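(* Let $(\varepsilon_i)_{i\in\mathbb{Z}}$ be a sequence of real-valued independent random variables such that $(\varepsilon_i^2)_{i\in\mathbb{Z}}$ is a uniformly integrable family and $\sigma_\varepsilon:=\sup_{i\in\mathbb{Z}}\|\varepsilon_i\|_2<\infty$. Let $(a_i)_{i\ge0}$ be a sequence of reals in $\ell^1$, and let $Y_k=\sum_{i\ge0}a_i\varepsilon_{k-i}$ for every integer $k$. Let $c:\mathbb{R}^+\to\mathbb{R}^+$ be a concave non-decreasing function with $\lim_{x\to0}c(x)=0$, and let $f:\mathbb{R}\to\mathbb{R}$ satisfy $$|f(x)-f(y)|\le c(|x-y|)\quad\text{for all }(x,y)\in\mathbb{R}^2.$$ Assume that $$c\Big(K\sum_{i\ge0}|a_i|\Big)<\infty\ \text{ for every finite real }K>0,\qquad\text{and}\qquad\sum_{k\ge1}k^{-1/2}c\Big(2\sigma_\varepsilon\sum_{i\ge k}|a_i|\Big)<\infty.$$ For $k\ge1$ define $X_k=f(Y_k)-\mathbb{E}(f(Y_k))$, and let $S_n=\sum_{k=1}^nX_k$ and $\sigma_n^2=\mathrm{Var}(S_n)$. If $\sigma_n^2=nh(n)$, where $h$ is a slowly varying function at infinity such that $\liminf_{n\to\infty}h(n)>0$, then $\big\{\sigma_n^{-1}\sum_{k=1}^{[nt]}X_k,\ t\in[0,1]\big\}$ converges in distribution in $D([0,1])$ to $W$, where $W$ is a standard Brownian motion.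
   Context: $\|\cdot\|_2$ is the $\mathbb{L}^2(\mathbb{P})$ norm and $[x]$ is the integer part of $x$. $D([0,1])$ is the space of right-continuous functions on $[0,1]$ with finite left-hand limits, endowed with the uniform topology. *)

theory Defs
  imports "HOL-Probability.Probability"
begin

text \<open>
  Uniform integrability of a family of real random variables. The integrals are taken in
  \<^typ>\<open>ennreal\<close>, so that integrability of the members is part of the condition and not presupposed.
\<close>

definition uniformly_integrable :: "'a measure \<Rightarrow> 'i set \<Rightarrow> ('i \<Rightarrow> 'a \<Rightarrow> real) \<Rightarrow> bool" where
  "uniformly_integrable M I X \<longleftrightarrow>
     (\<forall>i\<in>I. X i \<in> borel_measurable M) \<and>
     ((\<lambda>A::real. SUP i\<in>I. \<integral>\<^sup>+\<omega>. ennreal \<bar>X i \<omega>\<bar> * indicator {\<omega>. A < \<bar>X i \<omega>\<bar>} \<omega> \<partial>M) \<longlongrightarrow> 0) at_top"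

text \<open>Only meaningful for square integrable \<open>X\<close>.\<close>

definition norm2 :: "'a measure \<Rightarrow> ('a \<Rightarrow> real) \<Rightarrow> real" where
  "norm2 M X = sqrt (\<integral>\<omega>. (X \<omega>)\<^sup>2 \<partial>M)"

text \<open>Karamata's definition: positive and measurable near infinity, with the usual limit relation.\<close>

definition slowly_varying_at_infinity :: "(real \<Rightarrow> real) \<Rightarrow> bool" where
  "slowly_varying_at_infinity h \<longleftrightarrow>
     (\<exists>x0. (\<forall>x\<ge>x0. 0 < h x) \<and> h \<in> borel_measurable (lebesgue_on {x0..})) \<and>
     (\<forall>t>0. ((\<lambda>x. h (t * x) / h x) \<longlongrightarrow> 1) at_top)"

text \<open>
  The space \<open>D([0,1])\<close>. A function on \<open>[0,1]\<close> is represented by a total function that is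
  \<open>undefined\<close> outside \<open>[0,1]\<close>, as is required by \<^const>\<open>funspace\<close>, the metric space of
  bounded functions with the supremum distance.
\<close>

definition cadlag01 :: "(real \<Rightarrow> real) set" where
  "cadlag01 = {f \<in> extensional {0..1}.
     (\<forall>t\<in>{0..<1}. (f \<longlongrightarrow> f t) (at_right t)) \<and>
     (\<forall>t\<in>{0<..1}. \<exists>l. (f \<longlongrightarrow> l) (at_left t))}"

definition D01 :: "(real \<Rightarrow> real) topology" where
  "D01 = mtopology_of (submetric (funspace {0..1} euclidean_metric) cadlag01)"

lemma cadlag01_bounded:
  assumes "f \<in> cadlag01"
  shows "bounded (f ` {0..1})"
proof -
  have loc: "\<exists>U. open U \<and> t \<in> U \<and> bounded (f ` (U \<inter> {0..1}))" if t: "t \<in> {0..1}" for t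
  proof -
    have right: "\<exists>b>t. bounded (f ` ({t<..<b} \<inter> {0..1}))"
    proof (cases "t < 1")
      case True
      then have "(f \<longlongrightarrow> f t) (at_right t)"
        using assms t by (auto simp: cadlag01_def)
      then have "eventually (\<lambda>x. dist (f x) (f t) < 1) (at_right t)"
        by (auto simp: tendsto_iff)
      then obtain b where "b > t" and b: "\<And>y. y > t \<Longrightarrow> y < b \<Longrightarrow> dist (f y) (f t) < 1"
        unfolding eventually_at_right_field by blast
      then have "f ` ({t<..<b} \<inter> {0..1}) \<subseteq> ball (f t) 1"
        by (auto simp: dist_commute)
      then show ?thesis
        using \<open>b > t\<close> bounded_subset[OF bounded_ball] by blast
    next
      case False
      then have "{t<..<t + 1} \<inter> {0..1} = {}"
        using t by auto
      then show ?thesis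
        by (intro exI[of _ "t + 1"]) auto
    qed
    have left: "\<exists>a<t. bounded (f ` ({a<..<t} \<inter> {0..1}))"
    proof (cases "0 < t")
      case True
      then have "\<exists>l. (f \<longlongrightarrow> l) (at_left t)"
        using assms t by (auto simp: cadlag01_def)
      then obtain l where "(f \<longlongrightarrow> l) (at_left t)" ..
      then have "eventually (\<lambda>x. dist (f x) l < 1) (at_left t)"
        by (auto simp: tendsto_iff)
      then obtain a where "a < t" and a: "\<And>y. a < y \<Longrightarrow> y < t \<Longrightarrow> dist (f y) l < 1"
        unfolding eventually_at_left_field by blast
      then have "f ` ({a<..<t} \<inter> {0..1}) \<subseteq> ball l 1"
        by (auto simp: dist_commute)
      then show ?thesis
        using \<open>a < t\<close> bounded_subset[OF bounded_ball] by blast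
    next
      case False
      then have "{t - 1<..<t} \<inter> {0..1} = {}"
        using t by auto
      then show ?thesis
        by (intro exI[of _ "t - 1"]) auto
    qed
    obtain a b where ab: "a < t" "t < b" "bounded (f ` ({a<..<t} \<inter> {0..1}))"
        "bounded (f ` ({t<..<b} \<inter> {0..1}))"
      using left right by blast
    have "{a<..<b} \<inter> {0..1} \<subseteq> ({a<..<t} \<inter> {0..1}) \<union> ({t<..<b} \<inter> {0..1}) \<union> {t}"
      by auto
    then have "f ` ({a<..<b} \<inter> {0..1}) \<subseteq>
        f ` ({a<..<t} \<inter> {0..1}) \<union> f ` ({t<..<b} \<inter> {0..1}) \<union> {f t}"
      by (rule image_mono[THEN order_trans]) (simp add: image_Un)
    then have "bounded (f ` ({a<..<b} \<inter> {0..1}))"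
      by (rule bounded_subset[rotated]) (use ab(3,4) in simp)
    then show ?thesis
      using ab(1,2) by (intro exI[of _ "{a<..<b}"]) auto
  qed
  then obtain U where U: "\<And>t. t \<in> {0..1} \<Longrightarrow> open (U t) \<and> t \<in> U t \<and> bounded (f ` (U t \<inter> {0..1}))"
    by metis
  then have "\<And>t. t \<in> {0..1} \<Longrightarrow> open (U t)" "{0..1} \<subseteq> (\<Union>t\<in>{0..1}. U t)"
    by auto
  then obtain T where T: "T \<subseteq> {0..1}" "finite T" "{0..1} \<subseteq> (\<Union>t\<in>T. U t)"
    by (rule compactE_image[OF compact_Icc])
  then have "f ` {0..1} \<subseteq> (\<Union>t\<in>T. f ` (U t \<inter> {0..1}))"
    by blast
  moreover have "bounded (\<Union>t\<in>T. f ` (U t \<inter> {0..1}))"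
    using T U by (intro bounded_UN) auto
  ultimately show ?thesis
    by (rule bounded_subset[rotated])
qed

text \<open>Cadlag functions being bounded, \<^const>\<open>D01\<close> contains all of them.\<close>

lemma topspace_D01: "topspace D01 = cadlag01"
proof -
  have "cadlag01 \<subseteq> mspace (funspace {0..1} euclidean_metric)"
    using cadlag01_bounded
    by (auto simp: cadlag01_def Met_TC.fspace_def)
  then show ?thesis
    unfolding D01_def by (simp add: Int_absorb2)
qed

definition Borel_of :: "'c topology \<Rightarrow> 'c measure" where
  "Borel_of T = sigma (topspace T) {U. openin T U}"

definition converges_in_distribution ::
  "'c topology \<Rightarrow> 'a measure \<Rightarrow> (nat \<Rightarrow> 'a \<Rightarrow> 'c) \<Rightarrow> 'b measure \<Rightarrow> ('b \<Rightarrow> 'c) \<Rightarrow> bool" where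
  "converges_in_distribution T M Z N W \<longleftrightarrow>
     (\<forall>n. Z n \<in> measurable M (Borel_of T)) \<and> W \<in> measurable N (Borel_of T) \<and>
     (\<forall>F::'c \<Rightarrow> real. continuous_map T euclidean F \<and> bounded (F ` topspace T) \<longrightarrow>
        (\<lambda>n. \<integral>\<omega>. F (Z n \<omega>) \<partial>M) \<longlonglongrightarrow> (\<integral>\<omega>. F (W \<omega>) \<partial>N))"

text \<open>
  Standard Brownian motion with time set \<open>[0,1]\<close>. All paths are required to be continuous, which
  makes \<open>W\<close> a random element of \<open>D([0,1])\<close>.
\<close>

definition standard_brownian_motion :: "'b measure \<Rightarrow> (real \<Rightarrow> 'b \<Rightarrow> real) \<Rightarrow> bool" where
  "standard_brownian_motion N W \<longleftrightarrow>
     prob_space N \<and>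
     (\<forall>t\<in>{0..1}. W t \<in> borel_measurable N) \<and>
     (AE \<omega> in N. W 0 \<omega> = 0) \<and>
     (\<forall>\<omega>\<in>space N. continuous_on {0..1} (\<lambda>t. W t \<omega>)) \<and>
     (\<forall>s t. 0 \<le> s \<and> s < t \<and> t \<le> 1 \<longrightarrow>
        distributed N lborel (\<lambda>\<omega>. W t \<omega> - W s \<omega>) (normal_density 0 (sqrt (t - s)))) \<and>
     (\<forall>(m::nat) (t::nat \<Rightarrow> real). mono_on {..m} t \<and> t ` {..m} \<subseteq> {0..1} \<longrightarrow>
        prob_space.indep_vars N (\<lambda>_. borel) (\<lambda>i \<omega>. W (t (Suc i)) \<omega> - W (t i) \<omega>) {..<m})"

end

theory Submission
  imports Defs
begin

text \<open>
  The idea is to replace the partial sums, uniformly in time and up to a small multiple of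
  \<open>sqrt n\<close>, by sums of bounded independent variables, and to prove the invariance principle for those.

  Let \<open>A m\<close> be the tail sum of the \<open>\<bar>a i\<bar>\<close> from \<open>m\<close> on, and keep only the first \<open>m\<close> terms of the linear
  process. If \<open>m\<close> grows from \<open>2 ^ r\<close> to \<open>2 ^ Suc r\<close>, the argument of \<open>f\<close> changes in L2 by at most \<open>\<sigma>\<^sub>\<epsilon> * A (2 ^ r)\<close>,
  and concavity of the modulus \<open>c\<close> bounds the change of \<open>X k\<close> by a multiple of \<open>c (2 * \<sigma>\<^sub>\<epsilon> * A (2 ^ r))\<close>
  (\<open>norm2_modulus\<close>). The differences have dependence range \<open>2 ^ Suc r\<close>; splitting the indices into
  residue classes gives independent sequences, and Doob's inequality shows that the maximal partial
  sum up to time \<open>n\<close> of the differences is in L2 at most a multiple of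
  \<open>sqrt n * sqrt (2 ^ r) * c (2 * \<sigma>\<^sub>\<epsilon> * A (2 ^ r))\<close> (\<open>finite_range_maximal_inequality\<close>, \<open>dyadic_level\<close>). By Cauchy
  condensation the hypothesis on \<open>c\<close> says exactly that these bounds are summable over \<open>r\<close>. So a finite
  range suffices; uniform integrability then allows the innovations to be clipped, and
  omitting short gaps between long blocks produces independence
  (\<open>approximation_by_independent_blocks\<close>). If the accuracy improves slowly with \<open>n\<close>, one obtains a
  triangular array of bounded independent centered variables, negligible against \<open>sqrt n\<close>, whose
  partial sums approximate the original ones (\<open>diagonal_block_approximation\<close>).

  Since \<open>h\<close> is bounded away from 0 the error is also negligible against \<open>\<sigma> n\<close>, and slow variation makes
  the variance at time \<open>n * t\<close> proportional to \<open>t\<close> for rational \<open>t\<close> (\<open>variance_ratio\<close>). Variances of block sums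
  being additive, the increments over a grid have the variances of the Brownian increments. They
  are independent and asymptotically normal (\<open>bounded_triangular_CLT\<close>), hence converge jointly
  (\<open>joint_weak_convergence\<close>). Between grid points the fourth moment of the oscillation, again by
  Doob's inequality, is of the square order of the mesh (\<open>fourth_moment_oscillation\<close>), so a fine
  grid makes the discretisation error small for all large \<open>n\<close>. This proves convergence of expectations of Lipschitz
  functionals, which is enough: every bounded continuous functional is an increasing limit of
  Lipschitz ones (\<open>converges_in_distribution_D01I\<close>).
\<close>

section \<open>Independence of functions of disjoint groups of variables\<close>

text \<open>
  The sigma-algebra generated by the variables with index in \<open>A\<close>. Stating that a variable is measurable
  for it, instead of exhibiting it as an explicit function of these variables, lets the measurability
  rules for sums, maxima and compositions apply unchanged.
\<close>

definition (in prob_space) past :: "('i \<Rightarrow> 'a \<Rightarrow> real) \<Rightarrow> 'i set \<Rightarrow> 'a measure" where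
  "past X A = vimage_algebra (space M) (\<lambda>\<omega>. \<lambda>i\<in>A. X i \<omega>) (Pi\<^sub>M A (\<lambda>_. borel))"

context prob_space begin

lemma space_past [simp]: "space (past X A) = space M"
  by (simp add: past_def)

lemma measurable_past_restrict:
  "(\<lambda>\<omega>. \<lambda>i\<in>A. X i \<omega>) \<in> measurable (past X A) (Pi\<^sub>M A (\<lambda>_. borel))"
  unfolding past_def by (rule measurable_vimage_algebra1) (auto simp: space_PiM)

lemma measurable_past_component:
  assumes "i \<in> A"
  shows "X i \<in> borel_measurable (past X A)"
proof -
  have "(\<lambda>\<omega>. (\<lambda>i\<in>A. X i \<omega>) i) \<in> borel_measurable (past X A)"
    by (rule measurable_compose[OF measurable_past_restrict])
       (rule measurable_component_singleton[OF assms])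
  then show ?thesis using assms by simp
qed

lemma sets_past_subset:
  fixes T :: "'a \<Rightarrow> real"
  assumes "T \<in> borel_measurable (past X A)"
  shows "{T -` B \<inter> space M |B. B \<in> sets borel}
    \<subseteq> {(\<lambda>\<omega>. \<lambda>i\<in>A. X i \<omega>) -` B \<inter> space M |B. B \<in> sets (Pi\<^sub>M A (\<lambda>_. borel))}"
proof safe
  fix B :: "real set" assume "B \<in> sets borel"
  then have "T -` B \<inter> space M \<in> sets (past X A)"
    using measurable_sets[OF assms] by simp
  then show "\<exists>C. T -` B \<inter> space M = (\<lambda>\<omega>. \<lambda>i\<in>A. X i \<omega>) -` C \<inter> space M \<and> C \<in> sets (Pi\<^sub>M A (\<lambda>_. borel))"
    unfolding past_def by (subst (asm) sets_vimage_algebra2) (auto simp: space_PiM)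
qed

lemma past_mono:
  assumes "T \<in> borel_measurable (past X A)" "A \<subseteq> B"
  shows "T \<in> borel_measurable (past X B)"
proof -
  have "(\<lambda>\<omega>. \<lambda>i\<in>A. X i \<omega>) \<in> measurable (past X B) (Pi\<^sub>M A (\<lambda>_. borel))"
    by (intro measurable_restrict measurable_past_component) (use assms in auto)
  then have id: "id \<in> measurable (past X B) (past X A)"
    unfolding past_def[of X A] by (intro measurable_vimage_algebra2) auto
  show ?thesis using measurable_comp[OF id assms(1)] by simp
qed

lemma past_measurable:
  assumes "T \<in> borel_measurable (past X A)" "\<And>i. i \<in> A \<Longrightarrow> X i \<in> borel_measurable M"
  shows "T \<in> borel_measurable M"
proof -
  have "(\<lambda>\<omega>. \<lambda>i\<in>A. X i \<omega>) \<in> measurable M (Pi\<^sub>M A (\<lambda>_. borel))"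
    by (intro measurable_restrict) (use assms in auto)
  then have id: "id \<in> measurable M (past X A)"
    unfolding past_def[of X A] by (intro measurable_vimage_algebra2) auto
  show ?thesis using measurable_comp[OF id assms(1)] by simp
qed

text \<open>
  Restrictions of an independent family to disjoint index sets are independent, and a variable that
  is measurable for one such group generates a smaller sigma-algebra than the group does.
\<close>

lemma indep_vars_past:
  fixes T :: "'j \<Rightarrow> 'a \<Rightarrow> real"
  assumes ind: "indep_vars (\<lambda>_. borel) X I"
    and A: "\<And>j. j \<in> J \<Longrightarrow> A j \<subseteq> I" "disjoint_family_on A J"
    and T: "\<And>j. j \<in> J \<Longrightarrow> T j \<in> borel_measurable (past X (A j))"
  shows "indep_vars (\<lambda>_. borel) T J"
proof -
  have X: "\<And>i. i \<in> I \<Longrightarrow> X i \<in> borel_measurable M"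
    using ind by (auto simp: indep_vars_def2)
  have "indep_vars (\<lambda>j. Pi\<^sub>M (A j) (\<lambda>_. borel)) (\<lambda>j \<omega>. \<lambda>i\<in>A j. X i \<omega>) J"
    by (rule indep_vars_restrict[OF ind A])
  then have *: "indep_sets (\<lambda>j. {(\<lambda>\<omega>. \<lambda>i\<in>A j. X i \<omega>) -` B \<inter> space M |B. B \<in> sets (Pi\<^sub>M (A j) (\<lambda>_. borel))}) J"
    by (simp add: indep_vars_def2)
  have "indep_sets (\<lambda>j. {T j -` B \<inter> space M |B. B \<in> sets borel}) J"
    by (rule indep_sets_mono_sets[OF *]) (rule sets_past_subset[OF T])
  moreover have "\<forall>j\<in>J. T j \<in> borel_measurable M"
    using A T X by (blast intro: past_measurable)
  ultimately show ?thesis by (simp add: indep_vars_def2)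
qed

lemma indep_var_past:
  fixes S T :: "'a \<Rightarrow> real"
  assumes ind: "indep_vars (\<lambda>_. borel) X I" and A: "A \<subseteq> I" "B \<subseteq> I" "A \<inter> B = {}"
    and "S \<in> borel_measurable (past X A)" "T \<in> borel_measurable (past X B)"
  shows "indep_var borel S borel T"
proof -
  have "indep_vars (\<lambda>_. borel) (case_bool S T) UNIV"
    by (rule indep_vars_past[OF ind, of UNIV "case_bool A B"])
       (use assms in \<open>auto simp: disjoint_family_on_def split: bool.splits\<close>)
  moreover have "(\<lambda>_::bool. borel) = case_bool borel (borel :: real measure)"
    by (auto split: bool.splits)
  ultimately show ?thesis unfolding indep_var_def by simp
qed

end

section \<open>Doob's maximal inequality\<close>

primrec running_max :: "(nat \<Rightarrow> real) \<Rightarrow> nat \<Rightarrow> real" where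
  "running_max s 0 = s 0"
| "running_max s (Suc n) = max (running_max s n) (s (Suc n))"

lemma running_max_ge: "j \<le> n \<Longrightarrow> s j \<le> running_max s n"
  by (induction n) (auto simp: le_Suc_eq max_def)

lemma running_max_attained: "\<exists>j\<le>n. running_max s n = s j"
  by (induction n) (auto simp: max_def le_Suc_eq)

lemma running_max_le: "(\<And>j. j \<le> n \<Longrightarrow> s j \<le> b) \<Longrightarrow> running_max s n \<le> b"
  by (induction n) auto

lemma running_max_measurable:
  "(\<And>j. j \<le> n \<Longrightarrow> (\<lambda>\<omega>. s j \<omega>) \<in> borel_measurable M) \<Longrightarrow>
    (\<lambda>\<omega>. running_max (\<lambda>j. s j \<omega>) n) \<in> borel_measurable M"
  by (induction n) auto

lemma running_max_sum:
  "running_max (\<lambda>j. \<Sum>i\<in>I. s i j) n \<le> (\<Sum>i\<in>I. running_max (s i) n)"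
  by (intro running_max_le sum_mono running_max_ge)

lemma running_max_cmult:
  "0 \<le> c \<Longrightarrow> running_max (\<lambda>j. c * s j) n = c * running_max s n"
  by (induction n) (auto simp: max_mult_distrib_left)

lemma running_max_nonneg: "(\<And>j. 0 \<le> s j) \<Longrightarrow> 0 \<le> running_max s n"
  by (meson order_trans running_max_ge le0)

lemma running_max_mono_fun:
  "(\<And>j. j \<le> n \<Longrightarrow> s j \<le> t j) \<Longrightarrow> running_max s n \<le> running_max t n"
  by (intro running_max_le) (meson order_trans running_max_ge)

text \<open>
  Bernoulli's inequality for \<open>y / x\<close>, multiplied by \<open>x ^ Suc q\<close>.
\<close>

lemma power_Young:
  fixes x y :: real assumes "0 \<le> x" "0 \<le> y"
  shows "real (Suc q) * (x ^ q * y) \<le> y ^ Suc q + real q * x ^ Suc q"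
proof (cases "x = 0")
  case True then show ?thesis using assms by (cases q) auto
next
  case False
  then have x: "x > 0" using assms by simp
  have "1 + real (Suc q) * (y / x - 1) \<le> (1 + (y / x - 1)) ^ Suc q"
    by (rule Bernoulli_inequality) (use assms x in simp)
  then have "x ^ Suc q * (1 + real (Suc q) * (y / x - 1)) \<le> x ^ Suc q * (y / x) ^ Suc q"
    using x by (intro mult_left_mono) auto
  also have "\<dots> = y ^ Suc q"
    using x by (simp add: power_divide)
  also have "x ^ Suc q * (1 + real (Suc q) * (y / x - 1))
      = real (Suc q) * (x ^ q * y) - real q * x ^ Suc q"
    using x by (simp add: field_simps)
  finally show ?thesis by simp
qed

text \<open>
  A deterministic form of Doob's argument. The sum on the left is a discrete stochastic integral of
  the \<open>q\<close>-th power of the running maximum against the path; it has mean zero when the increments are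
  centered and independent of the past. Summation by parts works because the running maximum
  increases only at times when the path equals it; Young's inequality bounds the jump at these times.
\<close>

lemma pathwise_maximal_inequality_aux:
  assumes s0: "s 0 = (0::real)" and q: "q \<ge> 1"
  shows "(\<Sum>k<n. running_max s k ^ q * (s (Suc k) - s k))
    \<le> running_max s n ^ q * s n - real q / real (Suc q) * running_max s n ^ Suc q"
proof (induction n)
  case 0
  then show ?case using s0 q by (simp add: power_0_left)
next
  case (Suc n)
  let ?M = "running_max s n" and ?c = "real q / real (Suc q)"
  have M: "0 \<le> ?M" using running_max_ge[of 0 n s] s0 by simp
  have "(\<Sum>k<Suc n. running_max s k ^ q * (s (Suc k) - s k))
      \<le> ?M ^ q * s n - ?c * ?M ^ Suc q + ?M ^ q * (s (Suc n) - s n)"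
    using Suc by simp
  also have "\<dots> = ?M ^ q * s (Suc n) - ?c * ?M ^ Suc q" by (simp add: algebra_simps)
  also have "\<dots> \<le> running_max s (Suc n) ^ q * s (Suc n) - ?c * running_max s (Suc n) ^ Suc q"
  proof (cases "s (Suc n) \<le> ?M")
    case True then show ?thesis by (simp add: max_def)
  next
    case False
    then have y: "running_max s (Suc n) = s (Suc n)" "0 \<le> s (Suc n)" using M by (auto simp: max_def)
    have "real (Suc q) * (?M ^ q * s (Suc n)) \<le> s (Suc n) ^ Suc q + real q * ?M ^ Suc q"
      by (rule power_Young[OF M y(2)])
    then have "?M ^ q * s (Suc n) \<le> (s (Suc n) ^ Suc q + real q * ?M ^ Suc q) / real (Suc q)"
      by (simp add: pos_le_divide_eq mult.commute)
    also have "\<dots> = s (Suc n) ^ Suc q - ?c * s (Suc n) ^ Suc q + ?c * ?M ^ Suc q"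
    proof -
      have "1 - ?c = 1 / real (Suc q)" by (simp add: field_simps)
      then have "s (Suc n) ^ Suc q - ?c * s (Suc n) ^ Suc q = s (Suc n) ^ Suc q / real (Suc q)"
        by (metis left_diff_distrib mult_1 times_divide_eq_left)
      then show ?thesis by (simp add: add_divide_distrib)
    qed
    finally show ?thesis unfolding y(1) by (simp add: algebra_simps)
  qed
  finally show ?case .
qed

text \<open>
  Here the product \<open>M ^ q * s\<close> of the previous bound is absorbed: either \<open>4 * \<bar>s\<bar> \<le> M\<close>, and the product is
  at most a quarter of \<open>M ^ Suc q\<close>, or \<open>M\<close> is dominated by \<open>4 * \<bar>s\<bar>\<close>. What is left of \<open>M ^ Suc q\<close> has the
  coefficient \<open>q / Suc q - 1 / 4 \<ge> 1 / 4\<close>.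
\<close>

lemma pathwise_maximal_inequality:
  assumes s0: "s 0 = (0::real)" and q: "q \<ge> 1"
  shows "running_max s n ^ Suc q
    \<le> 4 ^ Suc q * \<bar>s n\<bar> ^ Suc q - 4 * (\<Sum>k<n. running_max s k ^ q * (s (Suc k) - s k))"
proof -
  let ?M = "running_max s n"
  have M: "0 \<le> ?M" using running_max_ge[of 0 n s] s0 by simp
  have A: "?M ^ q * s n \<le> ?M ^ Suc q / 4 + 4 ^ q * \<bar>s n\<bar> ^ Suc q"
  proof (cases "4 * \<bar>s n\<bar> \<le> ?M")
    case True
    then have "?M ^ q * s n \<le> ?M ^ q * (?M / 4)" using M by (intro mult_left_mono) auto
    also have "\<dots> = ?M ^ Suc q / 4" by simp
    finally show ?thesis by (smt (verit) mult_nonneg_nonneg zero_le_power abs_ge_zero)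
  next
    case False
    have "?M ^ q * s n \<le> ?M ^ q * \<bar>s n\<bar>" using M by (intro mult_left_mono) auto
    also have "\<dots> \<le> (4 * \<bar>s n\<bar>) ^ q * \<bar>s n\<bar>"
      using M False by (intro mult_right_mono power_mono) auto
    also have "\<dots> = 4 ^ q * \<bar>s n\<bar> ^ Suc q" by (simp add: power_mult_distrib)
    finally show ?thesis using M by (smt (verit) zero_le_power divide_nonneg_nonneg)
  qed
  have "1/2 \<le> real q / real (Suc q)" using q by (simp add: field_simps)
  then have "1/2 * ?M ^ Suc q \<le> real q / real (Suc q) * ?M ^ Suc q"
    using M by (intro mult_right_mono) auto
  with pathwise_maximal_inequality_aux[of s, OF s0 q, of n] A
  show ?thesis by simp
qed

context prob_space begin

lemma past_partial_sum:
  fixes \<xi> :: "nat \<Rightarrow> 'a \<Rightarrow> real"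
  shows "j \<le> n \<Longrightarrow> (\<lambda>\<omega>. \<Sum>k<j. \<xi> k \<omega>) \<in> borel_measurable (past \<xi> {..<n})"
  by (intro borel_measurable_sum measurable_past_component) auto

lemma power_sum_le:
  fixes x y :: real
  shows "\<bar>x + y\<bar> ^ p \<le> 2 ^ p * (\<bar>x\<bar> ^ p + \<bar>y\<bar> ^ p)"
proof -
  have "\<bar>x + y\<bar> ^ p \<le> (2 * max \<bar>x\<bar> \<bar>y\<bar>) ^ p" by (intro power_mono) auto
  also have "\<dots> = 2 ^ p * max \<bar>x\<bar> \<bar>y\<bar> ^ p" by (simp add: power_mult_distrib)
  also have "max \<bar>x\<bar> \<bar>y\<bar> ^ p \<le> \<bar>x\<bar> ^ p + \<bar>y\<bar> ^ p" by (auto simp: max_def)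
  finally show ?thesis by simp
qed

lemma integrable_power_partial_sum:
  fixes \<xi> :: "'i \<Rightarrow> 'a \<Rightarrow> real"
  assumes [measurable]: "\<And>k. k \<in> A \<Longrightarrow> \<xi> k \<in> borel_measurable M"
    and int: "\<And>k. k \<in> A \<Longrightarrow> integrable M (\<lambda>\<omega>. \<bar>\<xi> k \<omega>\<bar> ^ p)"
  shows "integrable M (\<lambda>\<omega>. \<bar>\<Sum>k\<in>A. \<xi> k \<omega>\<bar> ^ p)"
  using assms
proof (induction A rule: infinite_finite_induct)
  case (insert x F)
  note [measurable] = insert.prems(1)
  have "integrable M (\<lambda>\<omega>. 2 ^ p * (\<bar>\<xi> x \<omega>\<bar> ^ p + \<bar>\<Sum>k\<in>F. \<xi> k \<omega>\<bar> ^ p))"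
    using insert by auto
  then show ?case
  proof (rule Bochner_Integration.integrable_bound)
    show "(\<lambda>\<omega>. \<bar>\<Sum>k\<in>insert x F. \<xi> k \<omega>\<bar> ^ p) \<in> borel_measurable M"
      by (intro borel_measurable_power borel_measurable_abs borel_measurable_sum insert.prems(1))
    show "AE \<omega> in M. norm (\<bar>\<Sum>k\<in>insert x F. \<xi> k \<omega>\<bar> ^ p)
        \<le> norm (2 ^ p * (\<bar>\<xi> x \<omega>\<bar> ^ p + \<bar>\<Sum>k\<in>F. \<xi> k \<omega>\<bar> ^ p))"
      using insert.hyps by (auto simp: power_sum_le)
  qed
qed (cases p; simp)+

lemma integrable_lower_power:
  fixes f :: "'a \<Rightarrow> real"
  assumes [measurable]: "f \<in> borel_measurable M" and "integrable M (\<lambda>\<omega>. \<bar>f \<omega>\<bar> ^ p)" "q \<le> p"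
  shows "integrable M (\<lambda>\<omega>. f \<omega> ^ q)" "integrable M (\<lambda>\<omega>. \<bar>f \<omega>\<bar> ^ q)"
proof -
  have b: "\<bar>x\<bar> ^ q \<le> 1 + \<bar>x\<bar> ^ p" for x :: real
  proof (cases "\<bar>x\<bar> \<le> 1")
    case True then have "\<bar>x\<bar> ^ q \<le> 1" by (simp add: power_le_one)
    then show ?thesis by (smt (verit) zero_le_power abs_ge_zero)
  next
    case False then have "\<bar>x\<bar> ^ q \<le> \<bar>x\<bar> ^ p" using assms(3) by (intro power_increasing) auto
    then show ?thesis by simp
  qed
  have i: "integrable M (\<lambda>\<omega>. 1 + \<bar>f \<omega>\<bar> ^ p)" using assms by simp
  show "integrable M (\<lambda>\<omega>. f \<omega> ^ q)" "integrable M (\<lambda>\<omega>. \<bar>f \<omega>\<bar> ^ q)"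
    by (rule Bochner_Integration.integrable_bound[OF i]; use b in \<open>auto simp: power_abs\<close>)+
qed

lemma integrable_running_max:
  fixes s :: "nat \<Rightarrow> 'a \<Rightarrow> real"
  assumes "\<And>j. j \<le> n \<Longrightarrow> integrable M (s j)"
  shows "integrable M (\<lambda>\<omega>. running_max (\<lambda>j. s j \<omega>) n)"
  using assms by (induction n) auto

lemma integrable_running_max_power:
  fixes s :: "nat \<Rightarrow> 'a \<Rightarrow> real"
  assumes [measurable]: "\<And>j. j \<le> n \<Longrightarrow> s j \<in> borel_measurable M"
    and int: "\<And>j. j \<le> n \<Longrightarrow> integrable M (\<lambda>\<omega>. \<bar>s j \<omega>\<bar> ^ p)"
  shows "integrable M (\<lambda>\<omega>. \<bar>running_max (\<lambda>j. s j \<omega>) n\<bar> ^ p)"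
proof (rule Bochner_Integration.integrable_bound)
  show "integrable M (\<lambda>\<omega>. \<Sum>j\<le>n. \<bar>s j \<omega>\<bar> ^ p)"
    using int by auto
  show "(\<lambda>\<omega>. \<bar>running_max (\<lambda>j. s j \<omega>) n\<bar> ^ p) \<in> borel_measurable M"
    by (intro borel_measurable_power borel_measurable_abs running_max_measurable assms(1))
  have "\<bar>running_max (\<lambda>j. s j \<omega>) n\<bar> ^ p \<le> (\<Sum>j\<le>n. \<bar>s j \<omega>\<bar> ^ p)" for \<omega>
  proof -
    obtain j where "j \<le> n" "running_max (\<lambda>j. s j \<omega>) n = s j \<omega>" using running_max_attained by metis
    then show ?thesis by (auto intro!: member_le_sum)
  qed
  then show "AE \<omega> in M. norm (\<bar>running_max (\<lambda>j. s j \<omega>) n\<bar> ^ p) \<le> norm (\<Sum>j\<le>n. \<bar>s j \<omega>\<bar> ^ p)"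
    by (intro AE_I2) (simp add: sum_nonneg)
qed

text \<open>
  Take expectations in the pathwise inequality: the increment \<open>\<xi> k\<close> is independent of the running
  maximum up to time \<open>k\<close>, so every term of the stochastic integral vanishes.
\<close>

lemma maximal_inequality_onesided:
  fixes \<xi> :: "nat \<Rightarrow> 'a \<Rightarrow> real"
  assumes ind: "indep_vars (\<lambda>_. borel) \<xi> UNIV"
    and int: "\<And>k. integrable M (\<lambda>\<omega>. \<bar>\<xi> k \<omega>\<bar> ^ Suc q)" and cen: "\<And>k. expectation (\<xi> k) = 0"
    and q: "q \<ge> 1"
  shows "expectation (\<lambda>\<omega>. running_max (\<lambda>j. \<Sum>k<j. \<xi> k \<omega>) n ^ Suc q)
    \<le> 4 ^ Suc q * expectation (\<lambda>\<omega>. \<bar>\<Sum>k<n. \<xi> k \<omega>\<bar> ^ Suc q)"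
proof -
  have [measurable]: "\<xi> k \<in> borel_measurable M" for k
    using ind by (auto simp: indep_vars_def2)
  define S where "S j \<omega> = (\<Sum>k<j. \<xi> k \<omega>)" for j \<omega>
  have [measurable]: "S j \<in> borel_measurable M" for j unfolding S_def by measurable
  have iS: "integrable M (\<lambda>\<omega>. \<bar>S j \<omega>\<bar> ^ Suc q)" for j
    unfolding S_def by (intro integrable_power_partial_sum int) auto
  define R where "R k \<omega> = running_max (\<lambda>j. S j \<omega>) k" for k \<omega>
  have [measurable]: "R k \<in> borel_measurable M" for k
    unfolding R_def by (intro running_max_measurable) auto
  have iR: "integrable M (\<lambda>\<omega>. \<bar>R k \<omega>\<bar> ^ Suc q)" for k
    unfolding R_def by (intro integrable_running_max_power iS) auto
  have iRq: "integrable M (\<lambda>\<omega>. R k \<omega> ^ q)" for k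
    by (rule integrable_lower_power[OF _ iR[of k]]) auto
  have i\<xi>: "integrable M (\<xi> k)" for k
    using integrable_lower_power(1)[OF _ int[of k], of 1] by simp
  have step: "integrable M (\<lambda>\<omega>. R k \<omega> ^ q * \<xi> k \<omega>)" "expectation (\<lambda>\<omega>. R k \<omega> ^ q * \<xi> k \<omega>) = 0" for k
  proof -
    have iv: "indep_var borel (\<lambda>\<omega>. R k \<omega> ^ q) borel (\<xi> k)"
    proof (rule indep_var_past[OF ind, of "{..<k}" "{k}"])
      show "(\<lambda>\<omega>. R k \<omega> ^ q) \<in> borel_measurable (past \<xi> {..<k})"
        unfolding R_def S_def
        by (intro borel_measurable_power running_max_measurable past_partial_sum)
    qed (auto intro: measurable_past_component)
    show "integrable M (\<lambda>\<omega>. R k \<omega> ^ q * \<xi> k \<omega>)"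
      by (rule indep_var_integrable[OF iv iRq i\<xi>])
    show "expectation (\<lambda>\<omega>. R k \<omega> ^ q * \<xi> k \<omega>) = 0"
      using indep_var_lebesgue_integral[OF iv iRq i\<xi>] cen by simp
  qed
  have pw: "R n \<omega> ^ Suc q \<le> 4 ^ Suc q * \<bar>S n \<omega>\<bar> ^ Suc q - 4 * (\<Sum>k<n. R k \<omega> ^ q * \<xi> k \<omega>)" for \<omega>
    using pathwise_maximal_inequality[of "\<lambda>j. S j \<omega>" q n, OF _ q]
    by (simp add: R_def S_def)
  have "expectation (\<lambda>\<omega>. R n \<omega> ^ Suc q)
      \<le> expectation (\<lambda>\<omega>. 4 ^ Suc q * \<bar>S n \<omega>\<bar> ^ Suc q - 4 * (\<Sum>k<n. R k \<omega> ^ q * \<xi> k \<omega>))"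
  proof (rule integral_mono)
    show "integrable M (\<lambda>\<omega>. R n \<omega> ^ Suc q)"
      by (rule integrable_lower_power[OF _ iR[of n]]) auto
    show "integrable M (\<lambda>\<omega>. 4 ^ Suc q * \<bar>S n \<omega>\<bar> ^ Suc q - 4 * (\<Sum>k<n. R k \<omega> ^ q * \<xi> k \<omega>))"
      by (intro Bochner_Integration.integrable_diff integrable_mult_right Bochner_Integration.integrable_sum step iS)
  qed (rule pw)
  also have "\<dots> = 4 ^ Suc q * expectation (\<lambda>\<omega>. \<bar>S n \<omega>\<bar> ^ Suc q)
      - 4 * (\<Sum>k<n. expectation (\<lambda>\<omega>. R k \<omega> ^ q * \<xi> k \<omega>))"
    using iS step by (subst Bochner_Integration.integral_diff) (auto simp del: power_Suc)
  finally show ?thesis using step(2) by (simp add: R_def S_def)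
qed

text \<open>
  The two-sided version, for the path and its negative. It is used with \<open>q = 1\<close> to compare partial sum
  processes and with \<open>q = 3\<close> to bound their oscillation on short intervals.
\<close>

lemma maximal_inequality:
  fixes \<xi> :: "nat \<Rightarrow> 'a \<Rightarrow> real"
  assumes ind: "indep_vars (\<lambda>_. borel) \<xi> UNIV"
    and int: "\<And>k. integrable M (\<lambda>\<omega>. \<bar>\<xi> k \<omega>\<bar> ^ Suc q)" and cen: "\<And>k. expectation (\<xi> k) = 0"
    and q: "q \<ge> 1"
  shows "expectation (\<lambda>\<omega>. running_max (\<lambda>j. \<bar>\<Sum>k<j. \<xi> k \<omega>\<bar> ^ Suc q) n)
    \<le> 2 * 4 ^ Suc q * expectation (\<lambda>\<omega>. \<bar>\<Sum>k<n. \<xi> k \<omega>\<bar> ^ Suc q)"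
proof -
  have [measurable]: "\<xi> k \<in> borel_measurable M" for k
    using ind by (auto simp: indep_vars_def2)
  let ?\<eta> = "\<lambda>k \<omega>. - \<xi> k \<omega>"
  have ind': "indep_vars (\<lambda>_. borel) ?\<eta> UNIV"
    by (rule indep_vars_compose2[OF ind]) auto
  let ?A = "\<lambda>\<omega>. running_max (\<lambda>j. \<Sum>k<j. \<xi> k \<omega>) n" and ?B = "\<lambda>\<omega>. running_max (\<lambda>j. \<Sum>k<j. ?\<eta> k \<omega>) n"
  have A0: "0 \<le> ?A \<omega>" "0 \<le> ?B \<omega>" for \<omega>
    using running_max_ge[of 0 n "\<lambda>j. \<Sum>k<j. \<xi> k \<omega>"] running_max_ge[of 0 n "\<lambda>j. \<Sum>k<j. ?\<eta> k \<omega>"] by auto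
  have iS: "integrable M (\<lambda>\<omega>. \<bar>\<Sum>k<j. \<xi> k \<omega>\<bar> ^ Suc q)" for j
    by (intro integrable_power_partial_sum int) auto
  have iS': "integrable M (\<lambda>\<omega>. \<bar>\<Sum>k<j. ?\<eta> k \<omega>\<bar> ^ Suc q)" for j
    using iS[of j] by (simp only: sum_negf abs_minus)
  have "integrable M (\<lambda>\<omega>. \<bar>?A \<omega>\<bar> ^ Suc q)" "integrable M (\<lambda>\<omega>. \<bar>?B \<omega>\<bar> ^ Suc q)"
    by (intro integrable_running_max_power iS iS'; simp)+
  then have iAB: "integrable M (\<lambda>\<omega>. ?A \<omega> ^ Suc q)" "integrable M (\<lambda>\<omega>. ?B \<omega> ^ Suc q)"
    using A0 by simp_all
  have "expectation (\<lambda>\<omega>. running_max (\<lambda>j. \<bar>\<Sum>k<j. \<xi> k \<omega>\<bar> ^ Suc q) n)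
      \<le> expectation (\<lambda>\<omega>. ?A \<omega> ^ Suc q + ?B \<omega> ^ Suc q)"
  proof (rule integral_mono)
    show "integrable M (\<lambda>\<omega>. running_max (\<lambda>j. \<bar>\<Sum>k<j. \<xi> k \<omega>\<bar> ^ Suc q) n)"
      by (intro integrable_running_max iS)
    show "integrable M (\<lambda>\<omega>. ?A \<omega> ^ Suc q + ?B \<omega> ^ Suc q)" using iAB by simp
    fix \<omega>
    show "running_max (\<lambda>j. \<bar>\<Sum>k<j. \<xi> k \<omega>\<bar> ^ Suc q) n \<le> ?A \<omega> ^ Suc q + ?B \<omega> ^ Suc q"
    proof (rule running_max_le)
      fix j assume j: "j \<le> n"
      have 1: "(\<Sum>k<j. \<xi> k \<omega>) \<le> ?A \<omega>" "- (\<Sum>k<j. \<xi> k \<omega>) \<le> ?B \<omega>"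
        using running_max_ge[OF j, of "\<lambda>j. \<Sum>k<j. \<xi> k \<omega>"] running_max_ge[OF j, of "\<lambda>j. \<Sum>k<j. ?\<eta> k \<omega>"]
        by (auto simp: sum_negf)
      have "\<bar>\<Sum>k<j. \<xi> k \<omega>\<bar> ^ Suc q \<le> max (?A \<omega>) (?B \<omega>) ^ Suc q"
        using 1 by (intro power_mono) auto
      also have "\<dots> \<le> ?A \<omega> ^ Suc q + ?B \<omega> ^ Suc q"
        using A0 by (auto simp: max_def simp del: power_Suc)
      finally show "\<bar>\<Sum>k<j. \<xi> k \<omega>\<bar> ^ Suc q \<le> ?A \<omega> ^ Suc q + ?B \<omega> ^ Suc q" .
    qed
  qed
  also have "\<dots> = expectation (\<lambda>\<omega>. ?A \<omega> ^ Suc q) + expectation (\<lambda>\<omega>. ?B \<omega> ^ Suc q)"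
    using iAB by simp
  also have "\<dots> \<le> 4 ^ Suc q * expectation (\<lambda>\<omega>. \<bar>\<Sum>k<n. \<xi> k \<omega>\<bar> ^ Suc q)
     + 4 ^ Suc q * expectation (\<lambda>\<omega>. \<bar>\<Sum>k<n. ?\<eta> k \<omega>\<bar> ^ Suc q)"
    by (intro add_mono maximal_inequality_onesided ind ind' int cen q)
       (use int cen in \<open>auto simp del: power_Suc\<close>)
  also have "(\<lambda>\<omega>. \<bar>\<Sum>k<n. ?\<eta> k \<omega>\<bar> ^ Suc q) = (\<lambda>\<omega>. \<bar>\<Sum>k<n. \<xi> k \<omega>\<bar> ^ Suc q)"
    by (simp only: sum_negf abs_minus)
  finally show ?thesis by (simp add: algebra_simps)
qed

end

section \<open>The L2 norm\<close>

definition square_integrable :: "'a measure \<Rightarrow> ('a \<Rightarrow> real) \<Rightarrow> bool" where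
  "square_integrable M X \<longleftrightarrow> X \<in> borel_measurable M \<and> integrable M (\<lambda>\<omega>. (X \<omega>)\<^sup>2)"

lemma square_integrable_conj [dest]:
  "square_integrable M X \<Longrightarrow> X \<in> borel_measurable M \<and> integrable M (\<lambda>\<omega>. (X \<omega>)\<^sup>2)"
  by (auto simp: square_integrable_def)

lemma square_integrableD:
  "square_integrable M X \<Longrightarrow> X \<in> borel_measurable M"
  "square_integrable M X \<Longrightarrow> integrable M (\<lambda>\<omega>. (X \<omega>)\<^sup>2)"
  by (auto simp: square_integrable_def)

lemma square_integrable_bound:
  assumes "square_integrable M Y" "X \<in> borel_measurable M" "AE \<omega> in M. \<bar>X \<omega>\<bar> \<le> \<bar>Y \<omega>\<bar>"
  shows "square_integrable M X"
  unfolding square_integrable_def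
proof
  have "AE \<omega> in M. norm ((X \<omega>)\<^sup>2) \<le> norm ((Y \<omega>)\<^sup>2)"
    using assms(3) by eventually_elim (simp add: abs_le_square_iff)
  then show "integrable M (\<lambda>\<omega>. (X \<omega>)\<^sup>2)"
    using assms by (auto intro: Bochner_Integration.integrable_bound[of M "\<lambda>\<omega>. (Y \<omega>)\<^sup>2"])
qed fact

lemma square_integrable_cmult: "square_integrable M X \<Longrightarrow> square_integrable M (\<lambda>\<omega>. c * X \<omega>)"
  by (auto simp: square_integrable_def power_mult_distrib)

lemma square_integrable_abs: "square_integrable M X \<Longrightarrow> square_integrable M (\<lambda>\<omega>. \<bar>X \<omega>\<bar>)"
  by (auto simp: square_integrable_def)

lemma square_integrable_add:
  assumes "square_integrable M X" "square_integrable M Y"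
  shows "square_integrable M (\<lambda>\<omega>. X \<omega> + Y \<omega>)"
  unfolding square_integrable_def
proof
  show "(\<lambda>\<omega>. X \<omega> + Y \<omega>) \<in> borel_measurable M" using assms by (auto intro: borel_measurable_add)
  then have m: "(\<lambda>\<omega>. (X \<omega> + Y \<omega>)\<^sup>2) \<in> borel_measurable M" by simp
  show "integrable M (\<lambda>\<omega>. (X \<omega> + Y \<omega>)\<^sup>2)"
  proof (rule Bochner_Integration.integrable_bound[of M "\<lambda>\<omega>. 2 * (X \<omega>)\<^sup>2 + 2 * (Y \<omega>)\<^sup>2", OF _ m AE_I2])
    fix \<omega>
    have "(X \<omega> + Y \<omega>)\<^sup>2 \<le> 2 * (X \<omega>)\<^sup>2 + 2 * (Y \<omega>)\<^sup>2"
      using sum_squares_bound[of "X \<omega>" "Y \<omega>"] by (simp add: power2_sum)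
    then show "norm ((X \<omega> + Y \<omega>)\<^sup>2) \<le> norm (2 * (X \<omega>)\<^sup>2 + 2 * (Y \<omega>)\<^sup>2)" by simp
  qed (use assms[THEN square_integrableD(2)] in simp)
qed

lemma square_integrable_diff:
  assumes "square_integrable M X" "square_integrable M Y"
  shows "square_integrable M (\<lambda>\<omega>. X \<omega> - Y \<omega>)"
  using square_integrable_add[OF assms(1) square_integrable_cmult[OF assms(2), of "-1"]] by simp

lemma square_integrable_zero: "square_integrable M (\<lambda>_. 0)"
  by (simp add: square_integrable_def)

lemma square_integrable_sum:
  "(\<And>i. i \<in> I \<Longrightarrow> square_integrable M (X i)) \<Longrightarrow> square_integrable M (\<lambda>\<omega>. \<Sum>i\<in>I. X i \<omega>)"
  by (induction I rule: infinite_finite_induct) (auto simp: square_integrable_zero square_integrable_add)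

lemma square_integrable_max:
  assumes "square_integrable M X" "square_integrable M Y"
  shows "square_integrable M (\<lambda>\<omega>. max (X \<omega>) (Y \<omega>))"
  by (rule square_integrable_bound[OF square_integrable_add[OF assms[THEN square_integrable_abs]]])
     (use assms in \<open>auto simp: square_integrable_def\<close>)

lemma square_integrable_running_max:
  "(\<And>j. j \<le> n \<Longrightarrow> square_integrable M (s j)) \<Longrightarrow> square_integrable M (\<lambda>\<omega>. running_max (\<lambda>j. s j \<omega>) n)"
  by (induction n) (auto intro: square_integrable_max)

lemma norm2_nonneg [simp]: "0 \<le> norm2 M X"
  by (simp add: norm2_def)

lemma norm2_square: "(norm2 M X)\<^sup>2 = (\<integral>\<omega>. (X \<omega>)\<^sup>2 \<partial>M)"
  by (simp add: norm2_def)

lemma norm2_leI: "(\<integral>\<omega>. (X \<omega>)\<^sup>2 \<partial>M) \<le> b\<^sup>2 \<Longrightarrow> 0 \<le> b \<Longrightarrow> norm2 M X \<le> b"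
  unfolding norm2_def by (rule real_le_lsqrt) auto

lemma norm2_cmult: "norm2 M (\<lambda>\<omega>. c * X \<omega>) = \<bar>c\<bar> * norm2 M X"
  by (simp add: norm2_def power_mult_distrib real_sqrt_mult)

lemma norm2_abs [simp]: "norm2 M (\<lambda>\<omega>. \<bar>X \<omega>\<bar>) = norm2 M X"
  by (simp add: norm2_def)

lemma norm2_mono:
  assumes "square_integrable M Y" "X \<in> borel_measurable M" "AE \<omega> in M. \<bar>X \<omega>\<bar> \<le> \<bar>Y \<omega>\<bar>"
  shows "norm2 M X \<le> norm2 M Y"
proof -
  have "AE \<omega> in M. (X \<omega>)\<^sup>2 \<le> (Y \<omega>)\<^sup>2"
    using assms(3) by eventually_elim (simp add: abs_le_square_iff)
  then show ?thesis
    unfolding norm2_def using assms square_integrable_bound[OF assms]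
    by (intro real_sqrt_le_mono integral_mono_AE) auto
qed

text \<open>
  Minkowski's inequality. For \<open>a, b > 0\<close> convexity of the square gives
  \<open>(x + y)\<^sup>2 \<le> (a + b) * (x\<^sup>2 / a + y\<^sup>2 / b)\<close>; with \<open>a\<close> and \<open>b\<close> slightly above the two norms, integration yields
  the claim up to the excess.
\<close>

lemma norm2_triangle:
  assumes X: "square_integrable M X" and Y: "square_integrable M Y"
  shows "norm2 M (\<lambda>\<omega>. X \<omega> + Y \<omega>) \<le> norm2 M X + norm2 M Y"
proof (rule field_le_epsilon)
  fix e :: real assume e: "e > 0"
  define a where "a = norm2 M X + e / 2"
  define b where "b = norm2 M Y + e / 2"
  have ab: "a > 0" "b > 0" "norm2 M X \<le> a" "norm2 M Y \<le> b"
    using e by (auto simp: a_def b_def add_nonneg_pos)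
  have *: "(x + y)\<^sup>2 \<le> (a + b) * (x\<^sup>2 / a + y\<^sup>2 / b)" for x y :: real
  proof -
    have "(a + b) * (x\<^sup>2 / a + y\<^sup>2 / b) - (x + y)\<^sup>2 = (b * x - a * y)\<^sup>2 / (a * b)"
      using ab by (simp add: field_simps power2_eq_square)
    moreover have "\<dots> \<ge> 0" using ab by simp
    ultimately show ?thesis by linarith
  qed
  have "(\<integral>\<omega>. (X \<omega> + Y \<omega>)\<^sup>2 \<partial>M) \<le> (\<integral>\<omega>. (a + b) * ((X \<omega>)\<^sup>2 / a + (Y \<omega>)\<^sup>2 / b) \<partial>M)"
    using square_integrable_add[OF X Y] square_integrableD(2)[OF X] square_integrableD(2)[OF Y]
    by (intro integral_mono * integrable_mult_right Bochner_Integration.integrable_add integrable_divide_zero) auto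
  also have "\<dots> = (a + b) * ((norm2 M X)\<^sup>2 / a + (norm2 M Y)\<^sup>2 / b)"
    using square_integrableD(2)[OF X] square_integrableD(2)[OF Y] by (simp add: norm2_square)
  also have "\<dots> \<le> (a + b) * (a + b)"
  proof (intro mult_left_mono add_mono)
    have "(norm2 M X)\<^sup>2 \<le> a * a" "(norm2 M Y)\<^sup>2 \<le> b * b"
      using ab by (auto simp: power2_eq_square intro!: mult_mono)
    then show "(norm2 M X)\<^sup>2 / a \<le> a" "(norm2 M Y)\<^sup>2 / b \<le> b"
      using ab by (auto simp: field_simps)
  qed (use ab in auto)
  finally have "norm2 M (\<lambda>\<omega>. X \<omega> + Y \<omega>) \<le> a + b"
    using ab by (intro norm2_leI) (auto simp: power2_eq_square)
  then show "norm2 M (\<lambda>\<omega>. X \<omega> + Y \<omega>) \<le> norm2 M X + norm2 M Y + e"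
    by (simp add: a_def b_def)
qed

lemma norm2_sum:
  "(\<And>i. i \<in> I \<Longrightarrow> square_integrable M (X i)) \<Longrightarrow>
    norm2 M (\<lambda>\<omega>. \<Sum>i\<in>I. X i \<omega>) \<le> (\<Sum>i\<in>I. norm2 M (X i))"
proof (induction I rule: infinite_finite_induct)
  case (insert i I)
  have "norm2 M (\<lambda>\<omega>. \<Sum>i\<in>insert i I. X i \<omega>) \<le> norm2 M (X i) + norm2 M (\<lambda>\<omega>. \<Sum>i\<in>I. X i \<omega>)"
    using insert by (simp add: norm2_triangle square_integrable_sum)
  then show ?case using insert by simp
qed (auto simp: norm2_def)

lemma norm2_diff_triangle:
  assumes X: "square_integrable M X" and Y: "square_integrable M Y"
  shows "\<bar>norm2 M X - norm2 M Y\<bar> \<le> norm2 M (\<lambda>\<omega>. X \<omega> - Y \<omega>)"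
proof -
  note D = square_integrable_diff[OF X Y] square_integrable_diff[OF Y X]
  have "norm2 M (\<lambda>\<omega>. Y \<omega> - X \<omega>) = norm2 M (\<lambda>\<omega>. X \<omega> - Y \<omega>)"
    by (simp add: norm2_def power2_commute)
  then show ?thesis
    using norm2_triangle[OF D(1) Y] norm2_triangle[OF D(2) X] by simp
qed

context prob_space begin

lemma square_integrable_const: "square_integrable M (\<lambda>_. c)"
  by (simp add: square_integrable_def)

lemma square_integrable_bounded:
  "X \<in> borel_measurable M \<Longrightarrow> (\<And>\<omega>. \<bar>X \<omega>\<bar> \<le> b) \<Longrightarrow> square_integrable M X"
  by (rule square_integrable_bound[OF square_integrable_const[of b]]) (auto intro!: AE_I2 intro: order_trans[OF _ abs_ge_self])

lemma square_integrable_integrable: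
  assumes "square_integrable M X"
  shows "integrable M X"
  by (rule square_integrable_imp_integrable) (use assms in auto)

lemma norm2_bounded:
  assumes "X \<in> borel_measurable M" "\<And>\<omega>. \<bar>X \<omega>\<bar> \<le> b"
  shows "norm2 M X \<le> b"
proof -
  obtain \<omega> where "\<omega> \<in> space M" using not_empty by blast
  then have b: "0 \<le> b" using assms(2)[of \<omega>] by linarith
  have "norm2 M X \<le> norm2 M (\<lambda>_. b)"
    by (rule norm2_mono[OF square_integrable_const]) (use assms in \<open>auto intro!: AE_I2 intro: order_trans[OF _ abs_ge_self]\<close>)
  then show ?thesis using b by (simp add: norm2_def prob_space)
qed

lemma expectation_abs_le_norm2:
  assumes "square_integrable M X"
  shows "expectation (\<lambda>\<omega>. \<bar>X \<omega>\<bar>) \<le> norm2 M X"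
proof (rule field_le_epsilon)
  fix e :: real assume "e > 0"
  define a where "a = norm2 M X + e"
  have a: "a > 0" "norm2 M X \<le> a" using \<open>e > 0\<close> by (auto simp: a_def add_nonneg_pos)
  (* the tangent of the square at a, an arbitrary bound above the norm *)
  have *: "\<bar>x\<bar> \<le> x\<^sup>2 / (2 * a) + a / 2" for x :: real
  proof -
    have "0 \<le> (\<bar>x\<bar> - a)\<^sup>2" by simp
    then have "2 * a * \<bar>x\<bar> \<le> x\<^sup>2 + a\<^sup>2" by (simp add: power2_diff mult.commute mult.left_commute)
    then show ?thesis using a by (simp add: field_simps power2_eq_square)
  qed
  have "expectation (\<lambda>\<omega>. \<bar>X \<omega>\<bar>) \<le> expectation (\<lambda>\<omega>. (X \<omega>)\<^sup>2 / (2 * a) + a / 2)"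
    using assms square_integrable_integrable[OF assms] by (intro integral_mono *) auto
  also have "\<dots> = (norm2 M X)\<^sup>2 / (2 * a) + a / 2"
    using assms by (auto simp: norm2_square prob_space)
  also have "\<dots> \<le> a\<^sup>2 / (2 * a) + a / 2"
    using a by (intro add_mono divide_right_mono power_mono) auto
  also have "\<dots> = a" using a by (simp add: power2_eq_square)
  finally show "expectation (\<lambda>\<omega>. \<bar>X \<omega>\<bar>) \<le> norm2 M X + e" by (simp add: a_def)
qed

lemma square_integrable_centered:
  "square_integrable M X \<Longrightarrow> square_integrable M (\<lambda>\<omega>. X \<omega> - expectation X)"
  by (intro square_integrable_diff square_integrable_const)

lemma norm2_centered_le:
  assumes "square_integrable M X"
  shows "norm2 M (\<lambda>\<omega>. X \<omega> - expectation X) \<le> norm2 M X"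
proof (rule norm2_leI)
  have "variance X = expectation (\<lambda>\<omega>. (X \<omega>)\<^sup>2) - (expectation X)\<^sup>2"
    using assms square_integrable_integrable[OF assms] by (intro variance_eq) auto
  then show "expectation (\<lambda>\<omega>. (X \<omega> - expectation X)\<^sup>2) \<le> (norm2 M X)\<^sup>2"
    by (simp add: norm2_square)
qed simp

section \<open>Moments of sums of independent variables\<close>

lemma second_moment_indep_sum:
  fixes \<xi> :: "'i \<Rightarrow> 'a \<Rightarrow> real"
  assumes "finite I" "indep_vars (\<lambda>_. borel) \<xi> I"
    and "\<And>i. i \<in> I \<Longrightarrow> square_integrable M (\<xi> i)" "\<And>i. i \<in> I \<Longrightarrow> expectation (\<xi> i) = 0"
  shows "expectation (\<lambda>\<omega>. (\<Sum>i\<in>I. \<xi> i \<omega>)\<^sup>2) = (\<Sum>i\<in>I. expectation (\<lambda>\<omega>. (\<xi> i \<omega>)\<^sup>2))"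
  using assms
proof (induction I)
  case (insert i I)
  let ?T = "\<lambda>\<omega>. \<Sum>i\<in>I. \<xi> i \<omega>"
  have iv: "indep_var borel (\<xi> i) borel ?T"
    using insert by (intro indep_vars_sum) auto
  have sq: "square_integrable M (\<xi> i)" "square_integrable M ?T"
    using insert by (auto intro: square_integrable_sum)
  note int = square_integrable_integrable[OF sq(1)] square_integrable_integrable[OF sq(2)]
  have "expectation (\<lambda>\<omega>. (\<Sum>i\<in>insert i I. \<xi> i \<omega>)\<^sup>2)
      = expectation (\<lambda>\<omega>. (\<xi> i \<omega>)\<^sup>2 + (?T \<omega>)\<^sup>2 + 2 * (\<xi> i \<omega> * ?T \<omega>))"
    using insert by (simp add: power2_sum algebra_simps)
  also have "\<dots> = expectation (\<lambda>\<omega>. (\<xi> i \<omega>)\<^sup>2) + expectation (\<lambda>\<omega>. (?T \<omega>)\<^sup>2)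
      + 2 * expectation (\<lambda>\<omega>. \<xi> i \<omega> * ?T \<omega>)"
    using sq indep_var_integrable[OF iv int]
    by (subst Bochner_Integration.integral_add) (auto intro!: Bochner_Integration.integral_add)
  also have "expectation (\<lambda>\<omega>. \<xi> i \<omega> * ?T \<omega>) = 0"
    using indep_var_lebesgue_integral[OF iv int] insert.prems by simp
  finally show ?case using insert indep_vars_subset[OF insert.prems(1) subset_insertI] by simp
qed simp

text \<open>
  In the fourth power of \<open>\<xi> i + T\<close> all terms that are linear in one of the two independent centered factors
  vanish in the mean, which leaves \<open>T ^ 4 + 6 * (\<xi> i)\<^sup>2 * T\<^sup>2 + (\<xi> i) ^ 4\<close>; the cross term is exactly what
  turns \<open>3 * s\<^sup>2\<close> into \<open>3 * (v + s)\<^sup>2\<close>.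
\<close>

lemma fourth_moment_indep_sum:
  fixes \<xi> :: "'i \<Rightarrow> 'a \<Rightarrow> real"
  assumes "finite I" "indep_vars (\<lambda>_. borel) \<xi> I"
    and b: "\<And>i \<omega>. i \<in> I \<Longrightarrow> \<bar>\<xi> i \<omega>\<bar> \<le> b" and "\<And>i. i \<in> I \<Longrightarrow> expectation (\<xi> i) = 0"
  shows "expectation (\<lambda>\<omega>. (\<Sum>i\<in>I. \<xi> i \<omega>) ^ 4)
    \<le> 3 * (\<Sum>i\<in>I. expectation (\<lambda>\<omega>. (\<xi> i \<omega>)\<^sup>2))\<^sup>2 + b\<^sup>2 * (\<Sum>i\<in>I. expectation (\<lambda>\<omega>. (\<xi> i \<omega>)\<^sup>2))"
  using assms
proof (induction I)
  case (insert i I)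
  let ?T = "\<lambda>\<omega>. \<Sum>i\<in>I. \<xi> i \<omega>"
  have sub: "indep_vars (\<lambda>_. borel) \<xi> I"
    by (rule indep_vars_subset[OF insert.prems(1)]) auto
  have [measurable]: "\<xi> j \<in> borel_measurable M" if "j \<in> insert i I" for j
    using insert.prems(1) that unfolding indep_vars_def2 by blast
  have [measurable]: "\<xi> i \<in> borel_measurable M" by simp
  have [measurable]: "?T \<in> borel_measurable M" by (intro borel_measurable_sum) auto
  have bT: "\<bar>?T \<omega>\<bar> \<le> real (card I) * b" for \<omega>
    using insert.prems(2) by (intro order_trans[OF sum_abs] sum_bounded_above) auto
  have b\<xi>: "\<bar>\<xi> i \<omega>\<bar> \<le> b" for \<omega> using insert.prems(2) by auto
  have iv: "indep_var borel (\<xi> i) borel ?T"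
    using insert by (intro indep_vars_sum) auto
  have sq: "square_integrable M (\<xi> j)" if "j \<in> insert i I" for j
    using insert.prems(2) that by (intro square_integrable_bounded[of _ b]) auto
  have ip: "integrable M (\<lambda>\<omega>. \<xi> i \<omega> ^ k)" "integrable M (\<lambda>\<omega>. ?T \<omega> ^ l)" for k l
    by (rule integrable_const_bound[of _ "b ^ k"] integrable_const_bound[of _ "(real (card I) * b) ^ l"];
        use b\<xi> bT in \<open>auto simp: power_abs intro!: power_mono\<close>)+
  have ivp: "indep_var borel (\<lambda>\<omega>. \<xi> i \<omega> ^ k) borel (\<lambda>\<omega>. ?T \<omega> ^ l)" for k l
    using indep_var_compose[OF iv, of "\<lambda>x. x ^ k" borel "\<lambda>x. x ^ l" borel] by (simp add: comp_def)
  have I: "integrable M (\<lambda>\<omega>. \<xi> i \<omega> ^ k * ?T \<omega> ^ l)" for k l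
    by (rule indep_var_integrable[OF ivp ip])
  have E: "expectation (\<lambda>\<omega>. \<xi> i \<omega> ^ k * ?T \<omega> ^ l)
      = expectation (\<lambda>\<omega>. \<xi> i \<omega> ^ k) * expectation (\<lambda>\<omega>. ?T \<omega> ^ l)" for k l
    by (rule indep_var_lebesgue_integral[OF ivp ip])
  have T0: "expectation ?T = 0"
    using insert.prems square_integrable_integrable[OF sq] by (subst Bochner_Integration.integral_sum) auto
  define s where "s = (\<Sum>i\<in>I. expectation (\<lambda>\<omega>. (\<xi> i \<omega>)\<^sup>2))"
  define v where "v = expectation (\<lambda>\<omega>. (\<xi> i \<omega>)\<^sup>2)"
  have v0: "0 \<le> v" "0 \<le> s" unfolding v_def s_def by (auto intro: sum_nonneg)
  have T2: "expectation (\<lambda>\<omega>. ?T \<omega> ^ 2) = s"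
    unfolding s_def using insert sub sq by (intro second_moment_indep_sum) auto
  have \<xi>4: "expectation (\<lambda>\<omega>. \<xi> i \<omega> ^ 4) \<le> b\<^sup>2 * v"
  proof -
    have "expectation (\<lambda>\<omega>. \<xi> i \<omega> ^ 4) \<le> expectation (\<lambda>\<omega>. b\<^sup>2 * (\<xi> i \<omega>)\<^sup>2)"
    proof (rule integral_mono)
      fix \<omega>
      have "(\<xi> i \<omega>)\<^sup>2 \<le> b\<^sup>2" using power_mono[OF b\<xi>[of \<omega>], of 2] by simp
      then have "(\<xi> i \<omega>)\<^sup>2 * (\<xi> i \<omega>)\<^sup>2 \<le> b\<^sup>2 * (\<xi> i \<omega>)\<^sup>2" by (rule mult_right_mono) simp
      then show "\<xi> i \<omega> ^ 4 \<le> b\<^sup>2 * (\<xi> i \<omega>)\<^sup>2" by (simp flip: power_add)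
    qed (use ip in auto)
    then show ?thesis by (simp add: v_def)
  qed
  have ex: "(\<Sum>i\<in>insert i I. \<xi> i \<omega>) ^ 4 = ?T \<omega> ^ 4 + (4 * (\<xi> i \<omega> ^ 1 * ?T \<omega> ^ 3)
      + (6 * (\<xi> i \<omega> ^ 2 * ?T \<omega> ^ 2) + (4 * (\<xi> i \<omega> ^ 3 * ?T \<omega> ^ 1) + \<xi> i \<omega> ^ 4)))" for \<omega>
    using insert.hyps by (simp add: power4_eq_xxxx power3_eq_cube power2_eq_square algebra_simps)
  have "expectation (\<lambda>\<omega>. (\<Sum>i\<in>insert i I. \<xi> i \<omega>) ^ 4) = expectation (\<lambda>\<omega>. ?T \<omega> ^ 4)
      + (4 * expectation (\<lambda>\<omega>. \<xi> i \<omega> ^ 1 * ?T \<omega> ^ 3) + (6 * expectation (\<lambda>\<omega>. \<xi> i \<omega> ^ 2 * ?T \<omega> ^ 2)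
      + (4 * expectation (\<lambda>\<omega>. \<xi> i \<omega> ^ 3 * ?T \<omega> ^ 1) + expectation (\<lambda>\<omega>. \<xi> i \<omega> ^ 4))))"
    unfolding ex using I[of 1 3] I[of 2 2] I[of 3 1] ip(1)[of 4] ip(2)[of 4]
    by (simp only: Bochner_Integration.integral_add Bochner_Integration.integrable_add
        integrable_mult_right integral_mult_right_zero)
  also have "\<dots> = expectation (\<lambda>\<omega>. ?T \<omega> ^ 4) + (6 * (v * s) + expectation (\<lambda>\<omega>. \<xi> i \<omega> ^ 4))"
    unfolding E T2 using T0 insert.prems(3) by (simp add: v_def)
  also have "\<dots> \<le> 3 * s\<^sup>2 + b\<^sup>2 * s + (6 * (v * s) + b\<^sup>2 * v)"
    using insert.IH[OF sub] insert.prems \<xi>4 unfolding s_def by (intro add_mono) auto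
  also have "\<dots> \<le> 3 * (v + s)\<^sup>2 + b\<^sup>2 * (v + s)"
    by (simp add: power2_sum algebra_simps)
  finally show ?case using insert.hyps by (simp add: s_def v_def)
qed simp

end

lemma running_max_square: "(running_max (\<lambda>j. \<bar>s j\<bar>) n)\<^sup>2 = running_max (\<lambda>j. (s j)\<^sup>2) n"
proof (induction n)
  case (Suc n)
  have "(max x y)\<^sup>2 = max (x\<^sup>2) (y\<^sup>2)" if "0 \<le> x" "0 \<le> y" for x y :: real
    using that by (simp add: max_def)
  from this[of "running_max (\<lambda>j. \<bar>s j\<bar>) n" "\<bar>s (Suc n)\<bar>"]
  have "(max (running_max (\<lambda>j. \<bar>s j\<bar>) n) \<bar>s (Suc n)\<bar>)\<^sup>2
      = max ((running_max (\<lambda>j. \<bar>s j\<bar>) n)\<^sup>2) ((s (Suc n))\<^sup>2)"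
    by (simp add: running_max_nonneg)
  then show ?case using Suc by simp
qed simp

section \<open>Maximal inequality for dependence of finite range\<close>

context prob_space begin

text \<open>
  Terms at distance \<open>L\<close> or more are independent. Hence each residue class of indices modulo \<open>L\<close> carries an
  independent sequence, to which Doob's inequality applies; the \<open>L\<close> classes are put together by the
  Cauchy-Schwarz inequality. The price of the dependence is the factor \<open>sqrt L\<close>.
\<close>

lemma finite_range_maximal_inequality:
  fixes \<epsilon> :: "'i \<Rightarrow> 'a \<Rightarrow> real" and d :: "nat \<Rightarrow> 'a \<Rightarrow> real"
  assumes ind: "indep_vars (\<lambda>_. borel) \<epsilon> UNIV"
    and W: "\<And>k l. k + L \<le> l \<Longrightarrow> W k \<inter> W l = {}"
    and d: "\<And>k. d k \<in> borel_measurable (past \<epsilon> (W k))" "\<And>k. square_integrable M (d k)"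
      "\<And>k. expectation (d k) = 0" "\<And>k. norm2 M (d k) \<le> b"
    and L: "L \<ge> 1"
  shows "norm2 M (\<lambda>\<omega>. running_max (\<lambda>j. \<bar>\<Sum>k<j. d k \<omega>\<bar>) n) \<le> sqrt (32 * real L * real n) * b"
proof -
  have b: "0 \<le> b" using d(4)[of 0] norm2_nonneg[of M "d 0"] by linarith
  have [measurable]: "d k \<in> borel_measurable M" for k using d(2) by auto
  define e where "e q k \<omega> = (if k mod L = q then d k \<omega> else 0)" for q k \<omega>
  have [measurable]: "e q k \<in> borel_measurable M" for q k unfolding e_def by measurable
  have sqe: "square_integrable M (e q k)" for q k
    using d(2) by (cases "k mod L = q") (auto simp: e_def[abs_def] square_integrable_zero)
  have cene: "expectation (e q k) = 0" for q k
    using d(3) by (cases "k mod L = q") (auto simp: e_def[abs_def])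
  have inde: "indep_vars (\<lambda>_. borel) (e q) UNIV" for q
  proof (rule indep_vars_past[OF ind])
    let ?A = "\<lambda>k. if k mod L = q then W k else {}"
    have "?A k \<inter> ?A l = {}" if "k < l" for k l
    proof (cases "k mod L = q \<and> l mod L = q")
      case True
      then have "L dvd l - k" using that by (metis mod_eq_dvd_iff_nat less_imp_le)
      then have "L \<le> l - k" using that by (intro dvd_imp_le) auto
      then show ?thesis using W[of k l] that by auto
    qed auto
    then show "disjoint_family_on ?A UNIV"
      unfolding disjoint_family_on_def by (metis Int_commute nat_neq_iff)
    show "e q k \<in> borel_measurable (past \<epsilon> (?A k))" for k
      using d(1) by (auto simp: e_def[abs_def])
  qed auto
  have e2: "expectation (\<lambda>\<omega>. (e q k \<omega>)\<^sup>2) \<le> (if k mod L = q then b\<^sup>2 else 0)" for q k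
  proof (cases "k mod L = q")
    case True
    have "(norm2 M (d k))\<^sup>2 \<le> b\<^sup>2" using d(4) by (intro power_mono) auto
    then show ?thesis using True by (simp add: e_def norm2_square)
  qed (simp add: e_def)
  (* e q keeps the indices congruent to q and replaces the others by 0 *)
  have decomp: "d k \<omega> = (\<Sum>q<L. e q k \<omega>)" for k \<omega>
    using L by (simp add: e_def sum.delta)
  define R where "R q \<omega> = running_max (\<lambda>j. (\<Sum>k<j. e q k \<omega>)\<^sup>2) n" for q \<omega>
  have iR: "integrable M (R q)" for q
    unfolding R_def by (intro integrable_running_max square_integrableD square_integrable_sum sqe)
  have ER: "expectation (R q) \<le> 32 * (\<Sum>k<n. if k mod L = q then b\<^sup>2 else 0)" for q
  proof -
    have "expectation (R q) \<le> 2 * 4 ^ Suc 1 * expectation (\<lambda>\<omega>. \<bar>\<Sum>k<n. e q k \<omega>\<bar> ^ Suc 1)"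
      using maximal_inequality[OF inde[of q], of 1 n] sqe cene
      by (auto simp: R_def[abs_def] power2_eq_square square_integrable_def simp flip: abs_mult)
    also have "expectation (\<lambda>\<omega>. \<bar>\<Sum>k<n. e q k \<omega>\<bar> ^ Suc 1) = (\<Sum>k<n. expectation (\<lambda>\<omega>. (e q k \<omega>)\<^sup>2))"
      using second_moment_indep_sum[of "{..<n}" "e q"] sqe cene indep_vars_subset[OF inde]
      by (simp add: power2_eq_square flip: abs_mult)
    also have "\<dots> \<le> (\<Sum>k<n. if k mod L = q then b\<^sup>2 else 0)"
      by (intro sum_mono e2)
    finally show ?thesis by simp
  qed
  have "(\<integral>\<omega>. (running_max (\<lambda>j. \<bar>\<Sum>k<j. d k \<omega>\<bar>) n)\<^sup>2 \<partial>M) \<le> (\<integral>\<omega>. real L * (\<Sum>q<L. R q \<omega>) \<partial>M)"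
  proof (rule integral_mono)
    show "integrable M (\<lambda>\<omega>. (running_max (\<lambda>j. \<bar>\<Sum>k<j. d k \<omega>\<bar>) n)\<^sup>2)"
      by (intro square_integrableD square_integrable_running_max square_integrable_abs square_integrable_sum d)
    show "integrable M (\<lambda>\<omega>. real L * (\<Sum>q<L. R q \<omega>))" using iR by auto
    fix \<omega>
    have "(\<Sum>k<j. d k \<omega>)\<^sup>2 \<le> real L * (\<Sum>q<L. (\<Sum>k<j. e q k \<omega>)\<^sup>2)" for j
    proof -
      have "(\<Sum>k<j. d k \<omega>) = (\<Sum>q<L. (\<Sum>k<j. e q k \<omega>))"
        unfolding decomp by (rule sum.swap)
      then show ?thesis
        using Cauchy_Schwarz_ineq_sum[of "\<lambda>_. 1" "\<lambda>q. \<Sum>k<j. e q k \<omega>" "{..<L}"] by simp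
    qed
    then have "running_max (\<lambda>j. (\<Sum>k<j. d k \<omega>)\<^sup>2) n
        \<le> running_max (\<lambda>j. real L * (\<Sum>q<L. (\<Sum>k<j. e q k \<omega>)\<^sup>2)) n"
      by (intro running_max_mono_fun)
    also have "\<dots> \<le> real L * (\<Sum>q<L. R q \<omega>)"
      unfolding R_def running_max_cmult[OF of_nat_0_le_iff]
      by (intro mult_left_mono running_max_sum) auto
    finally show "(running_max (\<lambda>j. \<bar>\<Sum>k<j. d k \<omega>\<bar>) n)\<^sup>2 \<le> real L * (\<Sum>q<L. R q \<omega>)"
      unfolding running_max_square .
  qed
  also have "\<dots> = real L * (\<Sum>q<L. expectation (R q))" using iR by simp
  also have "\<dots> \<le> real L * (\<Sum>q<L. 32 * (\<Sum>k<n. if k mod L = q then b\<^sup>2 else 0))"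
    by (intro mult_left_mono sum_mono ER) auto
  also have "(\<Sum>q<L. 32 * (\<Sum>k<n. if k mod L = q then b\<^sup>2 else 0)) = 32 * (\<Sum>k<n. b\<^sup>2)"
    unfolding sum_distrib_left[symmetric]
    by (subst sum.swap) (use L in \<open>simp add: sum.delta\<close>)
  also have "real L * (32 * (\<Sum>k<n. b\<^sup>2)) = (sqrt (32 * real L * real n) * b)\<^sup>2"
    by (simp add: power_mult_distrib)
  finally show ?thesis using b by (intro norm2_leI) auto
qed

end

section \<open>Norm of the maximal partial sum\<close>

text \<open>
  The distance in which partial sum processes are compared: it is subadditive in the sequence \<open>d\<close>, and
  divided by \<open>sqrt n\<close> it controls the supremum distance of the rescaled paths.
\<close>

definition maximal_norm :: "'a measure \<Rightarrow> (nat \<Rightarrow> 'a \<Rightarrow> real) \<Rightarrow> nat \<Rightarrow> real" where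
  "maximal_norm M d n = norm2 M (\<lambda>\<omega>. running_max (\<lambda>j. \<bar>\<Sum>k<j. d k \<omega>\<bar>) n)"

lemma square_integrable_maximal:
  "(\<And>k. square_integrable M (d k)) \<Longrightarrow> square_integrable M (\<lambda>\<omega>. running_max (\<lambda>j. \<bar>\<Sum>k<j. d k \<omega>\<bar>) n)"
  by (intro square_integrable_running_max square_integrable_abs square_integrable_sum)

lemma maximal_norm_le:
  assumes "\<And>k. square_integrable M (d k)" "square_integrable M Z"
    and "\<And>j \<omega>. j \<le> n \<Longrightarrow> \<bar>\<Sum>k<j. d k \<omega>\<bar> \<le> Z \<omega>"
  shows "maximal_norm M d n \<le> norm2 M Z"
  unfolding maximal_norm_def
proof (rule norm2_mono[OF assms(2)])
  have "0 \<le> running_max (\<lambda>j. \<bar>\<Sum>k<j. d k \<omega>\<bar>) n" "running_max (\<lambda>j. \<bar>\<Sum>k<j. d k \<omega>\<bar>) n \<le> Z \<omega>" for \<omega>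
    using assms(3) by (auto intro: running_max_nonneg running_max_le)
  then show "AE \<omega> in M. \<bar>running_max (\<lambda>j. \<bar>\<Sum>k<j. d k \<omega>\<bar>) n\<bar> \<le> \<bar>Z \<omega>\<bar>"
    by (intro AE_I2) (smt (verit))
qed (rule square_integrableD(1)[OF square_integrable_maximal[OF assms(1)]])

lemma maximal_norm_sum:
  assumes "\<And>i k. i \<in> I \<Longrightarrow> square_integrable M (d i k)"
  shows "maximal_norm M (\<lambda>k \<omega>. \<Sum>i\<in>I. d i k \<omega>) n \<le> (\<Sum>i\<in>I. maximal_norm M (d i) n)"
proof -
  let ?Z = "\<lambda>i \<omega>. running_max (\<lambda>j. \<bar>\<Sum>k<j. d i k \<omega>\<bar>) n"
  have sq: "square_integrable M (?Z i)" if "i \<in> I" for i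
    using assms that by (intro square_integrable_maximal)
  have "maximal_norm M (\<lambda>k \<omega>. \<Sum>i\<in>I. d i k \<omega>) n \<le> norm2 M (\<lambda>\<omega>. \<Sum>i\<in>I. ?Z i \<omega>)"
  proof (rule maximal_norm_le)
    fix j \<omega> assume "j \<le> n"
    have "\<bar>\<Sum>k<j. \<Sum>i\<in>I. d i k \<omega>\<bar> = \<bar>\<Sum>i\<in>I. \<Sum>k<j. d i k \<omega>\<bar>"
      by (subst sum.swap) simp
    also have "\<dots> \<le> (\<Sum>i\<in>I. \<bar>\<Sum>k<j. d i k \<omega>\<bar>)" by (rule sum_abs)
    also have "\<dots> \<le> (\<Sum>i\<in>I. ?Z i \<omega>)"
      using \<open>j \<le> n\<close> by (intro sum_mono running_max_ge[of j n "\<lambda>j. \<bar>\<Sum>k<j. d _ k \<omega>\<bar>"])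
    finally show "\<bar>\<Sum>k<j. \<Sum>i\<in>I. d i k \<omega>\<bar> \<le> (\<Sum>i\<in>I. ?Z i \<omega>)" .
  qed (use sq assms in \<open>auto intro: square_integrable_sum\<close>)
  also have "\<dots> \<le> (\<Sum>i\<in>I. maximal_norm M (d i) n)"
    unfolding maximal_norm_def by (intro norm2_sum sq)
  finally show ?thesis .
qed

lemma maximal_norm_add:
  assumes "\<And>k. square_integrable M (d k)" "\<And>k. square_integrable M (e k)"
  shows "maximal_norm M (\<lambda>k \<omega>. d k \<omega> + e k \<omega>) n \<le> maximal_norm M d n + maximal_norm M e n"
proof -
  have "square_integrable M (case_bool d e i k)" for i k
    using assms by (cases i) auto
  from maximal_norm_sum[of UNIV M "case_bool d e" n, OF this] show ?thesis
    by (simp add: UNIV_bool add.commute)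
qed

lemma maximal_norm_le_sum:
  assumes "\<And>k. square_integrable M (d k)"
  shows "maximal_norm M d n \<le> (\<Sum>k<n. norm2 M (d k))"
proof -
  have "maximal_norm M d n \<le> norm2 M (\<lambda>\<omega>. \<Sum>k<n. \<bar>d k \<omega>\<bar>)"
  proof (rule maximal_norm_le)
    fix j \<omega> assume "j \<le> n"
    have "\<bar>\<Sum>k<j. d k \<omega>\<bar> \<le> (\<Sum>k<j. \<bar>d k \<omega>\<bar>)" by (rule sum_abs)
    also have "\<dots> \<le> (\<Sum>k<n. \<bar>d k \<omega>\<bar>)" using \<open>j \<le> n\<close> by (intro sum_mono2) auto
    finally show "\<bar>\<Sum>k<j. d k \<omega>\<bar> \<le> (\<Sum>k<n. \<bar>d k \<omega>\<bar>)" .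
  qed (intro square_integrable_sum square_integrable_abs assms)+
  also have "\<dots> \<le> (\<Sum>k<n. norm2 M (d k))"
    using norm2_sum[of "{..<n}" M "\<lambda>k \<omega>. \<bar>d k \<omega>\<bar>"] assms by (simp add: square_integrable_abs)
  finally show ?thesis .
qed

text \<open>
  Fatou's lemma for the squares.
\<close>

lemma norm2_AE_limit:
  assumes X: "\<And>i. square_integrable M (X i)" and b: "\<And>i. norm2 M (X i) \<le> b"
    and [measurable]: "Y \<in> borel_measurable M" and lim: "AE \<omega> in M. (\<lambda>i. X i \<omega>) \<longlonglongrightarrow> Y \<omega>"
  shows "square_integrable M Y" "norm2 M Y \<le> b"
proof -
  have b0: "0 \<le> b" using b[of 0] norm2_nonneg[of M "X 0"] by linarith
  have [measurable]: "X i \<in> borel_measurable M" for i using X by auto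
  have "(\<integral>\<^sup>+\<omega>. ennreal ((Y \<omega>)\<^sup>2) \<partial>M) = (\<integral>\<^sup>+\<omega>. liminf (\<lambda>i. ennreal ((X i \<omega>)\<^sup>2)) \<partial>M)"
  proof (rule nn_integral_cong_AE)
    show "AE \<omega> in M. ennreal ((Y \<omega>)\<^sup>2) = liminf (\<lambda>i. ennreal ((X i \<omega>)\<^sup>2))"
      using lim
    proof eventually_elim
      case (elim \<omega>)
      then have "(\<lambda>i. ennreal ((X i \<omega>)\<^sup>2)) \<longlonglongrightarrow> ennreal ((Y \<omega>)\<^sup>2)"
        by (intro tendsto_ennrealI tendsto_power)
      then show ?case by (rule lim_imp_Liminf[OF trivial_limit_sequentially, symmetric])
    qed
  qed
  also have "\<dots> \<le> liminf (\<lambda>i. \<integral>\<^sup>+\<omega>. ennreal ((X i \<omega>)\<^sup>2) \<partial>M)"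
    by (rule nn_integral_liminf) simp
  also have "\<dots> \<le> liminf (\<lambda>i::nat. ennreal (b\<^sup>2))"
  proof (intro Liminf_mono always_eventually allI)
    fix i
    have "(\<integral>\<^sup>+\<omega>. ennreal ((X i \<omega>)\<^sup>2) \<partial>M) = ennreal ((norm2 M (X i))\<^sup>2)"
      using X by (subst nn_integral_eq_integral) (auto simp: norm2_square)
    also have "\<dots> \<le> ennreal (b\<^sup>2)" using b b0 by (intro ennreal_leI power_mono) auto
    finally show "(\<integral>\<^sup>+\<omega>. ennreal ((X i \<omega>)\<^sup>2) \<partial>M) \<le> ennreal (b\<^sup>2)" .
  qed
  finally have *: "(\<integral>\<^sup>+\<omega>. ennreal ((Y \<omega>)\<^sup>2) \<partial>M) \<le> ennreal (b\<^sup>2)" by (simp add: Liminf_const)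
  then have int: "integrable M (\<lambda>\<omega>. (Y \<omega>)\<^sup>2)"
    by (intro integrableI_bounded) (auto intro: le_less_trans)
  then show "square_integrable M Y" by (simp add: square_integrable_def)
  have "ennreal (\<integral>\<omega>. (Y \<omega>)\<^sup>2 \<partial>M) \<le> ennreal (b\<^sup>2)"
    using * nn_integral_eq_integral[OF int] by simp
  then show "norm2 M Y \<le> b" using b0 by (intro norm2_leI) auto
qed

section \<open>Concave moduli of continuity\<close>

text \<open>
  A concave function that vanishes at 0 has a nonincreasing ratio \<open>c z / z\<close>.
\<close>

lemma concave_modulus_growth:
  fixes c :: "real \<Rightarrow> real"
  assumes conc: "concave_on {0..} c" and mono: "mono_on {0..} c" and c0: "c 0 = 0"
    and "0 < r" "0 \<le> z"
  shows "c z \<le> c r * max 1 (z / r)"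
proof (cases "z \<le> r")
  case True
  then have "c z \<le> c r" using assms by (intro mono_onD[OF mono]) auto
  then show ?thesis using True assms by (simp add: max_def divide_le_eq_1)
next
  case False
  have "r / z * c z + (1 - r / z) * c 0 \<le> c (r / z * z + (1 - r / z) * 0)"
    using concave_onD[OF conc, of "1 - r / z" z 0] assms False by simp
  then have "r / z * c z \<le> c r" using c0 False assms by simp
  then have "c z \<le> c r * (z / r)" using False assms by (simp add: field_simps)
  then show ?thesis using False assms by (simp add: max_def)
qed

definition tail_sum :: "(nat \<Rightarrow> real) \<Rightarrow> nat \<Rightarrow> real" where
  "tail_sum a m = (\<Sum>i. \<bar>a (m + i)\<bar>)"

definition clip :: "real \<Rightarrow> real \<Rightarrow> real" where
  "clip B x = max (- B) (min B x)"

lemma clip_bound: "0 \<le> B \<Longrightarrow> \<bar>clip B x\<bar> \<le> B"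
  by (auto simp: clip_def)

lemma clip_measurable [measurable]: "clip B \<in> borel_measurable borel"
  unfolding clip_def by measurable

text \<open>
  The setting of the theorem, with each hypothesis in the form in which the approximation uses it:
  uniform integrability enters through the clipping error of the innovations, and the series
  condition through its dyadic version.
\<close>

locale functional_of_linear_process = prob_space M for M :: "'a measure" +
  fixes \<epsilon> :: "int \<Rightarrow> 'a \<Rightarrow> real" and s :: real and a :: "nat \<Rightarrow> real"
    and Y :: "int \<Rightarrow> 'a \<Rightarrow> real" and c f :: "real \<Rightarrow> real"
  assumes indep: "indep_vars (\<lambda>_. borel) \<epsilon> UNIV"
    and sq_innov: "\<And>i. square_integrable M (\<epsilon> i)"
    and norm_innov: "\<And>i. norm2 M (\<epsilon> i) \<le> s"
    and clip_innov: "\<And>e. e > 0 \<Longrightarrow> \<exists>B\<ge>0. \<forall>i. norm2 M (\<lambda>\<omega>. \<epsilon> i \<omega> - clip B (\<epsilon> i \<omega>)) \<le> e"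
    and summ: "summable (\<lambda>i. \<bar>a i\<bar>)"
    and Y: "\<And>k \<omega>. Y k \<omega> = (\<Sum>i. a i * \<epsilon> (k - int i) \<omega>)"
    and conc: "concave_on {0..} c" and mono: "mono_on {0..} c"
    and c0: "c 0 = 0" and c_lim: "\<And>e. e > 0 \<Longrightarrow> \<exists>d>0. \<forall>x. 0 \<le> x \<and> x \<le> d \<longrightarrow> c x \<le> e"
    and modulus: "\<And>x y. \<bar>f x - f y\<bar> \<le> c \<bar>x - y\<bar>"
    and summ_dyadic: "summable (\<lambda>r. sqrt (2 ^ r) * c (2 * s * tail_sum a (2 ^ r)))"
begin

lemma s_nonneg: "0 \<le> s"
  using norm_innov[of 0] norm2_nonneg[of M "\<epsilon> 0"] by linarith

lemma innov_measurable [measurable]: "\<epsilon> i \<in> borel_measurable M"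
  using sq_innov by auto

lemma c_mono: "0 \<le> x \<Longrightarrow> x \<le> y \<Longrightarrow> c x \<le> c y"
  using mono_onD[OF mono, of x y] by auto

lemma c_nonneg: "0 \<le> x \<Longrightarrow> 0 \<le> c x"
  using c_mono[of 0 x] c0 by simp

lemma f_continuous: "continuous_on UNIV f"
  unfolding continuous_on_iff
proof (intro ballI allI impI)
  fix x e :: real assume "e > 0"
  then obtain d where "d > 0" and d: "\<And>z. 0 \<le> z \<Longrightarrow> z \<le> d \<Longrightarrow> c z \<le> e / 2" using c_lim[of "e / 2"] by auto
  then show "\<exists>d>0. \<forall>x'\<in>UNIV. dist x' x < d \<longrightarrow> dist (f x') (f x) < e"
    using modulus \<open>e > 0\<close> by (intro exI[of _ d]) (smt (verit) dist_real_def field_sum_of_halves)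
qed

lemma f_measurable [measurable]: "f \<in> borel_measurable borel"
  by (rule borel_measurable_continuous_onI[OF f_continuous])

lemma summable_tail: "summable (\<lambda>i. \<bar>a (m + i)\<bar>)"
  using summ summable_iff_shift[of "\<lambda>i. \<bar>a i\<bar>" m] by (simp add: add.commute)

lemma tail_sum_nonneg: "0 \<le> tail_sum a m"
  unfolding tail_sum_def by (intro suminf_nonneg summable_tail) auto

lemma sum_le_tail_sum:
  assumes "finite I" "\<And>i. i \<in> I \<Longrightarrow> m \<le> i"
  shows "(\<Sum>i\<in>I. \<bar>a i\<bar>) \<le> tail_sum a m"
proof -
  have "(\<Sum>i\<in>I. \<bar>a i\<bar>) = (\<Sum>j\<in>(\<lambda>i. i - m) ` I. \<bar>a (m + j)\<bar>)"
    using assms(2) by (subst sum.reindex) (auto simp: inj_on_def eq_diff_iff)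
  also have "\<dots> \<le> tail_sum a m"
    unfolding tail_sum_def using summable_tail assms by (intro sum_le_suminf) auto
  finally show ?thesis .
qed

lemma tail_sum_lim: "tail_sum a \<longlonglongrightarrow> 0"
proof -
  have "tail_sum a m = (\<Sum>i. \<bar>a i\<bar>) - (\<Sum>i<m. \<bar>a i\<bar>)" for m
    using suminf_minus_initial_segment[OF summ, of m] by (simp add: tail_sum_def add.commute)
  moreover have "(\<lambda>m. (\<Sum>i. \<bar>a i\<bar>) - (\<Sum>i<m. \<bar>a i\<bar>)) \<longlonglongrightarrow> 0"
    using tendsto_diff[OF tendsto_const summable_LIMSEQ[OF summ], of "\<Sum>i. \<bar>a i\<bar>"] by simp
  ultimately show ?thesis by presburger
qed

text \<open>
  If \<open>z\<close> is the difference of the arguments, then \<open>c \<bar>z\<bar> \<le> c r * max 1 (\<bar>z\<bar> / r)\<close>, and the square of the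
  second factor has mean at most 2. This is how a bound in the L2 norm passes through the concave modulus.
\<close>

lemma norm2_modulus:
  assumes [measurable]: "Z \<in> borel_measurable M" "Z' \<in> borel_measurable M"
    and sq: "square_integrable M (\<lambda>\<omega>. Z \<omega> - Z' \<omega>)" and r: "norm2 M (\<lambda>\<omega>. Z \<omega> - Z' \<omega>) \<le> r"
  shows "square_integrable M (\<lambda>\<omega>. f (Z \<omega>) - f (Z' \<omega>))"
    "norm2 M (\<lambda>\<omega>. f (Z \<omega>) - f (Z' \<omega>)) \<le> sqrt 2 * c r"
proof -
  have r0: "0 \<le> r" using r norm2_nonneg order_trans by blast
  have m: "(\<lambda>\<omega>. f (Z \<omega>) - f (Z' \<omega>)) \<in> borel_measurable M" by measurable
  have "square_integrable M (\<lambda>\<omega>. f (Z \<omega>) - f (Z' \<omega>)) \<and>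
    norm2 M (\<lambda>\<omega>. f (Z \<omega>) - f (Z' \<omega>)) \<le> sqrt 2 * c r"
  proof (cases "r = 0")
    case True
    then have "norm2 M (\<lambda>\<omega>. Z \<omega> - Z' \<omega>) = 0" using r by (simp add: order_antisym)
    then have "(\<integral>\<omega>. (Z \<omega> - Z' \<omega>)\<^sup>2 \<partial>M) = 0" by (simp add: norm2_def)
    then have "AE \<omega> in M. (Z \<omega> - Z' \<omega>)\<^sup>2 = 0"
      using sq by (subst (asm) integral_nonneg_eq_0_iff_AE) auto
    then have ae: "AE \<omega> in M. \<bar>f (Z \<omega>) - f (Z' \<omega>)\<bar> \<le> \<bar>0\<bar>" by eventually_elim simp
    show ?thesis
      using square_integrable_bound[OF square_integrable_zero m ae] norm2_mono[OF square_integrable_zero m ae] True c0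
      by (simp add: norm2_def)
  next
    case False
    then have rp: "r > 0" using r0 by simp
    have le: "(f (Z \<omega>) - f (Z' \<omega>))\<^sup>2 \<le> (c r)\<^sup>2 * (1 + (Z \<omega> - Z' \<omega>)\<^sup>2 / r\<^sup>2)" for \<omega>
    proof -
      let ?z = "\<bar>Z \<omega> - Z' \<omega>\<bar>"
      have "\<bar>f (Z \<omega>) - f (Z' \<omega>)\<bar> \<le> c r * max 1 (?z / r)"
        using modulus[of "Z \<omega>" "Z' \<omega>"] concave_modulus_growth[OF conc mono c0 rp, of ?z] by simp
      then have "(f (Z \<omega>) - f (Z' \<omega>))\<^sup>2 \<le> (c r * max 1 (?z / r))\<^sup>2"
        by (metis abs_ge_zero power2_abs power_mono)
      also have "\<dots> = (c r)\<^sup>2 * (max 1 (?z / r))\<^sup>2" by (simp add: power_mult_distrib)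
      also have "(max 1 (?z / r))\<^sup>2 \<le> 1 + (Z \<omega> - Z' \<omega>)\<^sup>2 / r\<^sup>2"
        by (auto simp: max_def power_divide)
      finally show ?thesis by (simp add: mult_left_mono)
    qed
    have ib: "integrable M (\<lambda>\<omega>. (c r)\<^sup>2 * (1 + (Z \<omega> - Z' \<omega>)\<^sup>2 / r\<^sup>2))"
      using square_integrableD(2)[OF sq] by simp
    have i: "integrable M (\<lambda>\<omega>. (f (Z \<omega>) - f (Z' \<omega>))\<^sup>2)"
      by (rule Bochner_Integration.integrable_bound[OF ib]) (use le in \<open>auto intro: order_trans[OF _ abs_ge_self]\<close>)
    have "(\<integral>\<omega>. (f (Z \<omega>) - f (Z' \<omega>))\<^sup>2 \<partial>M) \<le> (\<integral>\<omega>. (c r)\<^sup>2 * (1 + (Z \<omega> - Z' \<omega>)\<^sup>2 / r\<^sup>2) \<partial>M)"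
      by (rule integral_mono[OF i ib le])
    also have "\<dots> = (c r)\<^sup>2 * (1 + (norm2 M (\<lambda>\<omega>. Z \<omega> - Z' \<omega>))\<^sup>2 / r\<^sup>2)"
      using square_integrableD(2)[OF sq] by (simp add: norm2_square prob_space)
    also have "\<dots> \<le> (c r)\<^sup>2 * (1 + 1)"
      using r rp by (intro mult_left_mono add_left_mono) (auto intro!: power_mono)
    also have "\<dots> = (sqrt 2 * c r)\<^sup>2" by (simp add: power_mult_distrib)
    finally show ?thesis using c_nonneg[OF r0] i by (auto intro!: norm2_leI simp: square_integrable_def)
  qed
  then show "square_integrable M (\<lambda>\<omega>. f (Z \<omega>) - f (Z' \<omega>))"
    "norm2 M (\<lambda>\<omega>. f (Z \<omega>) - f (Z' \<omega>)) \<le> sqrt 2 * c r" by auto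
qed

lemma square_integrable_f:
  assumes "square_integrable M Z"
  shows "square_integrable M (\<lambda>\<omega>. f (Z \<omega>))"
proof -
  have "square_integrable M (\<lambda>\<omega>. f (Z \<omega>) - f 0)"
    using norm2_modulus(1)[of Z "\<lambda>_. 0" "norm2 M Z"] assms by auto
  from square_integrable_add[OF this square_integrable_const[of "f 0"]] show ?thesis by simp
qed

subsection \<open>Truncating the linear process\<close>

definition trunc :: "nat \<Rightarrow> int \<Rightarrow> 'a \<Rightarrow> real" where
  "trunc m k \<omega> = (\<Sum>i<m. a i * \<epsilon> (k - int i) \<omega>)"

definition centered :: "('a \<Rightarrow> real) \<Rightarrow> 'a \<Rightarrow> real" where
  "centered Z \<omega> = f (Z \<omega>) - expectation (\<lambda>\<omega>'. f (Z \<omega>'))"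

lemma square_integrable_linear:
  "square_integrable M (\<lambda>\<omega>. \<Sum>i\<in>I. a i * \<epsilon> (k - int i) \<omega>)"
  by (intro square_integrable_sum square_integrable_cmult sq_innov)

lemma norm2_linear: "norm2 M (\<lambda>\<omega>. \<Sum>i\<in>I. a i * \<epsilon> (k - int i) \<omega>) \<le> s * (\<Sum>i\<in>I. \<bar>a i\<bar>)"
proof -
  have "norm2 M (\<lambda>\<omega>. \<Sum>i\<in>I. a i * \<epsilon> (k - int i) \<omega>) \<le> (\<Sum>i\<in>I. norm2 M (\<lambda>\<omega>. a i * \<epsilon> (k - int i) \<omega>))"
    by (intro norm2_sum square_integrable_cmult sq_innov)
  also have "\<dots> \<le> (\<Sum>i\<in>I. \<bar>a i\<bar> * s)"
    by (intro sum_mono) (simp add: norm2_cmult mult_left_mono norm_innov)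
  finally show ?thesis by (simp add: sum_distrib_left mult.commute)
qed

lemma trunc_diff: "m \<le> m' \<Longrightarrow> trunc m' k \<omega> - trunc m k \<omega> = (\<Sum>i\<in>{m..<m'}. a i * \<epsilon> (k - int i) \<omega>)"
  unfolding trunc_def
  by (metis (no_types, lifting) atLeast0LessThan sum_diff_nat_ivl zero_le)

lemma square_integrable_trunc: "square_integrable M (trunc m k)"
  unfolding trunc_def[abs_def] by (rule square_integrable_linear)

lemma trunc_measurable [measurable]: "trunc m k \<in> borel_measurable M"
  using square_integrable_trunc by auto

lemma norm2_trunc_diff:
  assumes "m \<le> m'"
  shows "square_integrable M (\<lambda>\<omega>. trunc m' k \<omega> - trunc m k \<omega>)"
    "norm2 M (\<lambda>\<omega>. trunc m' k \<omega> - trunc m k \<omega>) \<le> s * tail_sum a m"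
proof -
  show "square_integrable M (\<lambda>\<omega>. trunc m' k \<omega> - trunc m k \<omega>)"
    by (intro square_integrable_diff square_integrable_trunc)
  have "norm2 M (\<lambda>\<omega>. trunc m' k \<omega> - trunc m k \<omega>) \<le> s * (\<Sum>i\<in>{m..<m'}. \<bar>a i\<bar>)"
    unfolding trunc_diff[OF assms] by (rule norm2_linear)
  also have "\<dots> \<le> s * tail_sum a m"
    using s_nonneg by (intro mult_left_mono sum_le_tail_sum) auto
  finally show "norm2 M (\<lambda>\<omega>. trunc m' k \<omega> - trunc m k \<omega>) \<le> s * tail_sum a m" .
qed

lemma Y_measurable [measurable]: "Y k \<in> borel_measurable M"
  unfolding Y[abs_def] by measurable

text \<open>
  The series has finite expected absolute sum, because the L1 norms of the innovations are bounded by
  their L2 norms.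
\<close>

lemma AE_summable_linear: "AE \<omega> in M. summable (\<lambda>i. a i * \<epsilon> (k - int i) \<omega>)"
proof -
  have i: "integrable M (\<lambda>\<omega>. \<bar>a i * \<epsilon> (k - int i) \<omega>\<bar>)" for i
    using square_integrable_integrable[OF sq_innov] by (intro integrable_abs integrable_mult_right)
  have "(\<integral>\<^sup>+\<omega>. (\<Sum>i. ennreal \<bar>a i * \<epsilon> (k - int i) \<omega>\<bar>) \<partial>M)
      = (\<Sum>i. \<integral>\<^sup>+\<omega>. ennreal \<bar>a i * \<epsilon> (k - int i) \<omega>\<bar> \<partial>M)"
    by (rule nn_integral_suminf) simp
  also have "\<dots> \<le> (\<Sum>i. ennreal (\<bar>a i\<bar> * s))"
  proof (intro suminf_le)
    fix i
    have "expectation (\<lambda>\<omega>. \<bar>a i * \<epsilon> (k - int i) \<omega>\<bar>) \<le> norm2 M (\<lambda>\<omega>. a i * \<epsilon> (k - int i) \<omega>)"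
      by (intro expectation_abs_le_norm2 square_integrable_cmult sq_innov)
    also have "\<dots> \<le> \<bar>a i\<bar> * s" by (simp add: norm2_cmult mult_left_mono norm_innov)
    finally show "(\<integral>\<^sup>+\<omega>. ennreal \<bar>a i * \<epsilon> (k - int i) \<omega>\<bar> \<partial>M) \<le> ennreal (\<bar>a i\<bar> * s)"
      by (subst nn_integral_eq_integral[OF i]) (auto intro: ennreal_leI)
  qed auto
  also have "\<dots> < \<infinity>"
    using summ s_nonneg by (subst suminf_ennreal2) (auto intro: summable_mult2)
  finally have "AE \<omega> in M. (\<Sum>i. ennreal \<bar>a i * \<epsilon> (k - int i) \<omega>\<bar>) \<noteq> \<infinity>"
    by (intro nn_integral_PInf_AE) auto
  then show ?thesis
  proof eventually_elim
    case (elim \<omega>)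
    have "summable (\<lambda>i. \<bar>a i * \<epsilon> (k - int i) \<omega>\<bar>)"
      by (rule summable_suminf_not_top) (use elim in auto)
    then show ?case by (rule summable_rabs_cancel)
  qed
qed

lemma norm2_Y_trunc:
  shows "square_integrable M (\<lambda>\<omega>. Y k \<omega> - trunc m k \<omega>)"
    "norm2 M (\<lambda>\<omega>. Y k \<omega> - trunc m k \<omega>) \<le> s * tail_sum a m"
proof -
  have lim: "AE \<omega> in M. (\<lambda>i. trunc (m + i) k \<omega> - trunc m k \<omega>) \<longlonglongrightarrow> Y k \<omega> - trunc m k \<omega>"
    using AE_summable_linear[of k]
  proof eventually_elim
    case (elim \<omega>)
    have "(\<lambda>n. trunc n k \<omega>) \<longlonglongrightarrow> Y k \<omega>"
      unfolding trunc_def Y using summable_LIMSEQ[OF elim] .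
    then have "(\<lambda>i. trunc (i + m) k \<omega>) \<longlonglongrightarrow> Y k \<omega>" by (rule LIMSEQ_ignore_initial_segment)
    then show ?case by (intro tendsto_diff tendsto_const) (simp add: add.commute)
  qed
  show "square_integrable M (\<lambda>\<omega>. Y k \<omega> - trunc m k \<omega>)"
    "norm2 M (\<lambda>\<omega>. Y k \<omega> - trunc m k \<omega>) \<le> s * tail_sum a m"
    by (rule norm2_AE_limit[OF norm2_trunc_diff _ lim]; simp)+
qed

lemma square_integrable_Y: "square_integrable M (Y k)"
  using square_integrable_add[OF norm2_Y_trunc(1)[of k 0] square_integrable_trunc[of 0 k]] by simp

lemma centered_props:
  assumes "square_integrable M Z"
  shows "square_integrable M (centered Z)" "expectation (centered Z) = 0"
proof -
  note sq = square_integrable_f[OF assms]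
  show "square_integrable M (centered Z)"
    unfolding centered_def[abs_def] by (rule square_integrable_centered[OF sq])
  show "expectation (centered Z) = 0"
    unfolding centered_def using square_integrable_integrable[OF sq] by (simp add: prob_space)
qed

lemma norm2_centered_diff:
  assumes Z: "square_integrable M Z" "square_integrable M Z'" "norm2 M (\<lambda>\<omega>. Z \<omega> - Z' \<omega>) \<le> r"
  shows "norm2 M (\<lambda>\<omega>. centered Z \<omega> - centered Z' \<omega>) \<le> sqrt 2 * c r"
proof -
  note sq = square_integrable_f[OF Z(1)] square_integrable_f[OF Z(2)]
  note * = norm2_modulus[OF _ _ square_integrable_diff[OF Z(1,2)] Z(3)]
  have "(\<lambda>\<omega>. centered Z \<omega> - centered Z' \<omega>)
    = (\<lambda>\<omega>. (f (Z \<omega>) - f (Z' \<omega>)) - expectation (\<lambda>\<omega>. f (Z \<omega>) - f (Z' \<omega>)))"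
    using sq[THEN square_integrable_integrable] by (simp add: centered_def fun_eq_iff)
  then have "norm2 M (\<lambda>\<omega>. centered Z \<omega> - centered Z' \<omega>) \<le> norm2 M (\<lambda>\<omega>. f (Z \<omega>) - f (Z' \<omega>))"
    using norm2_centered_le[OF square_integrable_diff[OF sq]] by simp
  also have "\<dots> \<le> sqrt 2 * c r" using *(2) Z by auto
  finally show ?thesis .
qed

end

context functional_of_linear_process begin

lemma past_linear:
  assumes [measurable]: "\<And>i. g i \<in> borel_measurable borel"
  shows "(\<lambda>\<omega>. \<Sum>i<m. (g i (\<epsilon> (k - int i) \<omega>) :: real)) \<in> borel_measurable (past \<epsilon> {k - int m<..k})"
proof (intro borel_measurable_sum)
  fix i assume "i \<in> {..<m}"
  then have "\<epsilon> (k - int i) \<in> borel_measurable (past \<epsilon> {k - int m<..k})"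
    by (intro measurable_past_component) auto
  then show "(\<lambda>\<omega>. g i (\<epsilon> (k - int i) \<omega>)) \<in> borel_measurable (past \<epsilon> {k - int m<..k})"
    by (rule measurable_compose) (rule assms)
qed

lemma past_trunc: "trunc m k \<in> borel_measurable (past \<epsilon> {k - int m<..k})"
  unfolding trunc_def[abs_def] by (rule past_linear) measurable

lemma past_centered:
  assumes "Z \<in> borel_measurable (past \<epsilon> A)"
  shows "centered Z \<in> borel_measurable (past \<epsilon> A)"
  unfolding centered_def[abs_def]
  by (intro borel_measurable_diff borel_measurable_const measurable_compose[OF assms f_measurable])

lemma window_disjoint:
  "k + L \<le> l \<Longrightarrow> {int (Suc k) - int L<..int (Suc k)} \<inter> {int (Suc l) - int L<..int (Suc l)} = {}"
  by auto

text \<open>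
  Between two consecutive dyadic truncations the variables change by at most
  \<open>sqrt 2 * c (2 * s * tail_sum a (2 ^ r))\<close> and depend on \<open>2 ^ Suc r\<close> consecutive innovations. The maximal
  inequality therefore yields the \<open>r\<close>-th term of the dyadic series, times \<open>sqrt n\<close>.
\<close>

lemma dyadic_level:
  "maximal_norm M (\<lambda>k \<omega>. centered (trunc (2 ^ Suc r) (int (Suc k))) \<omega> - centered (trunc (2 ^ r) (int (Suc k))) \<omega>) n
    \<le> 16 * sqrt (real n) * (sqrt (2 ^ r) * c (2 * s * tail_sum a (2 ^ r)))"
proof -
  let ?d = "\<lambda>k \<omega>. centered (trunc (2 ^ Suc r) (int (Suc k))) \<omega> - centered (trunc (2 ^ r) (int (Suc k))) \<omega>"
  let ?c = "c (2 * s * tail_sum a (2 ^ r))"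
  have c0: "0 \<le> ?c" by (intro c_nonneg) (simp add: s_nonneg tail_sum_nonneg)
  have "maximal_norm M ?d n \<le> sqrt (32 * real (2 ^ Suc r) * real n) * (sqrt 2 * ?c)"
    unfolding maximal_norm_def
  proof (rule finite_range_maximal_inequality[OF indep window_disjoint])
    fix k
    have "trunc (2 ^ r) (int (Suc k)) \<in> borel_measurable (past \<epsilon> {int (Suc k) - int (2 ^ Suc r)<..int (Suc k)})"
      by (rule past_mono[OF past_trunc]) auto
    then show "?d k \<in> borel_measurable (past \<epsilon> {int (Suc k) - int (2 ^ Suc r)<..int (Suc k)})"
      by (intro borel_measurable_diff past_centered past_trunc)
    note p = centered_props[OF square_integrable_trunc]
    show "square_integrable M (?d k)" by (intro square_integrable_diff p)
    show "expectation (?d k) = 0"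
      using p square_integrable_integrable[OF p(1)] by simp
    show "norm2 M (?d k) \<le> sqrt 2 * ?c"
    proof (rule norm2_centered_diff[OF square_integrable_trunc square_integrable_trunc])
      have "0 \<le> s * tail_sum a (2 ^ r)" by (simp add: s_nonneg tail_sum_nonneg)
      then show "norm2 M (\<lambda>\<omega>. trunc (2 ^ Suc r) (int (Suc k)) \<omega> - trunc (2 ^ r) (int (Suc k)) \<omega>) \<le> 2 * s * tail_sum a (2 ^ r)"
        using norm2_trunc_diff(2)[of "2 ^ r" "2 ^ Suc r" "int (Suc k)"] by simp
    qed
  qed (simp_all del: power_Suc)
  also have "\<dots> = sqrt 128 * sqrt (real n) * (sqrt (2 ^ r) * ?c)"
  proof -
    have "sqrt (32 * real (2 ^ Suc r) * real n) = sqrt 64 * (sqrt (2 ^ r) * sqrt (real n))"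
      unfolding real_sqrt_mult[symmetric] by simp
    moreover have "sqrt 128 = sqrt 64 * sqrt 2" unfolding real_sqrt_mult[symmetric] by simp
    ultimately show ?thesis by simp
  qed
  also have "\<dots> \<le> 16 * sqrt (real n) * (sqrt (2 ^ r) * ?c)"
  proof -
    have "sqrt 128 \<le> 16" by (rule real_le_lsqrt) auto
    then show ?thesis using c0 by (intro mult_right_mono) auto
  qed
  finally show ?thesis .
qed

text \<open>
  Telescoping over the dyadic levels between \<open>r\<close> and \<open>R\<close>: the levels contribute a tail of a convergent
  series, uniformly in \<open>n\<close>. For fixed \<open>n\<close> the level \<open>R\<close> may be taken so large that the crude bound by the sum
  of the norms suffices for what remains beyond it.
\<close>

lemma approx_trunc:
  assumes "\<delta> > 0"
  shows "\<exists>m\<ge>1. \<forall>n. maximal_norm M (\<lambda>k \<omega>. centered (Y (int (Suc k))) \<omega> - centered (trunc m (int (Suc k))) \<omega>) n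
    \<le> \<delta> * sqrt (real n)"
proof -
  define \<beta> where "\<beta> r = sqrt (2 ^ r) * c (2 * s * tail_sum a (2 ^ r))" for r
  have "summable \<beta>" using summ_dyadic by (simp add: \<beta>_def[abs_def])
  then obtain r where r: "\<And>R. norm (sum \<beta> {r..<R}) < \<delta> / 32"
    using assms unfolding summable_Cauchy by (metis order_refl divide_pos_pos zero_less_numeral)
  let ?D = "\<lambda>m k \<omega>. centered (Y (int (Suc k))) \<omega> - centered (trunc m (int (Suc k))) \<omega>"
  let ?d = "\<lambda>r k \<omega>. centered (trunc (2 ^ Suc r) (int (Suc k))) \<omega> - centered (trunc (2 ^ r) (int (Suc k))) \<omega>"
  note pT = centered_props[OF square_integrable_trunc] and pY = centered_props[OF square_integrable_Y]
  have "maximal_norm M (?D (2 ^ r)) n \<le> \<delta> * sqrt (real n)" for n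
  proof (cases "n = 0")
    case True then show ?thesis by (simp add: maximal_norm_def norm2_def)
  next
    case False
    define e where "e = \<delta> * sqrt (real n) / (4 * real n)"
    have "e > 0" using False assms by (simp add: e_def)
    then obtain x where "x > 0" and x: "\<And>z. 0 \<le> z \<Longrightarrow> z \<le> x \<Longrightarrow> c z \<le> e" using c_lim[OF \<open>e > 0\<close>] by blast
    have "(\<lambda>m. s * tail_sum a m) \<longlonglongrightarrow> s * 0" by (intro tendsto_intros tail_sum_lim)
    then have "eventually (\<lambda>m. s * tail_sum a m < x) sequentially"
      using \<open>x > 0\<close> by (intro order_tendstoD) auto
    then obtain N where N: "\<And>m. m \<ge> N \<Longrightarrow> s * tail_sum a m < x"
      by (auto simp: eventually_sequentially)
    define R where "R = max r N"
    have "N \<le> 2 ^ R" using less_exp[of R] unfolding R_def by linarith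
    then have cR: "c (s * tail_sum a (2 ^ R)) \<le> e"
      using N[of "2 ^ R"] by (intro x) (auto simp: s_nonneg tail_sum_nonneg)
    have split: "?D (2 ^ r) = (\<lambda>k \<omega>. ?D (2 ^ R) k \<omega> + (\<Sum>i\<in>{r..<R}. ?d i k \<omega>))"
    proof (intro ext)
      fix k \<omega>
      have "(\<Sum>i\<in>{r..<R}. ?d i k \<omega>) = centered (trunc (2 ^ R) (int (Suc k))) \<omega> - centered (trunc (2 ^ r) (int (Suc k))) \<omega>"
        by (rule sum_Suc_diff') (simp add: R_def)
      then show "?D (2 ^ r) k \<omega> = ?D (2 ^ R) k \<omega> + (\<Sum>i\<in>{r..<R}. ?d i k \<omega>)" by simp
    qed
    have "maximal_norm M (?D (2 ^ r)) n
        \<le> maximal_norm M (?D (2 ^ R)) n + maximal_norm M (\<lambda>k \<omega>. \<Sum>i\<in>{r..<R}. ?d i k \<omega>) n"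
      unfolding split by (intro maximal_norm_add square_integrable_sum square_integrable_diff pT pY)
    also have "maximal_norm M (?D (2 ^ R)) n \<le> (\<Sum>k<n. norm2 M (?D (2 ^ R) k))"
      by (intro maximal_norm_le_sum square_integrable_diff pT pY)
    also have "\<dots> \<le> (\<Sum>k<n. 2 * e)"
    proof (rule sum_mono)
      fix k
      have "norm2 M (?D (2 ^ R) k) \<le> sqrt 2 * c (s * tail_sum a (2 ^ R))"
        by (intro norm2_centered_diff square_integrable_Y square_integrable_trunc norm2_Y_trunc)
      also have "\<dots> \<le> 2 * e"
        using cR \<open>e > 0\<close> sqrt2_less_2
        by (intro mult_mono) (auto simp: s_nonneg tail_sum_nonneg intro!: c_nonneg)
      finally show "norm2 M (?D (2 ^ R) k) \<le> 2 * e" .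
    qed
    also have "\<dots> = \<delta> / 2 * sqrt (real n)" using False by (simp add: e_def)
    also have "maximal_norm M (\<lambda>k \<omega>. \<Sum>i\<in>{r..<R}. ?d i k \<omega>) n \<le> (\<Sum>i\<in>{r..<R}. maximal_norm M (?d i) n)"
      by (intro maximal_norm_sum square_integrable_diff pT)
    also have "\<dots> \<le> (\<Sum>i\<in>{r..<R}. 16 * sqrt (real n) * \<beta> i)"
      unfolding \<beta>_def by (intro sum_mono dyadic_level)
    also have "\<dots> = 16 * sqrt (real n) * sum \<beta> {r..<R}" by (simp add: sum_distrib_left)
    also have "\<dots> \<le> 16 * sqrt (real n) * (\<delta> / 32)"
      using r[of R] by (intro mult_left_mono) auto
    finally show ?thesis by (simp add: algebra_simps)
  qed
  then show ?thesis by (intro exI[of _ "2 ^ r"]) auto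
qed

definition clip_trunc :: "real \<Rightarrow> nat \<Rightarrow> int \<Rightarrow> 'a \<Rightarrow> real" where
  "clip_trunc B m k \<omega> = (\<Sum>i<m. a i * clip B (\<epsilon> (k - int i) \<omega>))"

lemma clip_trunc_measurable [measurable]: "clip_trunc B m k \<in> borel_measurable M"
  unfolding clip_trunc_def[abs_def] by measurable

lemma past_clip_trunc: "clip_trunc B m k \<in> borel_measurable (past \<epsilon> {k - int m<..k})"
  unfolding clip_trunc_def[abs_def] by (rule past_linear) measurable

lemma clip_trunc_bound:
  assumes "0 \<le> B"
  shows "\<bar>clip_trunc B m k \<omega>\<bar> \<le> tail_sum a 0 * B"
proof -
  have "\<bar>clip_trunc B m k \<omega>\<bar> \<le> (\<Sum>i<m. \<bar>a i\<bar> * B)"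
    unfolding clip_trunc_def
    by (intro order_trans[OF sum_abs] sum_mono) (use assms in \<open>auto simp: abs_mult clip_bound intro!: mult_left_mono\<close>)
  also have "\<dots> = (\<Sum>i<m. \<bar>a i\<bar>) * B" by (simp add: sum_distrib_right)
  also have "\<dots> \<le> tail_sum a 0 * B"
    using assms by (intro mult_right_mono sum_le_tail_sum) auto
  finally show ?thesis .
qed

lemma square_integrable_clip_trunc: "0 \<le> B \<Longrightarrow> square_integrable M (clip_trunc B m k)"
  using clip_trunc_bound by (intro square_integrable_bounded) auto

lemma centered_clip_bound:
  assumes B: "0 \<le> B"
  shows "\<bar>centered (clip_trunc B m k) \<omega>\<bar> \<le> 2 * (\<bar>f 0\<bar> + c (tail_sum a 0 * B))"
proof -
  have b: "\<bar>f (clip_trunc B m k \<omega>)\<bar> \<le> \<bar>f 0\<bar> + c (tail_sum a 0 * B)" for \<omega>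
    using modulus[of "clip_trunc B m k \<omega>" 0] c_mono[OF _ clip_trunc_bound[OF B, of m k \<omega>]] by simp
  have i: "integrable M (\<lambda>\<omega>. f (clip_trunc B m k \<omega>))"
    by (intro square_integrable_integrable square_integrable_f square_integrable_clip_trunc B)
  have "\<bar>expectation (\<lambda>\<omega>. f (clip_trunc B m k \<omega>))\<bar> \<le> expectation (\<lambda>\<omega>. \<bar>f (clip_trunc B m k \<omega>)\<bar>)"
    by (rule integral_abs_bound)
  also have "\<dots> \<le> expectation (\<lambda>\<omega>. \<bar>f 0\<bar> + c (tail_sum a 0 * B))"
    using i b by (intro integral_mono) auto
  finally have "\<bar>expectation (\<lambda>\<omega>. f (clip_trunc B m k \<omega>))\<bar> \<le> \<bar>f 0\<bar> + c (tail_sum a 0 * B)"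
    by (simp add: prob_space)
  with b[of \<omega>] show ?thesis
    unfolding centered_def by (intro order_trans[OF abs_triangle_ineq4]) simp
qed

text \<open>
  For a fixed range \<open>m\<close> the maximal inequality loses only the constant \<open>sqrt m\<close>, so it is enough to clip the
  innovations at a high level. The clipped sums are bounded, and so are their images under \<open>f\<close>.
\<close>

lemma approx_clip:
  assumes "\<delta> > 0" "m \<ge> 1"
  shows "\<exists>B\<ge>0. \<forall>n. maximal_norm M (\<lambda>k \<omega>. centered (trunc m (int (Suc k))) \<omega>
      - centered (clip_trunc B m (int (Suc k))) \<omega>) n \<le> \<delta> * sqrt (real n)"
proof -
  let ?A = "tail_sum a 0"
  define e where "e = \<delta> / sqrt (64 * real m)"
  have "e > 0" using assms by (simp add: e_def)
  then obtain x where "x > 0" and x: "\<And>z. 0 \<le> z \<Longrightarrow> z \<le> x \<Longrightarrow> c z \<le> e" using c_lim[OF \<open>e > 0\<close>] by blast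
  (* x is a distance at which the modulus is small, and a clipping error of at most \<eta> per innovation
     moves the truncated sum by at most x *)
  define \<eta> where "\<eta> = x / (?A + 1)"
  have A: "0 \<le> ?A" by (rule tail_sum_nonneg)
  have \<eta>: "\<eta> > 0" "?A * \<eta> \<le> x"
    using A \<open>x > 0\<close> by (auto simp: \<eta>_def field_simps)
  obtain B where B: "B \<ge> 0" "\<And>i. norm2 M (\<lambda>\<omega>. \<epsilon> i \<omega> - clip B (\<epsilon> i \<omega>)) \<le> \<eta>"
    using clip_innov[OF \<eta>(1)] by blast
  have sqc: "square_integrable M (\<lambda>\<omega>. clip B (\<epsilon> i \<omega>))" for i
    using clip_bound[OF B(1)] by (intro square_integrable_bounded) auto
  note sqT = square_integrable_trunc and sqC = square_integrable_clip_trunc[OF B(1)]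
  let ?d = "\<lambda>k \<omega>. centered (trunc m (int (Suc k))) \<omega> - centered (clip_trunc B m (int (Suc k))) \<omega>"
  have "maximal_norm M ?d n \<le> \<delta> * sqrt (real n)" for n
  proof -
    have "maximal_norm M ?d n \<le> sqrt (32 * real m * real n) * (sqrt 2 * e)"
      unfolding maximal_norm_def
    proof (rule finite_range_maximal_inequality[OF indep window_disjoint])
      fix k
      show "?d k \<in> borel_measurable (past \<epsilon> {int (Suc k) - int m<..int (Suc k)})"
        by (intro borel_measurable_diff past_centered past_trunc past_clip_trunc)
      note p = centered_props[OF sqT] centered_props[OF sqC]
      show "square_integrable M (?d k)" by (intro square_integrable_diff p)
      show "expectation (?d k) = 0"
        using p square_integrable_integrable[OF p(1)] square_integrable_integrable[OF p(3)] by simp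
      have "trunc m k \<omega> - clip_trunc B m k \<omega> = (\<Sum>i<m. a i * (\<epsilon> (k - int i) \<omega> - clip B (\<epsilon> (k - int i) \<omega>)))" for k \<omega>
        by (simp add: trunc_def clip_trunc_def sum_subtractf algebra_simps)
      then have "norm2 M (\<lambda>\<omega>. trunc m (int (Suc k)) \<omega> - clip_trunc B m (int (Suc k)) \<omega>)
          \<le> (\<Sum>i<m. norm2 M (\<lambda>\<omega>. a i * (\<epsilon> (int (Suc k) - int i) \<omega> - clip B (\<epsilon> (int (Suc k) - int i) \<omega>))))"
        by (simp only:) (intro norm2_sum square_integrable_cmult square_integrable_diff sq_innov sqc)
      also have "\<dots> \<le> (\<Sum>i<m. \<bar>a i\<bar> * \<eta>)"
        unfolding norm2_cmult by (intro sum_mono mult_left_mono B) auto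
      also have "\<dots> = (\<Sum>i<m. \<bar>a i\<bar>) * \<eta>" by (simp add: sum_distrib_right)
      also have "\<dots> \<le> ?A * \<eta>" using \<eta> by (intro mult_right_mono sum_le_tail_sum) auto
      also have "\<dots> \<le> x" by (rule \<eta>)
      finally have "norm2 M (?d k) \<le> sqrt 2 * c x"
        by (intro norm2_centered_diff sqT sqC)
      also have "\<dots> \<le> sqrt 2 * e" using x[of x] \<open>x > 0\<close> by simp
      finally show "norm2 M (?d k) \<le> sqrt 2 * e" .
    qed (use assms in auto)
    also have "\<dots> = sqrt (64 * real m) * e * sqrt (real n)"
      using real_sqrt_mult[of 32 2] by (simp add: real_sqrt_mult[symmetric] algebra_simps)
    also have "\<dots> = \<delta> * sqrt (real n)" using assms by (simp add: e_def)
    finally show ?thesis .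
  qed
  with B(1) show ?thesis by blast
qed

end

section \<open>Blocks\<close>

lemma sum_blocks:
  fixes x :: "nat \<Rightarrow> real"
  shows "(\<Sum>k<q * L. x k) = (\<Sum>i<q. \<Sum>k\<in>{i * L..<Suc i * L}. x k)"
proof (induction q)
  case (Suc q)
  have "(\<Sum>k<Suc q * L. x k) = (\<Sum>k<q * L. x k) + (\<Sum>k\<in>{q * L..<Suc q * L}. x k)"
    unfolding lessThan_atLeast0 by (rule sum.atLeastLessThan_concat[symmetric]) auto
  then show ?case using Suc by simp
qed simp

text \<open>
  The partial sums of \<open>x\<close> follow, uniformly up to time \<open>n\<close>, sums of bounded independent centered block variables,
  the \<open>i\<close>-th block standing for the times from \<open>i * L\<close> to \<open>Suc i * L\<close>. One number \<open>C\<close> serves as the bound of the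
  blocks and as the part of the error that does not grow with \<open>n\<close>.
\<close>

definition (in prob_space) approximated_by_blocks ::
    "(nat \<Rightarrow> 'a \<Rightarrow> real) \<Rightarrow> real \<Rightarrow> nat \<Rightarrow> real \<Rightarrow> (nat \<Rightarrow> 'a \<Rightarrow> real) \<Rightarrow> bool" where
  "approximated_by_blocks x \<delta> L C V \<longleftrightarrow> L \<ge> 1 \<and> C \<ge> 0 \<and> indep_vars (\<lambda>_. borel) V UNIV \<and>
    (\<forall>i \<omega>. \<bar>V i \<omega>\<bar> \<le> C) \<and> (\<forall>i. expectation (V i) = 0) \<and>
    (\<forall>n. norm2 M (\<lambda>\<omega>. running_max (\<lambda>j. \<bar>(\<Sum>k<j. x k \<omega>) - (\<Sum>i<j div L. V i \<omega>)\<bar>) n) \<le> \<delta> * sqrt (real n) + C)"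

context prob_space begin

text \<open>
  Leaving out the last \<open>m\<close> terms of every block of length \<open>L\<close> makes the blocks independent. The omitted
  pieces \<open>G i\<close> are independent too when \<open>L \<ge> 2 * m\<close>; there are \<open>n div L\<close> of them up to time \<open>n\<close> and each is bounded by
  \<open>m * K\<close>, so their maximal partial sum has norm of order \<open>m * K * sqrt (n / L)\<close>, which is small when \<open>L\<close> is large.
  An incomplete last block contributes at most \<open>L * K\<close>.
\<close>

lemma block_approximation:
  fixes \<epsilon> :: "int \<Rightarrow> 'a \<Rightarrow> real" and x :: "nat \<Rightarrow> 'a \<Rightarrow> real"
  assumes ind: "indep_vars (\<lambda>_. borel) \<epsilon> UNIV" and m: "m \<ge> 1" and \<delta>: "\<delta> > 0"
    and x: "\<And>k. x k \<in> borel_measurable (past \<epsilon> {int (Suc k) - int m<..int (Suc k)})"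
      "\<And>k \<omega>. \<bar>x k \<omega>\<bar> \<le> K" "\<And>k. expectation (x k) = 0"
  shows "\<exists>L C V. approximated_by_blocks x \<delta> L C V"
proof -
  have [measurable]: "\<epsilon> i \<in> borel_measurable M" for i using ind by (auto simp: indep_vars_def2)
  have [measurable]: "x k \<in> borel_measurable M" for k by (rule past_measurable[OF x(1)]) auto
  have K: "0 \<le> K" using x(2)[of 0 undefined] by linarith
  (* the length at which the omitted pieces cost at most \<delta> * sqrt n *)
  obtain L0 :: nat where L0: "32 * (real m * K)\<^sup>2 / \<delta>\<^sup>2 \<le> real L0" using real_arch_simple by blast
  define L where "L = max (2 * m) L0"
  have L: "2 * m \<le> L" "1 \<le> L" "32 * (real m * K)\<^sup>2 / \<delta>\<^sup>2 \<le> real L"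
    using L0 m by (auto simp: L_def)
  define V where "V i \<omega> = (\<Sum>k\<in>{i * L..<i * L + (L - m)}. x k \<omega>)" for i \<omega>
  define G where "G i \<omega> = (\<Sum>k\<in>{i * L + (L - m)..<Suc i * L}. x k \<omega>)" for i \<omega>
  have sqx: "square_integrable M (x k)" for k using x(2) by (intro square_integrable_bounded) auto
  have VG: "(\<Sum>k\<in>{i * L..<Suc i * L}. x k \<omega>) = V i \<omega> + G i \<omega>" for i \<omega>
    unfolding V_def G_def using L(1) by (subst sum.atLeastLessThan_concat) auto
  have bound: "\<bar>\<Sum>k\<in>I. x k \<omega>\<bar> \<le> real (card I) * K" for I \<omega>
    using x(2) by (intro order_trans[OF sum_abs] sum_bounded_above) auto
  have win: "{int (Suc k) - int m<..int (Suc k)} \<subseteq> {int (i * L) + 1 - int m<..int (i * L) + int L - int m}"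
    if "k \<in> {i * L..<i * L + (L - m)}" for i k
  proof -
    have "i * L \<le> k" "k + m + 1 \<le> i * L + L" using that L(1) by auto
    then have "int (i * L) \<le> int k" "int k + int m + 1 \<le> int (i * L) + int L" by linarith+
    then show ?thesis by (auto simp del: of_nat_mult)
  qed
  have win': "{int (Suc k) - int m<..int (Suc k)} \<subseteq> {int (i * L) + int L + 1 - 2 * int m<..int (i * L) + int L}"
    if "k \<in> {i * L + (L - m)..<Suc i * L}" for i k
  proof -
    have "i * L + L \<le> k + m" "k + 1 \<le> i * L + L" using that L(1) by auto
    then have "int (i * L) + int L \<le> int k + int m" "int k + 1 \<le> int (i * L) + int L" by linarith+
    then show ?thesis by (auto simp del: of_nat_mult)
  qed
  have mV: "V i \<in> borel_measurable (past \<epsilon> {int (i * L) + 1 - int m<..int (i * L) + int L - int m})" for i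
    unfolding V_def[abs_def] by (intro borel_measurable_sum past_mono[OF x(1)] win)
  have mG: "G i \<in> borel_measurable (past \<epsilon> {int (i * L) + int L + 1 - 2 * int m<..int (i * L) + int L})" for i
    unfolding G_def[abs_def] by (intro borel_measurable_sum past_mono[OF x(1)] win')
  have sep: "int (i * L) + int L \<le> int (j * L)" if "i < j" for i j
  proof -
    have "Suc i * L \<le> j * L" using that by (intro mult_right_mono) auto
    then show ?thesis by (simp flip: of_nat_add of_nat_mult add: add.commute)
  qed
  have Gmax: "norm2 M (\<lambda>\<omega>. running_max (\<lambda>j. \<bar>\<Sum>i<j. G i \<omega>\<bar>) q) \<le> sqrt (32 * real 1 * real q) * (real m * K)" for q
  proof (rule finite_range_maximal_inequality[OF ind _ mG])
    fix i j :: nat assume "i + 1 \<le> j"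
    then show "{int (i * L) + int L + 1 - 2 * int m<..int (i * L) + int L}
      \<inter> {int (j * L) + int L + 1 - 2 * int m<..int (j * L) + int L} = {}"
      using sep[of i j] L(1) by (auto simp del: of_nat_mult)
  next
    fix i
    show "square_integrable M (G i)" unfolding G_def[abs_def] by (intro square_integrable_sum sqx)
    show "expectation (G i) = 0"
      unfolding G_def[abs_def] using square_integrable_integrable[OF sqx] x(3) by simp
    show "norm2 M (G i) \<le> real m * K"
    proof (rule norm2_bounded)
      show "G i \<in> borel_measurable M" unfolding G_def[abs_def] by measurable
      show "\<bar>G i \<omega>\<bar> \<le> real m * K" for \<omega>
        using bound[of \<omega> "{i * L + (L - m)..<Suc i * L}"] L(1) m by (simp add: G_def)
    qed
  qed simp
  have indV: "indep_vars (\<lambda>_. borel) V UNIV"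
  proof (rule indep_vars_past[OF ind _ _ mV])
    have "{int (i * L) + 1 - int m<..int (i * L) + int L - int m} \<inter>
      {int (j * L) + 1 - int m<..int (j * L) + int L - int m} = {}" if "i < j" for i j
      using sep[OF that] by (auto simp del: of_nat_mult)
    then show "disjoint_family_on (\<lambda>i. {int (i * L) + 1 - int m<..int (i * L) + int L - int m}) UNIV"
      unfolding disjoint_family_on_def by (metis Int_commute nat_neq_iff)
  qed auto
  define C where "C = real L * K"
  have C: "0 \<le> C" using K by (simp add: C_def)
  have bV: "\<bar>V i \<omega>\<bar> \<le> C" for i \<omega>
  proof -
    have "\<bar>V i \<omega>\<bar> \<le> real (L - m) * K" using bound[of \<omega> "{i * L..<i * L + (L - m)}"] by (simp add: V_def)
    also have "\<dots> \<le> C" unfolding C_def using K by (intro mult_right_mono) auto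
    finally show ?thesis .
  qed
  have cV: "expectation (V i) = 0" for i
    unfolding V_def[abs_def] using square_integrable_integrable[OF sqx] x(3) by simp
  have sqV: "square_integrable M (V i)" for i unfolding V_def[abs_def] by (intro square_integrable_sum sqx)
  have sqG: "square_integrable M (G i)" for i unfolding G_def[abs_def] by (intro square_integrable_sum sqx)
  have main: "norm2 M (\<lambda>\<omega>. running_max (\<lambda>j. \<bar>(\<Sum>k<j. x k \<omega>) - (\<Sum>i<j div L. V i \<omega>)\<bar>) n) \<le> \<delta> * sqrt (real n) + C" for n
  proof -
    let ?R = "\<lambda>\<omega>. running_max (\<lambda>j. \<bar>\<Sum>i<j. G i \<omega>\<bar>) (n div L)"
    have sqR: "square_integrable M ?R" by (intro square_integrable_maximal sqG)
    have pw: "\<bar>(\<Sum>k<j. x k \<omega>) - (\<Sum>i<j div L. V i \<omega>)\<bar> \<le> ?R \<omega> + C" if j: "j \<le> n" for j \<omega>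
    proof -
      have "(\<Sum>k<j. x k \<omega>) = (\<Sum>k<j div L * L. x k \<omega>) + (\<Sum>k\<in>{j div L * L..<j}. x k \<omega>)"
        unfolding lessThan_atLeast0 by (rule sum.atLeastLessThan_concat[symmetric]) auto
      also have "(\<Sum>k<j div L * L. x k \<omega>) = (\<Sum>i<j div L. V i \<omega>) + (\<Sum>i<j div L. G i \<omega>)"
        unfolding sum_blocks VG by (rule sum.distrib)
      finally have "(\<Sum>k<j. x k \<omega>) - (\<Sum>i<j div L. V i \<omega>) = (\<Sum>i<j div L. G i \<omega>) + (\<Sum>k\<in>{j div L * L..<j}. x k \<omega>)"
        by simp
      moreover have "\<bar>\<Sum>i<j div L. G i \<omega>\<bar> \<le> ?R \<omega>"
        using running_max_ge[of "j div L" "n div L" "\<lambda>j. \<bar>\<Sum>i<j. G i \<omega>\<bar>"] div_le_mono[OF j] by simp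
      moreover have "\<bar>\<Sum>k\<in>{j div L * L..<j}. x k \<omega>\<bar> \<le> C"
      proof -
        have "j - j div L * L \<le> L" using L(2) by (metis minus_div_mult_eq_mod mod_less_divisor less_imp_le less_le_trans zero_less_one)
        then have "real (j - j div L * L) * K \<le> C" unfolding C_def using K by (intro mult_right_mono of_nat_mono)
        then show ?thesis using bound[of \<omega> "{j div L * L..<j}"] by simp
      qed
      ultimately show ?thesis by linarith
    qed
    let ?S = "\<lambda>\<omega>. running_max (\<lambda>j. \<bar>(\<Sum>k<j. x k \<omega>) - (\<Sum>i<j div L. V i \<omega>)\<bar>) n"
    have S: "0 \<le> ?S \<omega>" "?S \<omega> \<le> ?R \<omega> + C" for \<omega>
      using pw by (auto intro: running_max_nonneg running_max_le)
    have "norm2 M ?S \<le> norm2 M (\<lambda>\<omega>. ?R \<omega> + C)"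
    proof (rule norm2_mono[OF square_integrable_add[OF sqR square_integrable_const]])
      show "?S \<in> borel_measurable M"
        by (rule square_integrableD(1))
          (intro square_integrable_running_max square_integrable_abs square_integrable_diff square_integrable_sum sqx sqV)
      show "AE \<omega> in M. \<bar>?S \<omega>\<bar> \<le> \<bar>?R \<omega> + C\<bar>" using S by (intro AE_I2) (smt (verit))
    qed
    also have "\<dots> \<le> norm2 M ?R + norm2 M (\<lambda>_. C)"
      by (rule norm2_triangle[OF sqR square_integrable_const])
    also have "norm2 M (\<lambda>_. C) = C" using C by (simp add: norm2_def prob_space)
    also have "norm2 M ?R \<le> sqrt (32 * real 1 * real (n div L)) * (real m * K)" by (rule Gmax)
    also have "\<dots> \<le> \<delta> * sqrt (real n)"
    proof (rule power2_le_imp_le)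
      have "(sqrt (32 * real 1 * real (n div L)) * (real m * K))\<^sup>2 = 32 * (real m * K)\<^sup>2 * real (n div L)"
        by (simp add: power_mult_distrib)
      also have "\<dots> \<le> (\<delta>\<^sup>2 * real L) * real (n div L)"
        using L(3) \<delta> by (intro mult_right_mono) (auto simp: field_simps)
      also have "\<dots> = \<delta>\<^sup>2 * real (L * (n div L))" by simp
      also have "\<dots> \<le> \<delta>\<^sup>2 * real n"
        by (intro mult_left_mono of_nat_mono) auto
      finally show "(sqrt (32 * real 1 * real (n div L)) * (real m * K))\<^sup>2 \<le> (\<delta> * sqrt (real n))\<^sup>2"
        by (simp add: power_mult_distrib)
    qed (use \<delta> in auto)
    finally show ?thesis by simp
  qed
  have "approximated_by_blocks x \<delta> L C V"
    unfolding approximated_by_blocks_def using L(2) C indV bV cV main by simp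
  then show ?thesis by blast
qed

end

context functional_of_linear_process begin

text \<open>
  The three approximations combined: finite range, bounded innovations, independent blocks.
\<close>

theorem approximation_by_independent_blocks:
  assumes \<delta>: "\<delta> > 0"
  shows "\<exists>L C V. approximated_by_blocks (\<lambda>k. centered (Y (int (Suc k)))) \<delta> L C V"
proof -
  have \<delta>3: "\<delta> / 3 > 0" using \<delta> by simp
  obtain m where m: "m \<ge> 1" and A: "\<And>n. maximal_norm M (\<lambda>k \<omega>. centered (Y (int (Suc k))) \<omega> - centered (trunc m (int (Suc k))) \<omega>) n
    \<le> \<delta> / 3 * sqrt (real n)" using approx_trunc[OF \<delta>3] by blast
  obtain B where B: "B \<ge> 0" and A': "\<And>n. maximal_norm M (\<lambda>k \<omega>. centered (trunc m (int (Suc k))) \<omega>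
      - centered (clip_trunc B m (int (Suc k))) \<omega>) n \<le> \<delta> / 3 * sqrt (real n)"
    using approx_clip[OF \<delta>3 m] by blast
  let ?x = "\<lambda>k. centered (clip_trunc B m (int (Suc k)))" and ?t = "\<lambda>k. centered (trunc m (int (Suc k)))"
    and ?y = "\<lambda>k. centered (Y (int (Suc k)))"
  note p = centered_props[OF square_integrable_clip_trunc[OF B]] centered_props[OF square_integrable_trunc]
    centered_props[OF square_integrable_Y]
  obtain L C V where blk: "approximated_by_blocks ?x (\<delta> / 3) L C V"
    using block_approximation[OF indep m \<delta>3 past_centered[OF past_clip_trunc] centered_clip_bound[OF B] p(2)] by blast
  then have LCV: "L \<ge> 1" "C \<ge> 0" "indep_vars (\<lambda>_. borel) V UNIV"
    "\<And>i \<omega>. \<bar>V i \<omega>\<bar> \<le> C" "\<And>i. expectation (V i) = 0"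
    and A'': "\<And>n. norm2 M (\<lambda>\<omega>. running_max (\<lambda>j. \<bar>(\<Sum>k<j. ?x k \<omega>) - (\<Sum>i<j div L. V i \<omega>)\<bar>) n) \<le> \<delta> / 3 * sqrt (real n) + C"
    unfolding approximated_by_blocks_def by simp_all
  have sqV: "square_integrable M (V i)" for i
    using LCV(3,4) by (intro square_integrable_bounded) (auto simp: indep_vars_def2)
  have "norm2 M (\<lambda>\<omega>. running_max (\<lambda>j. \<bar>(\<Sum>k<j. ?y k \<omega>) - (\<Sum>i<j div L. V i \<omega>)\<bar>) n) \<le> \<delta> * sqrt (real n) + C" for n
  proof -
    let ?P = "\<lambda>\<omega>. running_max (\<lambda>j. \<bar>\<Sum>k<j. ?y k \<omega> - ?t k \<omega>\<bar>) n"
    let ?Q = "\<lambda>\<omega>. running_max (\<lambda>j. \<bar>\<Sum>k<j. ?t k \<omega> - ?x k \<omega>\<bar>) n"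
    let ?R = "\<lambda>\<omega>. running_max (\<lambda>j. \<bar>(\<Sum>k<j. ?x k \<omega>) - (\<Sum>i<j div L. V i \<omega>)\<bar>) n"
    let ?S = "\<lambda>\<omega>. running_max (\<lambda>j. \<bar>(\<Sum>k<j. ?y k \<omega>) - (\<Sum>i<j div L. V i \<omega>)\<bar>) n"
    have sq: "square_integrable M ?P" "square_integrable M ?Q" "square_integrable M ?R" "square_integrable M ?S"
      by (intro square_integrable_running_max square_integrable_abs square_integrable_diff square_integrable_sum p sqV)+
    have S: "0 \<le> ?S \<omega>" "?S \<omega> \<le> ?P \<omega> + ?Q \<omega> + ?R \<omega>" for \<omega>
    proof -
      show "?S \<omega> \<le> ?P \<omega> + ?Q \<omega> + ?R \<omega>"
      proof (rule running_max_le)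
        fix j assume j: "j \<le> n"
        show "\<bar>(\<Sum>k<j. ?y k \<omega>) - (\<Sum>i<j div L. V i \<omega>)\<bar> \<le> ?P \<omega> + ?Q \<omega> + ?R \<omega>"
          using running_max_ge[OF j, of "\<lambda>j. \<bar>\<Sum>k<j. ?y k \<omega> - ?t k \<omega>\<bar>"]
            running_max_ge[OF j, of "\<lambda>j. \<bar>\<Sum>k<j. ?t k \<omega> - ?x k \<omega>\<bar>"]
            running_max_ge[OF j, of "\<lambda>j. \<bar>(\<Sum>k<j. ?x k \<omega>) - (\<Sum>i<j div L. V i \<omega>)\<bar>"]
          unfolding sum_subtractf by linarith
      qed
    qed (auto intro: running_max_nonneg)
    have "norm2 M ?S \<le> norm2 M (\<lambda>\<omega>. ?P \<omega> + ?Q \<omega> + ?R \<omega>)"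
    proof (rule norm2_mono)
      show "AE \<omega> in M. \<bar>?S \<omega>\<bar> \<le> \<bar>?P \<omega> + ?Q \<omega> + ?R \<omega>\<bar>" using S by (intro AE_I2) (smt (verit))
    qed (intro square_integrable_add sq square_integrableD(1)[OF sq(4)])+
    also have "\<dots> \<le> norm2 M ?P + norm2 M ?Q + norm2 M ?R"
      using norm2_triangle[OF square_integrable_add[OF sq(1,2)] sq(3)] norm2_triangle[OF sq(1,2)] by linarith
    finally show ?thesis
      using A[of n] A'[of n] A''[of n] by (simp add: maximal_norm_def)
  qed
  with LCV have "approximated_by_blocks ?y \<delta> L C V"
    unfolding approximated_by_blocks_def by simp
  then show ?thesis by blast
qed

end

section \<open>Triangular array of blocks\<close>

text \<open>
  At time \<open>n\<close> take the largest \<open>q \<le> n\<close> whose bound \<open>C q\<close> is at most \<open>sqrt n / Suc q\<close>. Every fixed \<open>q\<close> is eventually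
  admissible, so the choice tends to infinity.
\<close>

lemma slowly_growing_index:
  fixes C :: "nat \<Rightarrow> real"
  assumes "\<And>q. C q \<ge> 0"
  shows "\<exists>q::nat \<Rightarrow> nat. filterlim q at_top sequentially \<and> (\<lambda>n. C (q n) / sqrt (real n)) \<longlonglongrightarrow> 0"
proof -
  (* 0 is admitted unconditionally to keep the set nonempty for small n *)
  define A where "A n = {q. q \<le> n \<and> (q = 0 \<or> C q * real (q + 1) \<le> sqrt (real n))}" for n :: nat
  define q where "q n = Max (A n)" for n
  have fin: "finite (A n)" for n by (rule finite_subset[of _ "{..n}"]) (auto simp: A_def)
  have ne: "A n \<noteq> {}" for n by (auto simp: A_def intro!: exI[of _ 0])
  have "eventually (\<lambda>n. Q \<le> q n) sequentially" for Q
  proof -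
    have "filterlim (\<lambda>n. sqrt (real n)) at_top sequentially"
      by (rule filterlim_compose[OF sqrt_at_top filterlim_real_sequentially])
    then have "eventually (\<lambda>n. C Q * real (Q + 1) \<le> sqrt (real n)) sequentially"
      by (simp add: filterlim_at_top)
    then show ?thesis using eventually_ge_at_top[of Q]
    proof eventually_elim
      case (elim n)
      then have "Q \<in> A n" by (simp add: A_def)
      then show ?case unfolding q_def by (rule Max_ge[OF fin])
    qed
  qed
  then have lim: "filterlim q at_top sequentially" by (simp add: filterlim_at_top)
  moreover have "(\<lambda>n. C (q n) / sqrt (real n)) \<longlonglongrightarrow> 0"
  proof (rule tendsto_sandwich[OF _ _ tendsto_const])
    show "eventually (\<lambda>n. 0 \<le> C (q n) / sqrt (real n)) sequentially"
      using assms by simp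
    have "eventually (\<lambda>n. 1 \<le> q n) sequentially" using lim by (simp add: filterlim_at_top)
    then show "eventually (\<lambda>n. C (q n) / sqrt (real n) \<le> inverse (real (Suc (q n)))) sequentially"
      using eventually_gt_at_top[of 0]
    proof eventually_elim
      case (elim n)
      have "q n \<in> A n" unfolding q_def by (rule Max_in[OF fin ne])
      then have "C (q n) * real (q n + 1) \<le> sqrt (real n)" using elim by (auto simp: A_def)
      then show ?case using elim by (simp add: field_simps)
    qed
    show "(\<lambda>n. inverse (real (Suc (q n)))) \<longlonglongrightarrow> 0"
      by (rule filterlim_compose[OF LIMSEQ_inverse_real_of_nat lim])
  qed
  ultimately show ?thesis by blast
qed

text \<open>
  The accuracy is allowed to improve with \<open>n\<close>. One triangular array of blocks then has asymptotically the
  same partial sums as the original sequence, and its entries are small compared with \<open>sqrt n\<close>.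
\<close>

lemma (in prob_space) diagonal_block_approximation:
  assumes "\<And>\<delta>. \<delta> > 0 \<Longrightarrow> \<exists>L C V. approximated_by_blocks x \<delta> L C V"
  shows "\<exists>\<delta> L C V. (\<forall>n. approximated_by_blocks x (\<delta> n) (L n) (C n) (V n)) \<and>
    \<delta> \<longlonglongrightarrow> 0 \<and> (\<lambda>n. C n / sqrt (real n)) \<longlonglongrightarrow> 0"
proof -
  have "\<forall>q. \<exists>LCV. approximated_by_blocks x (inverse (real (Suc q))) (fst LCV) (fst (snd LCV)) (snd (snd LCV))"
    using assms[of "inverse (real (Suc q))" for q] by simp
  then obtain F where F: "\<And>q. approximated_by_blocks x (inverse (real (Suc q))) (fst (F q)) (fst (snd (F q))) (snd (snd (F q)))"
    by metis
  define C where "C q = fst (snd (F q))" for q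
  have "C q \<ge> 0" for q using F[of q] by (simp add: C_def approximated_by_blocks_def)
  then obtain q :: "nat \<Rightarrow> nat" where q: "filterlim q at_top sequentially" "(\<lambda>n. C (q n) / sqrt (real n)) \<longlonglongrightarrow> 0"
    using slowly_growing_index by blast
  have "(\<lambda>n. inverse (real (Suc (q n)))) \<longlonglongrightarrow> 0"
    by (rule filterlim_compose[OF LIMSEQ_inverse_real_of_nat q(1)])
  then show ?thesis
    using F q(2) unfolding C_def
    by (intro exI[of _ "\<lambda>n. inverse (real (Suc (q n)))"] exI[of _ "\<lambda>n. fst (F (q n))"]
        exI[of _ "\<lambda>n. fst (snd (F (q n)))"] exI[of _ "\<lambda>n. snd (snd (F (q n)))"]) blast
qed

section \<open>Growth of the variance\<close>

lemma floor_fraction: "nat \<lfloor>real n * (real i / real p)\<rfloor> = (n * i) div p"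
proof -
  have "real n * (real i / real p) = real (n * i) / real p" by simp
  then show ?thesis by (simp only: floor_divide_of_nat_eq nat_int)
qed

text \<open>
  With \<open>d = n div p\<close>, the times \<open>n\<close> and \<open>(n * i) div p\<close> differ from the multiples \<open>p * d\<close> and \<open>i * d\<close> by at most \<open>p\<close>,
  and \<open>\<sigma>\<close> is Lipschitz and tends to infinity. So it suffices to compare \<open>\<sigma> (i * d)\<close> with \<open>\<sigma> (p * d)\<close>, where slow
  variation applies with the integer factors \<open>i\<close> and \<open>p\<close>. In this way \<open>h\<close> is evaluated at integers only, which
  is where the variances determine it.
\<close>

lemma variance_ratio:
  fixes \<sigma> :: "nat \<Rightarrow> real" and h :: "real \<Rightarrow> real"
  assumes nn: "\<And>n. 0 \<le> \<sigma> n" and \<sigma>0: "\<sigma> 0 = 0" and \<sigma>h: "\<And>n. n \<ge> 1 \<Longrightarrow> (\<sigma> n)\<^sup>2 = real n * h (real n)"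
    and sv: "\<And>t. t > 0 \<Longrightarrow> ((\<lambda>x. h (t * x) / h x) \<longlongrightarrow> 1) at_top"
    and h0: "h0 > 0" "eventually (\<lambda>n. h (real n) \<ge> h0) sequentially"
    and lip: "\<And>m n. \<bar>\<sigma> m - \<sigma> n\<bar> \<le> K * \<bar>real m - real n\<bar>"
    and i: "i \<le> p" "1 \<le> p"
  shows "(\<lambda>n. \<sigma> ((n * i) div p) / \<sigma> n) \<longlonglongrightarrow> sqrt (real i / real p)"
proof -
  define s where "s n = \<sigma> (p * n)" for n
  have K: "0 \<le> K" using lip[of 1 0] abs_ge_zero[of "\<sigma> 1 - \<sigma> 0"] by simp
  have hlim: "(\<lambda>n. h (real k * real n) / h (real n)) \<longlonglongrightarrow> 1" if "k \<ge> 1" for k :: nat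
    using filterlim_compose[OF sv[of "real k"] filterlim_real_sequentially] that by simp
  have hpos: "eventually (\<lambda>n. h (real (k * n)) \<ge> h0) sequentially" if "k \<ge> 1" for k
  proof -
    obtain N where N: "\<And>n. n \<ge> N \<Longrightarrow> h (real n) \<ge> h0" using h0(2) by (auto simp: eventually_sequentially)
    have "n \<ge> N \<Longrightarrow> k * n \<ge> N" for n using that by (metis le_trans mult_le_mono1 mult_1)
    then show ?thesis using N unfolding eventually_sequentially by blast
  qed
  have s_inf: "filterlim s at_top sequentially"
  proof (rule filterlim_at_top_mono)
    show "filterlim (\<lambda>n. sqrt (h0 * real n)) at_top sequentially"
      by (intro filterlim_compose[OF sqrt_at_top] filterlim_tendsto_pos_mult_at_top[OF tendsto_const h0(1)] filterlim_real_sequentially)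
    show "eventually (\<lambda>n. sqrt (h0 * real n) \<le> s n) sequentially"
      using hpos[OF i(2)] eventually_ge_at_top[of 1]
    proof eventually_elim
      case (elim n)
      have "real n \<le> real (p * n)" using i(2) by (intro of_nat_mono) auto
      then have "h0 * real n \<le> real (p * n) * h (real (p * n))"
        using elim h0(1) by (subst mult.commute) (intro mult_mono, auto)
      also have "\<dots> = (s n)\<^sup>2" unfolding s_def using elim i(2) by (subst \<sigma>h) auto
      finally show ?case using nn by (intro real_le_lsqrt) (auto simp: s_def)
    qed
  qed
  have main: "(\<lambda>n. \<sigma> (i * n) / s n) \<longlonglongrightarrow> sqrt (real i / real p)"
  proof (cases "i = 0")
    case True then show ?thesis by (simp add: \<sigma>0)
  next
    case False
    then have i1: "i \<ge> 1" by simp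
    have "(\<lambda>n. sqrt (real i / real p * ((h (real i * real n) / h (real n)) / (h (real p * real n) / h (real n)))))
        \<longlonglongrightarrow> sqrt (real i / real p * (1 / 1))"
      by (intro tendsto_intros hlim i1 i(2)) auto
    moreover have "eventually (\<lambda>n. sqrt (real i / real p * ((h (real i * real n) / h (real n)) / (h (real p * real n) / h (real n))))
        = \<sigma> (i * n) / s n) sequentially"
      using h0(2) hpos[OF i1] hpos[OF i(2)] eventually_ge_at_top[of 1]
    proof eventually_elim
      case (elim n)
      have e: "(\<sigma> (k * n))\<^sup>2 = real k * real n * h (real k * real n)" if "k \<ge> 1" for k
        using \<sigma>h[of "k * n"] elim that by simp
      have "real i / real p * ((h (real i * real n) / h (real n)) / (h (real p * real n) / h (real n)))
          = (\<sigma> (i * n) / s n)\<^sup>2"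
        unfolding power_divide s_def e[OF i1] e[OF i(2)] using elim h0(1) by (simp add: field_simps)
      then show ?case using nn by (simp add: s_def)
    qed
    ultimately show ?thesis by (auto dest: Lim_transform_eventually)
  qed
  let ?d = "\<lambda>n. n div p"
  have dinf: "filterlim ?d at_top sequentially"
    unfolding filterlim_at_top
  proof
    fix Z show "eventually (\<lambda>n. Z \<le> n div p) sequentially"
      using eventually_ge_at_top[of "Z * p"]
      by eventually_elim (use i(2) in \<open>simp add: less_eq_div_iff_mult_less_eq\<close>)
  qed
  have small: "(\<lambda>n. K * real p / s (?d n)) \<longlonglongrightarrow> 0"
    by (rule tendsto_divide_0[OF tendsto_const])
       (rule filterlim_at_top_imp_at_infinity[OF filterlim_compose[OF s_inf dinf]])
  have close: "(\<lambda>n. (\<sigma> (u n) - \<sigma> (w n)) / s (?d n)) \<longlonglongrightarrow> 0"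
    if "\<And>n. \<bar>real (u n) - real (w n)\<bar> \<le> real p" for u w :: "nat \<Rightarrow> nat"
  proof (rule Lim_null_comparison[OF _ small], intro always_eventually allI)
    fix n
    have "\<bar>\<sigma> (u n) - \<sigma> (w n)\<bar> \<le> K * real p"
      using order_trans[OF lip mult_left_mono[OF that K]] .
    then show "norm ((\<sigma> (u n) - \<sigma> (w n)) / s (?d n)) \<le> K * real p / s (?d n)"
      using nn by (simp add: s_def divide_right_mono)
  qed
  have num: "(\<lambda>n. \<sigma> ((n * i) div p) / s (?d n)) \<longlonglongrightarrow> sqrt (real i / real p)"
  proof -
    have "\<bar>real ((n * i) div p) - real (i * ?d n)\<bar> \<le> real p" for n
    proof -
      have "n * i = p * (i * ?d n) + (n mod p) * i"
        by (metis add.commute add_mult_distrib div_mult_mod_eq mult.assoc mult.commute)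
      then have "(n * i) div p = i * ?d n + ((n mod p) * i) div p" using i(2) by simp
      moreover have "((n mod p) * i) div p \<le> p"
      proof -
        have "n mod p \<le> p" using i(2) mod_less_divisor[of p n] by linarith
        then have "(n mod p) * i \<le> p * p" using i by (intro mult_mono) auto
        then show ?thesis using i(2) by (metis div_le_mono div_mult_self1_is_m less_le_trans zero_less_one)
      qed
      ultimately show ?thesis by simp
    qed
    from tendsto_add[OF close[of "\<lambda>n. (n * i) div p" "\<lambda>n. i * ?d n", OF this] filterlim_compose[OF main dinf]]
    show ?thesis by (simp add: diff_divide_distrib)
  qed
  have den: "(\<lambda>n. \<sigma> n / s (?d n)) \<longlonglongrightarrow> 1"
  proof -
    have "\<bar>real n - real (p * ?d n)\<bar> \<le> real p" for n
    proof -
      have "n = p * ?d n + n mod p" by simp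
      then have "real n = real (p * ?d n) + real (n mod p)" by (metis of_nat_add)
      moreover have "real (n mod p) \<le> real p"
        using i(2) mod_less_divisor[of p n] by (intro of_nat_mono) linarith
      ultimately show ?thesis by simp
    qed
    from close[of "\<lambda>n. n" "\<lambda>n. p * ?d n", OF this]
    have "(\<lambda>n. \<sigma> n / s (?d n) - s (?d n) / s (?d n)) \<longlonglongrightarrow> 0"
      by (simp add: diff_divide_distrib s_def)
    moreover have "eventually (\<lambda>n. s (?d n) / s (?d n) = 1) sequentially"
    proof -
      have "eventually (\<lambda>n. 0 < s (?d n)) sequentially"
        using filterlim_compose[OF s_inf dinf] by (simp add: filterlim_at_top_dense)
      then show ?thesis by eventually_elim simp
    qed
    then have "(\<lambda>n. s (?d n) / s (?d n)) \<longlonglongrightarrow> 1" by (rule tendsto_eventually)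
    ultimately show ?thesis using tendsto_add by fastforce
  qed
  have "(\<lambda>n. (\<sigma> ((n * i) div p) / s (?d n)) / (\<sigma> n / s (?d n))) \<longlonglongrightarrow> sqrt (real i / real p) / 1"
    by (intro tendsto_divide num den) simp
  moreover have "eventually (\<lambda>n. (\<sigma> ((n * i) div p) / s (?d n)) / (\<sigma> n / s (?d n)) = \<sigma> ((n * i) div p) / \<sigma> n) sequentially"
  proof -
    have "eventually (\<lambda>n. 0 < s (?d n)) sequentially"
      using filterlim_compose[OF s_inf dinf] by (simp add: filterlim_at_top_dense)
    then show ?thesis by eventually_elim simp
  qed
  ultimately have "(\<lambda>n. \<sigma> ((n * i) div p) / \<sigma> n) \<longlonglongrightarrow> sqrt (real i / real p) / 1"
    by (rule Lim_transform_eventually)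
  then show ?thesis by simp
qed

section \<open>The central limit theorem for bounded triangular arrays\<close>

context prob_space begin

text \<open>
  Compare both functions with \<open>1 - t\<^sup>2 * v / 2\<close>. Both errors carry the factor \<open>v\<close>, so that they can be summed over
  the rows of an array with bounded total variance.
\<close>

lemma char_close_to_normal:
  fixes X :: "'a \<Rightarrow> real"
  assumes [measurable]: "X \<in> borel_measurable M" and b: "\<And>\<omega>. \<bar>X \<omega>\<bar> \<le> b" and cen: "expectation X = 0"
    and v: "v = expectation (\<lambda>\<omega>. (X \<omega>)\<^sup>2)"
  shows "cmod (char (distr M borel X) t - exp (- (t\<^sup>2 * v / 2))) \<le> (\<bar>t\<bar> ^ 3 * b + t ^ 4 * b\<^sup>2) * v"
proof -
  have sq: "square_integrable M X" by (rule square_integrable_bounded[OF _ b]) simp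
  have bb: "0 \<le> b" using b[of undefined] by linarith
  have v0: "0 \<le> v" unfolding v by simp
  have X2: "(X \<omega>)\<^sup>2 \<le> b\<^sup>2" for \<omega> using power_mono[OF b[of \<omega>], of 2] by simp
  have vb: "v \<le> b\<^sup>2"
  proof -
    have "v \<le> expectation (\<lambda>_. b\<^sup>2)" unfolding v using sq by (intro integral_mono X2) auto
    then show ?thesis by (simp add: prob_space)
  qed
  have "cmod (char (distr M borel X) t - (1 - t^2 * v / 2)) \<le>
      (t^2 / 6) * expectation (\<lambda>\<omega>. min (6 * (X \<omega>)^2) (\<bar>t\<bar> * \<bar>X \<omega>\<bar>^3))"
    using sq square_integrable_integrable[OF sq] cen v by (intro char_approx3') auto
  also have "\<dots> \<le> (t^2 / 6) * (\<bar>t\<bar> * b * v)"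
  proof (intro mult_left_mono)
    have le: "min (6 * (X \<omega>)^2) (\<bar>t\<bar> * \<bar>X \<omega>\<bar>^3) \<le> \<bar>t\<bar> * b * (X \<omega>)\<^sup>2" for \<omega>
    proof -
      have "\<bar>X \<omega>\<bar> ^ 3 = \<bar>X \<omega>\<bar> * (X \<omega>)\<^sup>2" by (simp add: power3_eq_cube power2_eq_square)
      also have "\<dots> \<le> b * (X \<omega>)\<^sup>2" by (intro mult_right_mono b) simp
      finally have "\<bar>t\<bar> * \<bar>X \<omega>\<bar> ^ 3 \<le> \<bar>t\<bar> * (b * (X \<omega>)\<^sup>2)" by (intro mult_left_mono) auto
      then show ?thesis by (simp add: mult.assoc)
    qed
    have i: "integrable M (\<lambda>\<omega>. \<bar>t\<bar> * b * (X \<omega>)\<^sup>2)" using sq by auto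
    have i': "integrable M (\<lambda>\<omega>. min (6 * (X \<omega>)^2) (\<bar>t\<bar> * \<bar>X \<omega>\<bar>^3))"
      by (rule Bochner_Integration.integrable_bound[OF i])
        (use le bb in \<open>auto simp: abs_mult intro!: AE_I2\<close>)
    have "expectation (\<lambda>\<omega>. min (6 * (X \<omega>)^2) (\<bar>t\<bar> * \<bar>X \<omega>\<bar>^3)) \<le> expectation (\<lambda>\<omega>. \<bar>t\<bar> * b * (X \<omega>)\<^sup>2)"
      by (rule integral_mono[OF i' i le])
    then show "expectation (\<lambda>\<omega>. min (6 * (X \<omega>)^2) (\<bar>t\<bar> * \<bar>X \<omega>\<bar>^3)) \<le> \<bar>t\<bar> * b * v"
      by (simp add: v)
  qed simp
  also have "\<dots> \<le> \<bar>t\<bar> ^ 3 * b * v"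
  proof -
    have "t\<^sup>2 = \<bar>t\<bar> * \<bar>t\<bar>" by (simp add: power2_eq_square)
    then have "t\<^sup>2 * (\<bar>t\<bar> * b * v) = \<bar>t\<bar> ^ 3 * b * v"
      by (simp only: power3_eq_cube mult.assoc)
    moreover have "0 \<le> \<bar>t\<bar> ^ 3 * b * v" using bb v0 by simp
    ultimately show ?thesis by linarith
  qed
  finally have 1: "cmod (char (distr M borel X) t - (1 - t^2 * v / 2)) \<le> \<bar>t\<bar> ^ 3 * b * v" .
  define y where "y = t\<^sup>2 * v / 2"
  have y: "0 \<le> y" using v0 by (simp add: y_def)
  have "\<bar>exp (- y) - (1 - y)\<bar> \<le> y\<^sup>2"
  proof -
    have "1 - y \<le> exp (- y)" using exp_ge_add_one_self[of "- y"] by simp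
    moreover have "exp (- y) \<le> 1 - y + y\<^sup>2"
    proof -
      have "exp (- y) = 1 / exp y" by (simp add: exp_minus inverse_eq_divide)
      also have "\<dots> \<le> 1 / (1 + y)" using y exp_ge_add_one_self[of y] by (intro divide_left_mono) auto
      also have "\<dots> \<le> 1 - y + y\<^sup>2"
      proof -
        have "1 \<le> (1 - y + y\<^sup>2) * (1 + y)" using y by (simp add: algebra_simps power2_eq_square)
        then show ?thesis using y by (simp add: divide_le_eq)
      qed
      finally show ?thesis .
    qed
    ultimately show ?thesis by simp
  qed
  also have "y\<^sup>2 \<le> t ^ 4 * b\<^sup>2 * v"
  proof -
    have "y\<^sup>2 = t ^ 4 * (v * v) / 4" by (simp add: y_def power2_eq_square power4_eq_xxxx)
    also have "\<dots> \<le> t ^ 4 * (b\<^sup>2 * v) / 4"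
      using vb v0 by (intro divide_right_mono mult_left_mono mult_right_mono) auto
    also have "\<dots> \<le> t ^ 4 * (b\<^sup>2 * v)" using v0 by simp
    finally show ?thesis by (simp add: mult.assoc)
  qed
  finally have 2: "cmod (complex_of_real (1 - y) - exp (- y)) \<le> t ^ 4 * b\<^sup>2 * v"
    unfolding of_real_diff[symmetric] norm_of_real by (simp add: abs_minus_commute)
  have "cmod (char (distr M borel X) t - exp (- y))
      \<le> cmod (char (distr M borel X) t - (1 - t^2 * v / 2)) + cmod (complex_of_real (1 - y) - exp (- y))"
    using norm_triangle_ineq[of "char (distr M borel X) t - (1 - t^2 * v / 2)" "complex_of_real (1 - y) - exp (- y)"]
    by (simp add: y_def)
  with 1 2 show ?thesis by (simp add: y_def algebra_simps)
qed

text \<open>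
  The characteristic functions of the row sums are products, and products of numbers of modulus at
  most 1 differ by no more than the sum of the differences of the factors.
\<close>

theorem bounded_triangular_CLT:
  fixes \<xi> :: "nat \<Rightarrow> nat \<Rightarrow> 'a \<Rightarrow> real"
  assumes fin: "\<And>n. finite (J n)" and ind: "\<And>n. indep_vars (\<lambda>_. borel) (\<xi> n) (J n)"
    and b: "\<And>n i \<omega>. i \<in> J n \<Longrightarrow> \<bar>\<xi> n i \<omega>\<bar> \<le> b n" and cen: "\<And>n i. i \<in> J n \<Longrightarrow> expectation (\<xi> n i) = 0"
    and b0: "b \<longlonglongrightarrow> 0"
    and var: "(\<lambda>n. \<Sum>i\<in>J n. expectation (\<lambda>\<omega>. (\<xi> n i \<omega>)\<^sup>2)) \<longlonglongrightarrow> 1"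
  shows "weak_conv_m (\<lambda>n. distr M borel (\<lambda>\<omega>. \<Sum>i\<in>J n. \<xi> n i \<omega>)) std_normal_distribution"
proof (rule levy_continuity)
  have [measurable]: "\<xi> n i \<in> borel_measurable M" if "i \<in> J n" for n i
    using ind[of n] that by (auto simp: indep_vars_def2)
  show "real_distribution (distr M borel (\<lambda>\<omega>. \<Sum>i\<in>J n. \<xi> n i \<omega>))" for n
    by (rule real_distribution_distr) (auto intro: borel_measurable_sum)
  show "real_distribution std_normal_distribution" by (rule real_dist_normal_dist)
  fix t :: real
  define v where "v n i = expectation (\<lambda>\<omega>. (\<xi> n i \<omega>)\<^sup>2)" for n i
  define V where "V n = (\<Sum>i\<in>J n. v n i)" for n
  have V: "V \<longlonglongrightarrow> 1" using var by (simp add: V_def[abs_def] v_def)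
  have v0: "0 \<le> v n i" for n i by (simp add: v_def)
  let ?\<phi> = "\<lambda>n i. char (distr M borel (\<xi> n i)) t"
  have bound: "cmod (char (distr M borel (\<lambda>\<omega>. \<Sum>i\<in>J n. \<xi> n i \<omega>)) t - exp (- (t\<^sup>2 * V n / 2)))
      \<le> (\<bar>t\<bar> ^ 3 * b n + t ^ 4 * (b n)\<^sup>2) * V n" for n
  proof -
    have e: "complex_of_real (exp (- (t\<^sup>2 * V n / 2))) = (\<Prod>i\<in>J n. complex_of_real (exp (- (t\<^sup>2 * v n i / 2))))"
    proof -
      have "- (t\<^sup>2 * V n / 2) = (\<Sum>i\<in>J n. - (t\<^sup>2 * v n i / 2))"
        by (simp add: V_def sum_distrib_left sum_divide_distrib sum_negf)
      then show ?thesis using fin by (simp add: exp_sum)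
    qed
    have "cmod ((\<Prod>i\<in>J n. ?\<phi> n i) - (\<Prod>i\<in>J n. complex_of_real (exp (- (t\<^sup>2 * v n i / 2)))))
        \<le> (\<Sum>i\<in>J n. cmod (?\<phi> n i - complex_of_real (exp (- (t\<^sup>2 * v n i / 2)))))"
    proof (rule norm_prod_diff)
      fix i assume i: "i \<in> J n"
      interpret D: real_distribution "distr M borel (\<xi> n i)" using i by (intro real_distribution_distr) auto
      show "cmod (?\<phi> n i) \<le> 1" by (rule D.cmod_char_le_1)
      show "cmod (complex_of_real (exp (- (t\<^sup>2 * v n i / 2)))) \<le> 1"
        using v0[of n i] by (simp add: norm_of_real)
    qed
    also have "\<dots> \<le> (\<Sum>i\<in>J n. (\<bar>t\<bar> ^ 3 * b n + t ^ 4 * (b n)\<^sup>2) * v n i)"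
      by (intro sum_mono char_close_to_normal b cen) (auto simp: v_def)
    also have "\<dots> = (\<bar>t\<bar> ^ 3 * b n + t ^ 4 * (b n)\<^sup>2) * V n" by (simp add: V_def sum_distrib_left)
    finally show ?thesis unfolding e char_distr_sum[OF ind] .
  qed
  have "(\<lambda>n. (\<bar>t\<bar> ^ 3 * b n + t ^ 4 * (b n)\<^sup>2) * V n) \<longlonglongrightarrow> (\<bar>t\<bar> ^ 3 * 0 + t ^ 4 * 0\<^sup>2) * 1"
    by (intro tendsto_intros b0 V)
  then have "(\<lambda>n. (\<bar>t\<bar> ^ 3 * b n + t ^ 4 * (b n)\<^sup>2) * V n) \<longlonglongrightarrow> 0" by simp
  from Lim_null_comparison[OF always_eventually this] bound
  have d: "(\<lambda>n. char (distr M borel (\<lambda>\<omega>. \<Sum>i\<in>J n. \<xi> n i \<omega>)) t - exp (- (t\<^sup>2 * V n / 2))) \<longlonglongrightarrow> 0"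
    by (meson allI)
  have "(\<lambda>n. complex_of_real (exp (- (t\<^sup>2 * V n / 2)))) \<longlonglongrightarrow> complex_of_real (exp (- (t\<^sup>2 * 1 / 2)))"
    by (intro tendsto_intros V) auto
  from tendsto_add[OF d this]
  show "(\<lambda>n. char (distr M borel (\<lambda>\<omega>. \<Sum>i\<in>J n. \<xi> n i \<omega>)) t) \<longlonglongrightarrow> char std_normal_distribution t"
    by (simp add: char_std_normal_distribution)
qed

end

section \<open>Joint convergence of independent components\<close>

text \<open>
  Vectors with \<open>p\<close> components are represented by functions on all natural numbers that vanish from \<open>p\<close> on.
\<close>

definition cut :: "nat \<Rightarrow> (nat \<Rightarrow> real) \<Rightarrow> nat \<Rightarrow> real" where
  "cut p u i = (if i < p then u i else 0)"

lemma measurable_cut: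
  assumes "\<And>i. i < p \<Longrightarrow> (\<lambda>\<omega>. U \<omega> i) \<in> borel_measurable M"
  shows "(\<lambda>\<omega>. cut p (U \<omega>)) \<in> borel_measurable M"
proof (rule measurable_coordinatewise_then_product)
  fix i show "(\<lambda>\<omega>. cut p (U \<omega>) i) \<in> borel_measurable M"
    using assms by (cases "i < p") (simp_all add: cut_def)
qed

lemma (in prob_space) expectation_indep_vector:
  fixes U :: "nat \<Rightarrow> 'a \<Rightarrow> real" and G :: "(nat \<Rightarrow> real) \<Rightarrow> real"
  assumes ind: "indep_vars (\<lambda>_. borel) U {..<p}" and p: "p \<ge> 1" and [measurable]: "G \<in> borel_measurable borel"
  shows "expectation (\<lambda>\<omega>. G (cut p (\<lambda>i. U i \<omega>)))
    = (\<integral>u. G (cut p u) \<partial>(\<Pi>\<^sub>M i\<in>{..<p}. distr M borel (U i)))"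
proof -
  have rv: "\<And>i. i \<in> {..<p} \<Longrightarrow> U i \<in> borel_measurable M"
    using ind by (auto simp: indep_vars_def2)
  have eq: "distr M (\<Pi>\<^sub>M i\<in>{..<p}. borel) (\<lambda>\<omega>. \<lambda>i\<in>{..<p}. U i \<omega>) = (\<Pi>\<^sub>M i\<in>{..<p}. distr M borel (U i))"
    using ind p by (subst indep_vars_iff_distr_eq_PiM'[symmetric]) (auto intro: rv simp: lessThan_empty_iff)
  have "(\<lambda>u. cut p u) \<in> borel_measurable (\<Pi>\<^sub>M i\<in>{..<p}. borel)"
    by (rule measurable_cut) auto
  then have mG: "(\<lambda>u. G (cut p u)) \<in> borel_measurable (\<Pi>\<^sub>M i\<in>{..<p}. borel)"
    by (rule measurable_compose) simp
  have "(\<integral>u. G (cut p u) \<partial>(\<Pi>\<^sub>M i\<in>{..<p}. distr M borel (U i)))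
      = expectation (\<lambda>\<omega>. G (cut p (\<lambda>i\<in>{..<p}. U i \<omega>)))"
    unfolding eq[symmetric] by (rule integral_distr[OF _ mG]) (intro measurable_restrict rv)
  also have "\<dots> = expectation (\<lambda>\<omega>. G (cut p (\<lambda>i. U i \<omega>)))"
    by (intro arg_cong[where f=expectation] ext arg_cong[where f=G]) (simp add: cut_def)
  finally show ?thesis by simp
qed

lemma indep_vars_projections:
  fixes \<Omega> :: "'i \<Rightarrow> 'c measure"
  assumes ps: "\<And>i. i \<in> I \<Longrightarrow> prob_space (\<Omega> i)" and I: "I \<noteq> {}"
  shows "prob_space.indep_vars (Pi\<^sub>M I \<Omega>) \<Omega> (\<lambda>i \<omega>. \<omega> i) I"
proof -
  interpret P: prob_space "Pi\<^sub>M I \<Omega>" by (rule prob_space_PiM) (rule ps)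
  have "distr (Pi\<^sub>M I \<Omega>) (Pi\<^sub>M I \<Omega>) (\<lambda>\<omega>. \<lambda>i\<in>I. \<omega> i) = distr (Pi\<^sub>M I \<Omega>) (Pi\<^sub>M I \<Omega>) (\<lambda>\<omega>. \<omega>)"
    by (rule distr_cong) (auto simp: space_PiM PiE_iff extensional_def fun_eq_iff)
  also have "\<dots> = Pi\<^sub>M I \<Omega>" by (rule distr_id2) simp
  also have "\<dots> = (\<Pi>\<^sub>M i\<in>I. distr (Pi\<^sub>M I \<Omega>) (\<Omega> i) (\<lambda>\<omega>. \<omega> i))"
    by (rule PiM_cong) (auto simp: distr_PiM_component ps)
  finally show ?thesis
    by (subst P.indep_vars_iff_distr_eq_PiM'[OF I]) auto
qed

text \<open>
  By Skorohod's theorem every component has a copy that converges everywhere, on a space of its own; the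
  copies are made independent by placing them on the product of these spaces, and dominated
  convergence finishes the argument. The continuity of \<open>G\<close> is needed along componentwise convergent
  sequences, which is how it is stated.
\<close>

theorem joint_weak_convergence:
  fixes M :: "'a measure" and N :: "'b measure"
    and U :: "nat \<Rightarrow> nat \<Rightarrow> 'a \<Rightarrow> real" and Z :: "nat \<Rightarrow> 'b \<Rightarrow> real" and G :: "(nat \<Rightarrow> real) \<Rightarrow> real"
  assumes M: "prob_space M" and N: "prob_space N" and p: "p \<ge> 1"
    and indU: "\<And>n. prob_space.indep_vars M (\<lambda>_. borel) (U n) {..<p}"
    and indZ: "prob_space.indep_vars N (\<lambda>_. borel) Z {..<p}"
    and conv: "\<And>i. i < p \<Longrightarrow> weak_conv_m (\<lambda>n. distr M borel (U n i)) (distr N borel (Z i))"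
    and mG: "G \<in> borel_measurable borel" and bG: "\<And>u. \<bar>G u\<bar> \<le> B"
    and cG: "\<And>X x. (\<And>i. (\<lambda>n. X n i) \<longlonglongrightarrow> x i) \<Longrightarrow> (\<lambda>n. G (X n)) \<longlonglongrightarrow> G x"
  shows "(\<lambda>n. \<integral>\<omega>. G (cut p (\<lambda>i. U n i \<omega>)) \<partial>M) \<longlonglongrightarrow> (\<integral>\<omega>. G (cut p (\<lambda>i. Z i \<omega>)) \<partial>N)"
proof -
  interpret M: prob_space M by fact
  interpret N: prob_space N by fact
  have rU: "U n i \<in> borel_measurable M" if "i < p" for n i
    using indU[of n] that by (auto simp: M.indep_vars_def2)
  have rZ: "Z i \<in> borel_measurable N" if "i < p" for i
    using indZ that by (auto simp: N.indep_vars_def2)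
  define good where "good i \<Omega> Yn Y \<longleftrightarrow> prob_space \<Omega> \<and> (\<forall>n. Yn n \<in> measurable \<Omega> borel)
    \<and> (\<forall>n. distr \<Omega> borel (Yn n) = distr M borel (U n i)) \<and> Y \<in> measurable \<Omega> lborel
    \<and> distr \<Omega> borel Y = distr N borel (Z i) \<and> (\<forall>x\<in>space \<Omega>. (\<lambda>n. Yn n x) \<longlonglongrightarrow> Y x)"
    for i and \<Omega> :: "real measure" and Yn :: "nat \<Rightarrow> real \<Rightarrow> real" and Y :: "real \<Rightarrow> real"
  have "\<exists>\<Omega> Yn Y. good i \<Omega> Yn Y" if "i < p" for i
    unfolding good_def
    by (rule Skorohod) (use that rU rZ conv in \<open>auto intro: M.real_distribution_distr N.real_distribution_distr\<close>)
  then have "\<forall>i. \<exists>W. i < p \<longrightarrow> good i (fst W) (fst (snd W)) (snd (snd W))" by (metis fst_conv snd_conv)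
  then obtain W where W: "\<And>i. i < p \<Longrightarrow> good i (fst (W i)) (fst (snd (W i))) (snd (snd (W i)))" by metis
  define \<Omega> where "\<Omega> i = fst (W i)" for i
  define Yn where "Yn i = fst (snd (W i))" for i
  define Y where "Y i = snd (snd (W i))" for i
  have ps: "prob_space (\<Omega> i)" and mYn: "Yn i n \<in> borel_measurable (\<Omega> i)"
    and dYn: "distr (\<Omega> i) borel (Yn i n) = distr M borel (U n i)" and mY: "Y i \<in> borel_measurable (\<Omega> i)"
    and dY: "distr (\<Omega> i) borel (Y i) = distr N borel (Z i)"
    and cY: "\<And>x. x \<in> space (\<Omega> i) \<Longrightarrow> (\<lambda>n. Yn i n x) \<longlonglongrightarrow> Y i x" if "i < p" for i n
    using W[OF that] by (auto simp: good_def \<Omega>_def Yn_def Y_def)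
  let ?P = "Pi\<^sub>M {..<p} \<Omega>"
  interpret P: prob_space ?P by (rule prob_space_PiM) (use ps in auto)
  have indP: "P.indep_vars \<Omega> (\<lambda>i \<omega>. \<omega> i) {..<p}"
    by (rule indep_vars_projections) (use ps p in \<open>auto simp: lessThan_empty_iff\<close>)
  have mproj: "(\<lambda>\<omega>. \<omega> i) \<in> measurable ?P (\<Omega> i)" if "i < p" for i
    using that by (intro measurable_component_singleton) auto
  have transfer: "(\<integral>\<omega>. G (cut p (\<lambda>i. H i (\<omega> i))) \<partial>?P) = (\<integral>u. G (cut p u) \<partial>(\<Pi>\<^sub>M i\<in>{..<p}. D i))"
    if H: "\<And>i. i < p \<Longrightarrow> H i \<in> borel_measurable (\<Omega> i)" "\<And>i. i < p \<Longrightarrow> distr (\<Omega> i) borel (H i) = D i"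
    for H :: "nat \<Rightarrow> real \<Rightarrow> real" and D :: "nat \<Rightarrow> real measure"
  proof -
    have "P.indep_vars (\<lambda>_. borel) (\<lambda>i \<omega>. H i (\<omega> i)) {..<p}"
      by (rule P.indep_vars_compose2[OF indP]) (use H in auto)
    from P.expectation_indep_vector[OF this p mG]
    have "(\<integral>\<omega>. G (cut p (\<lambda>i. H i (\<omega> i))) \<partial>?P)
        = (\<integral>u. G (cut p u) \<partial>(\<Pi>\<^sub>M i\<in>{..<p}. distr ?P borel (\<lambda>\<omega>. H i (\<omega> i))))" .
    also have "(\<Pi>\<^sub>M i\<in>{..<p}. distr ?P borel (\<lambda>\<omega>. H i (\<omega> i))) = (\<Pi>\<^sub>M i\<in>{..<p}. D i)"
    proof (rule PiM_cong)
      fix i assume "i \<in> {..<p}"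
      then have i: "i < p" by simp
      have "distr ?P borel (\<lambda>\<omega>. H i (\<omega> i)) = distr (distr ?P (\<Omega> i) (\<lambda>\<omega>. \<omega> i)) borel (H i)"
        using distr_distr[OF H(1)[OF i] mproj[OF i]] by (simp add: comp_def)
      also have "distr ?P (\<Omega> i) (\<lambda>\<omega>. \<omega> i) = \<Omega> i"
        using i ps by (intro distr_PiM_component) auto
      finally show "distr ?P borel (\<lambda>\<omega>. H i (\<omega> i)) = D i" using H(2)[OF i] by simp
    qed simp
    finally show ?thesis .
  qed
  have meas: "(\<lambda>\<omega>. G (cut p (\<lambda>i. H i (\<omega> i)))) \<in> borel_measurable ?P"
    if "\<And>i. i < p \<Longrightarrow> H i \<in> borel_measurable (\<Omega> i)" for H :: "nat \<Rightarrow> real \<Rightarrow> real"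
  proof -
    have "(\<lambda>\<omega>. cut p (\<lambda>i. H i (\<omega> i))) \<in> borel_measurable ?P"
      by (rule measurable_cut) (rule measurable_compose[OF mproj that])
    then show ?thesis by (rule measurable_compose) (rule mG)
  qed
  have "(\<lambda>n. \<integral>\<omega>. G (cut p (\<lambda>i. Yn i n (\<omega> i))) \<partial>?P) \<longlonglongrightarrow> (\<integral>\<omega>. G (cut p (\<lambda>i. Y i (\<omega> i))) \<partial>?P)"
  proof (rule integral_dominated_convergence[where w="\<lambda>_. B"])
    show "AE \<omega> in ?P. (\<lambda>n. G (cut p (\<lambda>i. Yn i n (\<omega> i)))) \<longlonglongrightarrow> G (cut p (\<lambda>i. Y i (\<omega> i)))"
    proof (intro AE_I2 cG)
      fix \<omega> i assume \<omega>: "\<omega> \<in> space ?P"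
      have "\<omega> i \<in> space (\<Omega> i)" if "i < p" using \<omega> that by (auto simp: space_PiM)
      then show "(\<lambda>n. cut p (\<lambda>i. Yn i n (\<omega> i)) i) \<longlonglongrightarrow> cut p (\<lambda>i. Y i (\<omega> i)) i"
        by (auto simp: cut_def intro: cY)
    qed
  qed (use bG mYn mY in \<open>auto intro!: meas\<close>)
  moreover have "(\<integral>\<omega>. G (cut p (\<lambda>i. Yn i n (\<omega> i))) \<partial>?P) = (\<integral>\<omega>. G (cut p (\<lambda>i. U n i \<omega>)) \<partial>M)" for n
    using M.expectation_indep_vector[OF indU p mG] transfer[of "\<lambda>i. Yn i n", OF mYn dYn] by simp
  moreover have "(\<integral>\<omega>. G (cut p (\<lambda>i. Y i (\<omega> i))) \<partial>?P) = (\<integral>\<omega>. G (cut p (\<lambda>i. Z i \<omega>)) \<partial>N)"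
    using N.expectation_indep_vector[OF indZ p mG] transfer[of Y, OF mY dY] by simp
  ultimately show ?thesis by simp
qed

section \<open>Fourth moment of the oscillation\<close>

lemma (in prob_space) indep_vars_shift:
  fixes V :: "nat \<Rightarrow> 'a \<Rightarrow> real"
  assumes "indep_vars (\<lambda>_. borel) V UNIV"
  shows "indep_vars (\<lambda>_. borel) (\<lambda>k. V (u + k)) UNIV"
  by (rule indep_vars_past[OF assms, of UNIV "\<lambda>k. {u + k}"])
     (auto simp: disjoint_family_on_def intro: measurable_past_component)

lemma (in prob_space) fourth_moment_oscillation:
  fixes V :: "nat \<Rightarrow> 'a \<Rightarrow> real"
  assumes ind: "indep_vars (\<lambda>_. borel) V UNIV" and b: "\<And>i \<omega>. \<bar>V i \<omega>\<bar> \<le> b" and cen: "\<And>i. expectation (V i) = 0"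
    and uw: "u \<le> w"
  defines "s \<equiv> \<Sum>i\<in>{u..<w}. expectation (\<lambda>\<omega>. (V i \<omega>)\<^sup>2)"
  shows "expectation (\<lambda>\<omega>. running_max (\<lambda>j. \<bar>\<Sum>i\<in>{u..<u + j}. V i \<omega>\<bar> ^ 4) (w - u)) \<le> 512 * (3 * s\<^sup>2 + b\<^sup>2 * s)"
proof -
  have [measurable]: "V i \<in> borel_measurable M" for i using ind by (auto simp: indep_vars_def2)
  note ind' = indep_vars_shift[OF ind, of u]
  have sh: "(\<Sum>i\<in>{u..<u + j}. g i) = (\<Sum>k<j. g (u + k))" for j and g :: "nat \<Rightarrow> real"
    using sum.shift_bounds_nat_ivl[of g 0 u j] by (simp add: add.commute lessThan_atLeast0)
  have int: "integrable M (\<lambda>\<omega>. \<bar>V (u + k) \<omega>\<bar> ^ Suc 3)" for k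
  proof (rule integrable_const_bound[of _ "b ^ Suc 3", OF AE_I2])
    show "norm (\<bar>V (u + k) \<omega>\<bar> ^ Suc 3) \<le> b ^ Suc 3" for \<omega>
      unfolding real_norm_def power_abs abs_idempotent by (intro power_mono b) simp
  qed simp
  have "expectation (\<lambda>\<omega>. running_max (\<lambda>j. \<bar>\<Sum>k<j. V (u + k) \<omega>\<bar> ^ Suc 3) (w - u))
      \<le> 2 * 4 ^ Suc 3 * expectation (\<lambda>\<omega>. \<bar>\<Sum>k<w - u. V (u + k) \<omega>\<bar> ^ Suc 3)"
    by (rule maximal_inequality[OF ind' int cen]) simp
  also have "expectation (\<lambda>\<omega>. \<bar>\<Sum>k<w - u. V (u + k) \<omega>\<bar> ^ Suc 3) = expectation (\<lambda>\<omega>. (\<Sum>k<w - u. V (u + k) \<omega>) ^ 4)"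
  proof -
    have "Suc 3 = 4" by simp
    then show ?thesis by (simp only: power_even_abs even_numeral)
  qed
  also have "\<dots> \<le> 3 * (\<Sum>k<w - u. expectation (\<lambda>\<omega>. (V (u + k) \<omega>)\<^sup>2))\<^sup>2
      + b\<^sup>2 * (\<Sum>k<w - u. expectation (\<lambda>\<omega>. (V (u + k) \<omega>)\<^sup>2))"
    by (rule fourth_moment_indep_sum) (use b cen indep_vars_subset[OF ind'] in auto)
  also have "(\<Sum>k<w - u. expectation (\<lambda>\<omega>. (V (u + k) \<omega>)\<^sup>2)) = s"
    using sh[of "\<lambda>i. expectation (\<lambda>\<omega>. (V i \<omega>)\<^sup>2)" "w - u"] uw by (simp add: s_def)
  finally show ?thesis unfolding sh by (simp add: eval_nat_numeral)
qed

section \<open>The uniform topology on cadlag functions\<close>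

text \<open>
  The closed balls of the uniform metric, expressed without a supremum.
\<close>

definition near :: "(real \<Rightarrow> real) \<Rightarrow> (real \<Rightarrow> real) \<Rightarrow> real \<Rightarrow> bool" where
  "near x y r \<longleftrightarrow> (\<forall>t\<in>{0..1}. \<bar>x t - y t\<bar> \<le> r)"

lemma near_sym: "near x y r \<Longrightarrow> near y x r"
  by (auto simp: near_def abs_minus_commute)

lemma near_refl: "0 \<le> r \<Longrightarrow> near x x r"
  by (simp add: near_def)

lemma near_mono: "near x y r \<Longrightarrow> r \<le> q \<Longrightarrow> near x y q"
  by (fastforce simp: near_def)

lemma near_trans: "near x y r \<Longrightarrow> near y z q \<Longrightarrow> near x z (r + q)"
  unfolding near_def
proof
  fix t :: real assume "\<forall>t\<in>{0..1}. \<bar>x t - y t\<bar> \<le> r" "\<forall>t\<in>{0..1}. \<bar>y t - z t\<bar> \<le> q" "t \<in> {0..1}"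
  then have "\<bar>x t - y t\<bar> \<le> r" "\<bar>y t - z t\<bar> \<le> q" by auto
  then show "\<bar>x t - z t\<bar> \<le> r + q" by linarith
qed

definition sup_dist :: "(real \<Rightarrow> real) \<Rightarrow> (real \<Rightarrow> real) \<Rightarrow> real" where
  "sup_dist x y = (SUP t\<in>{0..1}. \<bar>x t - y t\<bar>)"

lemma sup_dist_le: "near x y r \<Longrightarrow> sup_dist x y \<le> r"
  unfolding sup_dist_def near_def by (intro cSUP_least) auto

lemma near_sup_dist:
  assumes "x \<in> cadlag01" "y \<in> cadlag01"
  shows "near x y (sup_dist x y)"
proof -
  obtain a b where "\<And>t. t \<in> {0..1} \<Longrightarrow> \<bar>x t\<bar> \<le> a" "\<And>t. t \<in> {0..1} \<Longrightarrow> \<bar>y t\<bar> \<le> b"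
    using cadlag01_bounded[OF assms(1)] cadlag01_bounded[OF assms(2)] by (fastforce simp: bounded_iff)
  then have "bdd_above ((\<lambda>t. \<bar>x t - y t\<bar>) ` {0..1})"
    by (intro bdd_aboveI2[where M="a + b"]) (fastforce intro: order_trans[OF abs_triangle_ineq4 add_mono])
  then show ?thesis unfolding near_def sup_dist_def by (auto intro: cSUP_upper)
qed

lemma sup_dist_nonneg: "x \<in> cadlag01 \<Longrightarrow> y \<in> cadlag01 \<Longrightarrow> 0 \<le> sup_dist x y"
  using near_sup_dist[of x y] unfolding near_def by (meson abs_ge_zero atLeastAtMost_iff order_trans zero_le_one order_refl)

lemma mdist_D01:
  assumes x: "x \<in> cadlag01" and y: "y \<in> cadlag01"
  shows "mdist (submetric (funspace {0..1} euclidean_metric) cadlag01) x y = sup_dist x y"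
proof -
  have *: "z \<in> mspace (funspace {0..1} euclidean_metric)" if "z \<in> cadlag01" for z
    using cadlag01_bounded[OF that] that by (auto simp: cadlag01_def Met_TC.fspace_def)
  show ?thesis
    using *[OF x] *[OF y] by (simp add: Met_TC.fdist_def sup_dist_def dist_real_def)
qed

lemma mspace_D01: "mspace (submetric (funspace {0..1} euclidean_metric) cadlag01) = cadlag01"
  using topspace_D01 unfolding D01_def by simp

lemma openin_D01:
  "openin D01 U \<longleftrightarrow> U \<subseteq> cadlag01 \<and> (\<forall>x\<in>U. \<exists>r>0. \<forall>y\<in>cadlag01. near x y r \<longrightarrow> y \<in> U)"
proof -
  let ?m = "submetric (funspace {0..1} euclidean_metric) cadlag01"
  interpret Metric_space "mspace ?m" "mdist ?m" by (rule Metric_space_mspace_mdist)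
  have 1: "openin D01 U \<longleftrightarrow> U \<subseteq> cadlag01 \<and> (\<forall>x. x \<in> U \<longrightarrow> (\<exists>r>0. mcball x r \<subseteq> U))"
    unfolding D01_def mtopology_of_def openin_mtopology_mcball unfolding mspace_D01 ..
  have "mcball x r \<subseteq> U \<longleftrightarrow> (\<forall>y\<in>cadlag01. near x y r \<longrightarrow> y \<in> U)" if "x \<in> cadlag01" for x r
  proof -
    have "y \<in> mcball x r \<longleftrightarrow> y \<in> cadlag01 \<and> near x y r" for y
    proof -
      have mc: "y \<in> mcball x r \<longleftrightarrow> y \<in> cadlag01 \<and> mdist ?m x y \<le> r"
        using that in_mcball[of y x r] by (simp only: mspace_D01 simp_thms)
      show ?thesis
      proof (cases "y \<in> cadlag01")
        case True
        then have "sup_dist x y \<le> r \<longleftrightarrow> near x y r"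
          using near_sup_dist[OF that True] by (auto intro: sup_dist_le near_mono)
        then show ?thesis unfolding mc mdist_D01[OF that True] by blast
      qed (simp only: mc simp_thms)
    qed
    then show ?thesis by auto
  qed
  note 2 = this
  have 3: "(\<exists>r>0. mcball x r \<subseteq> U) \<longleftrightarrow> (\<exists>r>0. \<forall>y\<in>cadlag01. near x y r \<longrightarrow> y \<in> U)"
    if "U \<subseteq> cadlag01" "x \<in> U" for x
    using 2[OF subsetD[OF that]] by simp
  show ?thesis
    unfolding 1 Ball_def[of U] by (intro conj_cong refl all_cong1 imp_cong 3)
qed

lemma continuous_map_D01:
  fixes F :: "(real \<Rightarrow> real) \<Rightarrow> real"
  assumes F: "continuous_map D01 euclidean F" and x: "x \<in> cadlag01" and e: "e > 0"
  shows "\<exists>r>0. \<forall>y\<in>cadlag01. near x y r \<longrightarrow> \<bar>F y - F x\<bar> < e"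
proof -
  have "openin D01 {z \<in> topspace D01. F z \<in> ball (F x) e}"
    by (rule openin_continuous_map_preimage[OF F]) simp
  then show ?thesis
    using x e unfolding openin_D01 topspace_D01
    by (simp add: dist_real_def abs_minus_commute) 
qed

lemma Lipschitz_continuous_D01:
  fixes F :: "(real \<Rightarrow> real) \<Rightarrow> real"
  assumes "\<And>x y r. x \<in> cadlag01 \<Longrightarrow> y \<in> cadlag01 \<Longrightarrow> 0 \<le> r \<Longrightarrow> near x y r \<Longrightarrow> \<bar>F x - F y\<bar> \<le> K * r"
  shows "continuous_map D01 euclidean F"
  unfolding continuous_map_alt
proof (intro conjI allI impI)
  fix V :: "real set" assume "openin euclidean V"
  then have V: "open V" by simp
  show "openin D01 (F -` V \<inter> topspace D01)"
    unfolding openin_D01 topspace_D01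
  proof (intro conjI ballI)
    fix x assume x: "x \<in> F -` V \<inter> cadlag01"
    then obtain e where e: "e > 0" "ball (F x) e \<subseteq> V" using V openE by blast
    define r where "r = e / (\<bar>K\<bar> + 1)"
    have r: "r > 0" "\<bar>K\<bar> * r < e"
    proof -
      show "r > 0" using e by (simp add: r_def add_nonneg_pos)
      have "\<bar>K\<bar> * e < e * (\<bar>K\<bar> + 1)" using e by (simp add: algebra_simps)
      then show "\<bar>K\<bar> * r < e" by (simp add: r_def pos_divide_less_eq add_nonneg_pos)
    qed
    have "y \<in> F -` V \<inter> cadlag01" if y: "y \<in> cadlag01" "near x y r" for y
    proof -
      have "\<bar>F x - F y\<bar> \<le> K * r" using assms[of x y r] x y r by auto
      also have "\<dots> \<le> \<bar>K\<bar> * r" using r by (intro mult_right_mono) auto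
      also have "\<dots> < e" by (rule r)
      finally show ?thesis using e y by (auto simp: dist_real_def)
    qed
    then show "\<exists>r>0. \<forall>y\<in>cadlag01. near x y r \<longrightarrow> y \<in> F -` V \<inter> cadlag01" using r by blast
  qed auto
qed auto

lemma space_Borel_of [simp]: "space (Borel_of T) = topspace T"
  unfolding Borel_of_def by (rule space_measure_of) (auto dest: openin_subset)

lemma sets_Borel_of_openin: "openin T U \<Longrightarrow> U \<in> sets (Borel_of T)"
  unfolding Borel_of_def by (subst sets_measure_of) (auto dest: openin_subset)

lemma measurable_Borel_ofI:
  assumes "\<And>\<omega>. \<omega> \<in> space M \<Longrightarrow> Z \<omega> \<in> topspace T"
    and "\<And>U. openin T U \<Longrightarrow> Z -` U \<inter> space M \<in> sets M"
  shows "Z \<in> measurable M (Borel_of T)"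
  unfolding Borel_of_def by (rule measurable_measure_of) (use assms in \<open>auto dest: openin_subset\<close>)

lemma continuous_map_measurable:
  fixes F :: "'c \<Rightarrow> real"
  assumes "continuous_map T euclidean F"
  shows "F \<in> borel_measurable (Borel_of T)"
proof (rule borel_measurableI)
  fix S :: "real set" assume "open S"
  then have "openin T {x \<in> topspace T. F x \<in> S}"
    by (intro openin_continuous_map_preimage[OF assms]) simp
  then show "F -` S \<inter> space (Borel_of T) \<in> sets (Borel_of T)"
    by (auto dest!: sets_Borel_of_openin simp: vimage_def Int_def conj_commute)
qed

section \<open>Step paths\<close>

text \<open>
  The rescaled partial sum process, for \<open>\<tau> j\<close> the \<open>j\<close>-th partial sum. With \<open>\<tau> i = w (i / p)\<close> the same operator yields
  the discretisation of a path \<open>w\<close> on the grid of mesh \<open>1 / p\<close>.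
\<close>

definition step_path :: "nat \<Rightarrow> (nat \<Rightarrow> real) \<Rightarrow> real \<Rightarrow> real" where
  "step_path n \<tau> = (\<lambda>t\<in>{0..1}. \<tau> (nat \<lfloor>real n * t\<rfloor>))"

lemma step_index_le: "t \<in> {0..1} \<Longrightarrow> nat \<lfloor>real n * t\<rfloor> \<le> n"
proof -
  assume "t \<in> {0..1}"
  then have "real n * t \<le> real n * 1" by (intro mult_left_mono) auto
  then have "\<lfloor>real n * t\<rfloor> \<le> int n" by linarith
  then show ?thesis by linarith
qed

lemma near_step_path: "(\<And>j. j \<le> n \<Longrightarrow> \<bar>\<tau> j - \<tau>' j\<bar> \<le> r) \<Longrightarrow> near (step_path n \<tau>) (step_path n \<tau>') r"
  unfolding near_def step_path_def using step_index_le by auto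

lemma step_path_cadlag: "step_path n \<tau> \<in> cadlag01"
proof (cases "n = 0")
  case True
  have c: "((\<lambda>t. \<tau> 0) \<longlongrightarrow> \<tau> 0) F" for F :: "real filter" by simp
  have "(step_path n \<tau> \<longlongrightarrow> step_path n \<tau> t) (at_right t)" if "t \<in> {0..<1}" for t
  proof -
    have "eventually (\<lambda>x. \<tau> 0 = step_path n \<tau> x) (at_right t)"
      using that True by (auto simp: eventually_at_right_field step_path_def intro!: exI[of _ 1])
    moreover have "step_path n \<tau> t = \<tau> 0" using that True by (simp add: step_path_def)
    ultimately show ?thesis using Lim_transform_eventually[OF c] by metis
  qed
  moreover have "(step_path n \<tau> \<longlongrightarrow> \<tau> 0) (at_left t)" if "t \<in> {0<..1}" for t
  proof -
    have "eventually (\<lambda>x. \<tau> 0 = step_path n \<tau> x) (at_left t)"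
      using that True by (auto simp: eventually_at_left_field step_path_def intro!: exI[of _ 0])
    from Lim_transform_eventually[OF c this] show ?thesis .
  qed
  moreover have "step_path n \<tau> \<in> extensional {0..1}" by (simp add: step_path_def)
  ultimately show ?thesis unfolding cadlag01_def by blast
next
  case False
  then have n: "real n > 0" by simp
  have "(step_path n \<tau> \<longlongrightarrow> step_path n \<tau> t) (at_right t)" if t: "t \<in> {0..<1}" for t
  proof -
    let ?b = "min 1 ((real_of_int \<lfloor>real n * t\<rfloor> + 1) / real n)"
    have b: "?b > t" using t n by (simp add: pos_less_divide_eq mult.commute)
    have "step_path n \<tau> x = step_path n \<tau> t" if x: "t < x" "x < ?b" for x
    proof -
      have "real n * x < real_of_int \<lfloor>real n * t\<rfloor> + 1" using x n by (simp add: pos_less_divide_eq mult.commute)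
      moreover have "real n * t \<le> real n * x" using x n by simp
      ultimately have "\<lfloor>real n * x\<rfloor> = \<lfloor>real n * t\<rfloor>" by linarith
      then show ?thesis using x t by (simp add: step_path_def)
    qed
    then have "eventually (\<lambda>x. step_path n \<tau> t = step_path n \<tau> x) (at_right t)"
      using b unfolding eventually_at_right_field by (intro exI[of _ ?b]) auto
    from Lim_transform_eventually[OF tendsto_const this] show ?thesis .
  qed
  moreover have "(step_path n \<tau> \<longlongrightarrow> \<tau> (nat (\<lceil>real n * t\<rceil> - 1))) (at_left t)" if t: "t \<in> {0<..1}" for t
  proof -
    let ?b = "max 0 ((real_of_int \<lceil>real n * t\<rceil> - 1) / real n)"
    have b: "?b < t"
    proof -
      have "real_of_int \<lceil>real n * t\<rceil> - 1 < real n * t" by linarith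
      then show ?thesis using t n by (simp add: pos_divide_less_eq mult.commute)
    qed
    have "step_path n \<tau> x = \<tau> (nat (\<lceil>real n * t\<rceil> - 1))" if x: "?b < x" "x < t" for x
    proof -
      have "real_of_int \<lceil>real n * t\<rceil> - 1 < real n * x" using x n by (simp add: pos_divide_less_eq mult.commute)
      moreover have "real n * x < real n * t" using x n by simp
      ultimately have "\<lfloor>real n * x\<rfloor> = \<lceil>real n * t\<rceil> - 1" by linarith
      then show ?thesis using x t by (simp add: step_path_def)
    qed
    then have "eventually (\<lambda>x. \<tau> (nat (\<lceil>real n * t\<rceil> - 1)) = step_path n \<tau> x) (at_left t)"
      using b unfolding eventually_at_left_field by (intro exI[of _ ?b]) auto
    from Lim_transform_eventually[OF tendsto_const this] show ?thesis .
  qed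
  moreover have "step_path n \<tau> \<in> extensional {0..1}" by (simp add: step_path_def)
  ultimately show ?thesis unfolding cadlag01_def by blast
qed

lemma continuous_path_cadlag:
  assumes "continuous_on {0..1} w"
  shows "(\<lambda>t\<in>{0..1}. w t) \<in> cadlag01"
proof -
  let ?w = "\<lambda>t\<in>{0..1}. w t"
  have lim: "(w \<longlongrightarrow> w t) (at t within {0..1})" if "t \<in> {0..1}" for t :: real
    using assms that by (auto simp: continuous_on_def)
  have lim': "(?w \<longlongrightarrow> w t) (at t within {0..1})" if "t \<in> {0..1}" for t :: real
  proof (rule Lim_transform_eventually[OF lim[OF that]])
    show "eventually (\<lambda>x. w x = ?w x) (at t within {0..1})"
      by (simp add: eventually_at_filter)
  qed
  have "(?w \<longlongrightarrow> ?w t) (at_right t)" if t: "t \<in> {0..<1}" for t :: real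
  proof -
    have "(?w \<longlongrightarrow> w t) (at t within {t..1})"
      by (rule tendsto_within_subset[OF lim']) (use t in auto)
    then show ?thesis using t by (simp add: at_within_Icc_at_right)
  qed
  moreover have "(?w \<longlongrightarrow> w t) (at_left t)" if t: "t \<in> {0<..1}" for t :: real
  proof -
    have "(?w \<longlongrightarrow> w t) (at t within {0..t})"
      by (rule tendsto_within_subset[OF lim']) (use t in auto)
    then show ?thesis using t by (simp add: at_within_Icc_at_left)
  qed
  moreover have "?w \<in> extensional {0..1}" by simp
  ultimately show ?thesis unfolding cadlag01_def by blast
qed

text \<open>
  A step path depends continuously on its finitely many values. This gives the measurability of the
  partial sum process for the Borel sets of the nonseparable space.
\<close>

lemma open_step_path_preimage:
  assumes "openin D01 U"
  shows "open {\<tau>. step_path n \<tau> \<in> U}"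
proof -
  have "\<exists>T. open T \<and> \<tau> \<in> T \<and> T \<subseteq> {\<tau>. step_path n \<tau> \<in> U}" if \<tau>: "step_path n \<tau> \<in> U" for \<tau>
  proof -
    obtain r where r: "r > 0" "\<And>y. y \<in> cadlag01 \<Longrightarrow> near (step_path n \<tau>) y r \<Longrightarrow> y \<in> U"
      using assms \<tau> unfolding openin_D01 by blast
    let ?T = "\<Inter>j\<in>{..n}. (\<lambda>\<tau>'::nat \<Rightarrow> real. \<tau>' j) -` ball (\<tau> j) r"
    have "open ?T"
      by (intro open_INT ballI open_vimage open_ball continuous_on_product_coordinates) auto
    moreover have "\<tau> \<in> ?T" using r by auto
    moreover have "?T \<subseteq> {\<tau>. step_path n \<tau> \<in> U}"
      using r(2)[OF step_path_cadlag near_step_path] by (force simp: dist_real_def)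
    ultimately show ?thesis by blast
  qed
  then show ?thesis by (subst open_subopen) blast
qed

lemma measurable_step_path_borel: "step_path n \<in> measurable borel (Borel_of D01)"
proof (rule measurable_Borel_ofI)
  show "step_path n -` U \<inter> space borel \<in> sets borel" if "openin D01 U" for U
    using open_step_path_preimage[OF that, of n] by (simp add: vimage_def)
qed (simp add: topspace_D01 step_path_cadlag)

lemma step_path_cong: "(\<And>j. j \<le> n \<Longrightarrow> \<tau> j = \<tau>' j) \<Longrightarrow> step_path n \<tau> = step_path n \<tau>'"
  unfolding step_path_def using step_index_le by (auto simp: restrict_def)

lemma measurable_step_path:
  assumes "\<And>j. j \<le> n \<Longrightarrow> \<tau> j \<in> borel_measurable M"
  shows "(\<lambda>\<omega>. step_path n (\<lambda>j. \<tau> j \<omega>)) \<in> measurable M (Borel_of D01)"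
proof -
  have "(\<lambda>\<omega>. step_path n (cut (Suc n) (\<lambda>j. \<tau> j \<omega>))) \<in> measurable M (Borel_of D01)"
    by (rule measurable_compose[OF measurable_cut measurable_step_path_borel]) (use assms in auto)
  moreover have "step_path n (cut (Suc n) (\<lambda>j. \<tau> j \<omega>)) = step_path n (\<lambda>j. \<tau> j \<omega>)" for \<omega>
    by (rule step_path_cong) (simp add: cut_def)
  ultimately show ?thesis by simp
qed

text \<open>
  The path \<open>W \<omega>\<close> lies in the open set \<open>U\<close> exactly if, for some \<open>m\<close>, all but finitely many \<open>Z p \<omega>\<close> lie in the open
  set \<open>I m\<close> of paths whose distance to the complement of \<open>U\<close> exceeds \<open>1 / Suc m\<close>.
\<close>

lemma measurable_uniform_limit_D01:
  assumes Z: "\<And>p. Z p \<in> measurable M (Borel_of D01)" and W: "\<And>\<omega>. \<omega> \<in> space M \<Longrightarrow> W \<omega> \<in> cadlag01"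
    and lim: "\<And>\<omega> e. \<omega> \<in> space M \<Longrightarrow> e > 0 \<Longrightarrow> eventually (\<lambda>p. near (Z p \<omega>) (W \<omega>) e) sequentially"
  shows "W \<in> measurable M (Borel_of D01)"
proof (rule measurable_Borel_ofI)
  show "\<omega> \<in> space M \<Longrightarrow> W \<omega> \<in> topspace D01" for \<omega> using W by (simp add: topspace_D01)
  fix U assume U: "openin D01 U"
  define I where "I m = {x \<in> cadlag01. \<exists>r>inverse (real (Suc m)). \<forall>y\<in>cadlag01. near x y r \<longrightarrow> y \<in> U}" for m
  have Zc: "Z p \<omega> \<in> cadlag01" if "\<omega> \<in> space M" for p \<omega>
    using measurable_space[OF Z that] by (simp add: topspace_D01)
  have "openin D01 (I m)" for m
    unfolding openin_D01
  proof (intro conjI ballI)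
    fix x assume "x \<in> I m"
    then obtain r where r: "r > inverse (real (Suc m))" "\<And>y. y \<in> cadlag01 \<Longrightarrow> near x y r \<Longrightarrow> y \<in> U"
      by (auto simp: I_def)
    define i where "i = inverse (real (Suc m))"
    define q where "q = (r - i) / 2"
    have ir: "i < r" using r(1) by (simp add: i_def)
    have "z \<in> I m" if z: "z \<in> cadlag01" "near x z q" for z
    proof -
      have "r - q > inverse (real (Suc m))" unfolding i_def[symmetric] q_def using ir by (simp add: field_simps)
      moreover have "y \<in> U" if "y \<in> cadlag01" "near z y (r - q)" for y
        using r(2)[OF that(1)] near_trans[OF z(2) that(2)] by simp
      ultimately show ?thesis using z by (auto simp: I_def)
    qed
    then show "\<exists>r>0. \<forall>y\<in>cadlag01. near x y r \<longrightarrow> y \<in> I m"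
      using ir by (intro exI[of _ q]) (auto simp: q_def)
  qed (auto simp: I_def)
  then have mI: "Z p -` I m \<inter> space M \<in> sets M" for p m
    using measurable_sets[OF Z sets_Borel_of_openin] by blast
  have "W -` U \<inter> space M = (\<Union>m. \<Union>P. \<Inter>p\<in>{P..}. Z p -` I m \<inter> space M)"
  proof (intro equalityI subsetI)
    fix \<omega> assume \<omega>: "\<omega> \<in> W -` U \<inter> space M"
    then obtain r where r: "r > 0" "\<And>y. y \<in> cadlag01 \<Longrightarrow> near (W \<omega>) y r \<Longrightarrow> y \<in> U"
      using U unfolding openin_D01 by blast
    obtain m where m: "inverse (real (Suc m)) < r / 2" using reals_Archimedean[of "r / 2"] r by auto
    obtain P where P: "\<And>p. p \<ge> P \<Longrightarrow> near (Z p \<omega>) (W \<omega>) (r / 2)"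
      using lim[of \<omega> "r / 2"] \<omega> r by (auto simp: eventually_sequentially)
    have "Z p \<omega> \<in> I m" if "p \<ge> P" for p
    proof -
      have "y \<in> U" if y: "y \<in> cadlag01" "near (Z p \<omega>) y (r / 2)" for y
        using r(2)[OF y(1)] near_trans[OF near_sym[OF P[OF \<open>p \<ge> P\<close>]] y(2)] by simp
      then show ?thesis using Zc \<omega> m unfolding I_def by blast
    qed
    then show "\<omega> \<in> (\<Union>m. \<Union>P. \<Inter>p\<in>{P..}. Z p -` I m \<inter> space M)" using \<omega> by blast
  next
    fix \<omega> assume "\<omega> \<in> (\<Union>m. \<Union>P. \<Inter>p\<in>{P..}. Z p -` I m \<inter> space M)"
    then obtain m P where mP: "\<And>p. p \<ge> P \<Longrightarrow> Z p \<omega> \<in> I m" "\<omega> \<in> space M" by fastforce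
    obtain P' where P': "\<And>p. p \<ge> P' \<Longrightarrow> near (Z p \<omega>) (W \<omega>) (inverse (real (Suc m)))"
      using lim[OF mP(2), of "inverse (real (Suc m))"] by (auto simp: eventually_sequentially)
    have "Z (max P P') \<omega> \<in> I m" "near (Z (max P P') \<omega>) (W \<omega>) (inverse (real (Suc m)))"
      using mP(1) P' by auto
    then obtain r where "inverse (real (Suc m)) < r" "\<And>y. y \<in> cadlag01 \<Longrightarrow> near (Z (max P P') \<omega>) y r \<Longrightarrow> y \<in> U"
      unfolding I_def by blast
    with near_mono[OF \<open>near (Z (max P P') \<omega>) (W \<omega>) (inverse (real (Suc m)))\<close>, of r] W[OF mP(2)]
    have "W \<omega> \<in> U" by simp
    then show "\<omega> \<in> W -` U \<inter> space M" using mP by simp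
  qed
  also have "\<dots> \<in> sets M"
    by (intro sets.countable_UN' sets.countable_INT' countableI_type image_subsetI mI) auto
  finally show "W -` U \<inter> space M \<in> sets M" .
qed

section \<open>Lipschitz test functions suffice\<close>

text \<open>
  The radius \<open>r\<close> is quantified so that estimates can be used with any convenient bound for the distance of two
  paths.
\<close>

definition Lipschitz_D01 :: "real \<Rightarrow> ((real \<Rightarrow> real) \<Rightarrow> real) \<Rightarrow> bool" where
  "Lipschitz_D01 K H \<longleftrightarrow> (\<forall>x\<in>cadlag01. \<forall>y\<in>cadlag01. \<forall>r\<ge>0. near x y r \<longrightarrow> \<bar>H x - H y\<bar> \<le> K * r)"

text \<open>
  The largest function below \<open>F\<close> that is \<open>k\<close>-Lipschitz for the uniform metric.
\<close>

definition Lipschitz_envelope :: "((real \<Rightarrow> real) \<Rightarrow> real) \<Rightarrow> nat \<Rightarrow> (real \<Rightarrow> real) \<Rightarrow> real" where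
  "Lipschitz_envelope F k x = (INF y\<in>cadlag01. F y + real k * sup_dist x y)"

context
  fixes F :: "(real \<Rightarrow> real) \<Rightarrow> real" and B :: real
  assumes F: "continuous_map D01 euclidean F" and B: "\<And>x. x \<in> cadlag01 \<Longrightarrow> \<bar>F x\<bar> \<le> B"
begin

lemma envelope_bdd_below:
  assumes "x \<in> cadlag01"
  shows "bdd_below ((\<lambda>y. F y + real k * sup_dist x y) ` cadlag01)"
proof (rule bdd_belowI2)
  fix y assume y: "y \<in> cadlag01"
  have "0 \<le> real k * sup_dist x y" by (simp add: assms sup_dist_nonneg y)
  then show "- B \<le> F y + real k * sup_dist x y" using B[OF y] by linarith
qed

lemma envelope_le:
  assumes "x \<in> cadlag01"
  shows "Lipschitz_envelope F k x \<le> F x"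
proof -
  have "Lipschitz_envelope F k x \<le> F x + real k * sup_dist x x"
    unfolding Lipschitz_envelope_def by (rule cINF_lower[OF envelope_bdd_below[OF assms] assms])
  moreover have "sup_dist x x = 0"
    using sup_dist_le[OF near_refl[of 0 x]] sup_dist_nonneg[OF assms assms] by simp
  ultimately show ?thesis by simp
qed

lemma envelope_ge:
  assumes "x \<in> cadlag01"
  shows "- B \<le> Lipschitz_envelope F k x"
  unfolding Lipschitz_envelope_def
proof (rule cINF_greatest)
  fix y assume y: "y \<in> cadlag01"
  have "0 \<le> real k * sup_dist x y" by (simp add: assms sup_dist_nonneg y)
  then show "- B \<le> F y + real k * sup_dist x y" using B[OF y] by linarith
qed (use assms in auto)

lemma envelope_bound: "x \<in> cadlag01 \<Longrightarrow> \<bar>Lipschitz_envelope F k x\<bar> \<le> B"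
  using envelope_le[of x k] envelope_ge[of x k] B[of x] by linarith

lemma envelope_Lipschitz: "Lipschitz_D01 (real k) (Lipschitz_envelope F k)"
proof -
  have le: "Lipschitz_envelope F k x \<le> Lipschitz_envelope F k y + real k * r"
    if xy: "x \<in> cadlag01" "y \<in> cadlag01" "near x y r" for x y r
  proof -
    have "Lipschitz_envelope F k x - real k * r \<le> Lipschitz_envelope F k y"
      unfolding Lipschitz_envelope_def[of F k y]
    proof (rule cINF_greatest)
      fix z assume z: "z \<in> cadlag01"
      have "Lipschitz_envelope F k x \<le> F z + real k * sup_dist x z"
        unfolding Lipschitz_envelope_def by (rule cINF_lower[OF envelope_bdd_below[OF xy(1)] z])
      moreover have "sup_dist x z \<le> r + sup_dist y z"
        by (rule sup_dist_le[OF near_trans[OF xy(3) near_sup_dist[OF xy(2) z]]])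
      then have "real k * sup_dist x z \<le> real k * (r + sup_dist y z)" by (rule mult_left_mono) simp
      ultimately show "Lipschitz_envelope F k x - real k * r \<le> F z + real k * sup_dist y z"
        by (simp add: algebra_simps)
    qed (use xy in auto)
    then show ?thesis by simp
  qed
  show ?thesis
    unfolding Lipschitz_D01_def
  proof (intro ballI allI impI)
    fix x y r assume "x \<in> cadlag01" "y \<in> cadlag01" "near x y r"
    then show "\<bar>Lipschitz_envelope F k x - Lipschitz_envelope F k y\<bar> \<le> real k * r"
      using le[of x y r] le[of y x r] near_sym[of x y r] by linarith
  qed
qed

text \<open>
  Once \<open>k * r \<ge> 2 * B\<close>, the points at distance more than \<open>r\<close> from \<open>x\<close> cannot lower the infimum, and inside this
  distance \<open>F\<close> is close to \<open>F x\<close>.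
\<close>

lemma envelope_tendsto:
  assumes x: "x \<in> cadlag01"
  shows "(\<lambda>k. Lipschitz_envelope F k x) \<longlonglongrightarrow> F x"
proof (rule LIMSEQ_I)
  fix e :: real assume e: "e > 0"
  obtain r where r: "r > 0" "\<And>y. y \<in> cadlag01 \<Longrightarrow> near x y r \<Longrightarrow> \<bar>F y - F x\<bar> < e / 2"
    using continuous_map_D01[OF F x, of "e / 2"] e by auto
  obtain k0 :: nat where k0: "2 * B / r \<le> real k0" using real_arch_simple by blast
  have "norm (Lipschitz_envelope F k x - F x) < e" if k: "k \<ge> k0" for k
  proof -
    have "F x - e / 2 \<le> Lipschitz_envelope F k x"
      unfolding Lipschitz_envelope_def
    proof (rule cINF_greatest)
      fix y assume y: "y \<in> cadlag01"
      have s0: "0 \<le> sup_dist x y" by (rule sup_dist_nonneg[OF x y])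
      show "F x - e / 2 \<le> F y + real k * sup_dist x y"
      proof (cases "sup_dist x y \<le> r")
        case True
        then have "\<bar>F y - F x\<bar> < e / 2" using r(2)[OF y near_mono[OF near_sup_dist[OF x y]]] by simp
        moreover have "0 \<le> real k * sup_dist x y" using s0 by simp
        ultimately show ?thesis by linarith
      next
        case False
        have "2 * B \<le> real k0 * r" using k0 r by (simp add: pos_divide_le_eq)
        also have "\<dots> \<le> real k * sup_dist x y" using False k r by (intro mult_mono) auto
        finally show ?thesis using B[OF x] B[OF y] e by linarith
      qed
    qed (use x in auto)
    with envelope_le[OF x, of k] e show ?thesis by simp
  qed
  then show "\<exists>k0. \<forall>k\<ge>k0. norm (Lipschitz_envelope F k x - F x) < e" by blast
qed

end

lemma Lipschitz_D01_measurable: "Lipschitz_D01 K H \<Longrightarrow> H \<in> borel_measurable (Borel_of D01)"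
  by (intro continuous_map_measurable Lipschitz_continuous_D01) (auto simp: Lipschitz_D01_def)

text \<open>
  The Lipschitz envelopes increase to \<open>F\<close>, which gives the lower bound for the limit inferior of the expectations; the
  upper bound is the same statement for \<open>- F\<close>.
\<close>

theorem converges_in_distribution_D01I:
  fixes M :: "'a measure" and N :: "'b measure"
  assumes M: "prob_space M" and N: "prob_space N"
    and Z: "\<And>n. Z n \<in> measurable M (Borel_of D01)" and W: "W \<in> measurable N (Borel_of D01)"
    and lim: "\<And>H K B. 0 \<le> K \<Longrightarrow> Lipschitz_D01 K H \<Longrightarrow> (\<And>x. x \<in> cadlag01 \<Longrightarrow> \<bar>H x\<bar> \<le> B) \<Longrightarrow>
      (\<lambda>n. \<integral>\<omega>. H (Z n \<omega>) \<partial>M) \<longlonglongrightarrow> (\<integral>\<omega>. H (W \<omega>) \<partial>N)"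
  shows "converges_in_distribution D01 M Z N W"
  unfolding converges_in_distribution_def
proof (intro conjI allI impI Z W)
  interpret M: prob_space M by fact
  interpret N: prob_space N by fact
  have Zc: "\<omega> \<in> space M \<Longrightarrow> Z n \<omega> \<in> cadlag01" for n \<omega>
    using measurable_space[OF Z] by (simp add: topspace_D01)
  have Wc: "\<omega> \<in> space N \<Longrightarrow> W \<omega> \<in> cadlag01" for \<omega>
    using measurable_space[OF W] by (simp add: topspace_D01)
  have lower: "eventually (\<lambda>n. (\<integral>\<omega>. F (W \<omega>) \<partial>N) - e < (\<integral>\<omega>. F (Z n \<omega>) \<partial>M)) sequentially"
    if F: "continuous_map D01 euclidean F" and B: "\<And>x. x \<in> cadlag01 \<Longrightarrow> \<bar>F x\<bar> \<le> B" and e: "e > 0"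
    for F :: "(real \<Rightarrow> real) \<Rightarrow> real" and B e :: real
  proof -
    let ?E = "Lipschitz_envelope F"
    note L = envelope_Lipschitz[OF F B]
    have mE: "?E k \<in> borel_measurable (Borel_of D01)" for k
      by (rule Lipschitz_D01_measurable[OF L])
    have mF: "F \<in> borel_measurable (Borel_of D01)" by (rule continuous_map_measurable[OF F])
    have "(\<lambda>k. \<integral>\<omega>. ?E k (W \<omega>) \<partial>N) \<longlonglongrightarrow> (\<integral>\<omega>. F (W \<omega>) \<partial>N)"
    proof (rule integral_dominated_convergence[where w="\<lambda>_. B"])
      show "AE \<omega> in N. (\<lambda>k. ?E k (W \<omega>)) \<longlonglongrightarrow> F (W \<omega>)"
        by (intro AE_I2 envelope_tendsto[OF F B] Wc)
      show "AE \<omega> in N. norm (?E k (W \<omega>)) \<le> B" for k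
        using envelope_bound[OF F B] Wc by (intro AE_I2) auto
    qed (auto intro: measurable_compose[OF W mE] measurable_compose[OF W mF])
    then have "eventually (\<lambda>k. (\<integral>\<omega>. F (W \<omega>) \<partial>N) - e < (\<integral>\<omega>. ?E k (W \<omega>) \<partial>N)) sequentially"
      by (rule order_tendstoD) (use e in simp)
    then obtain k where k: "(\<integral>\<omega>. F (W \<omega>) \<partial>N) - e < (\<integral>\<omega>. ?E k (W \<omega>) \<partial>N)"
      by (auto simp: eventually_sequentially)
    have "(\<lambda>n. \<integral>\<omega>. ?E k (Z n \<omega>) \<partial>M) \<longlonglongrightarrow> (\<integral>\<omega>. ?E k (W \<omega>) \<partial>N)"
      by (rule lim[OF _ L envelope_bound[OF F B]]) auto
    then have "eventually (\<lambda>n. (\<integral>\<omega>. F (W \<omega>) \<partial>N) - e < (\<integral>\<omega>. ?E k (Z n \<omega>) \<partial>M)) sequentially"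
      by (rule order_tendstoD) (rule k)
    then show ?thesis
    proof eventually_elim
      case (elim n)
      have "(\<integral>\<omega>. ?E k (Z n \<omega>) \<partial>M) \<le> (\<integral>\<omega>. F (Z n \<omega>) \<partial>M)"
      proof (rule integral_mono)
        show "integrable M (\<lambda>\<omega>. ?E k (Z n \<omega>))"
          by (rule M.integrable_const_bound[where B=B])
            (use envelope_bound[OF F B] Zc in \<open>auto intro: measurable_compose[OF Z mE]\<close>)
        show "integrable M (\<lambda>\<omega>. F (Z n \<omega>))"
          by (rule M.integrable_const_bound[where B=B])
            (use B Zc in \<open>auto intro: measurable_compose[OF Z mF]\<close>)
      qed (auto intro: envelope_le[OF F B] Zc)
      with elim show ?case by simp
    qed
  qed
  fix F :: "(real \<Rightarrow> real) \<Rightarrow> real"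
  assume "continuous_map D01 euclidean F \<and> bounded (F ` topspace D01)"
  then obtain B where F: "continuous_map D01 euclidean F" and B: "\<And>x. x \<in> cadlag01 \<Longrightarrow> \<bar>F x\<bar> \<le> B"
    by (auto simp: bounded_iff topspace_D01)
  have F': "continuous_map D01 euclidean (\<lambda>x. - F x)"
    using continuous_map_compose[OF F, of euclidean uminus]
    by (simp add: comp_def continuous_on_minus)
  show "(\<lambda>n. \<integral>\<omega>. F (Z n \<omega>) \<partial>M) \<longlonglongrightarrow> (\<integral>\<omega>. F (W \<omega>) \<partial>N)"
  proof (rule order_tendstoI)
    fix a assume "a < (\<integral>\<omega>. F (W \<omega>) \<partial>N)"
    then show "eventually (\<lambda>n. a < (\<integral>\<omega>. F (Z n \<omega>) \<partial>M)) sequentially"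
      using lower[OF F B, of "(\<integral>\<omega>. F (W \<omega>) \<partial>N) - a"] by simp
  next
    fix a assume "(\<integral>\<omega>. F (W \<omega>) \<partial>N) < a"
    then show "eventually (\<lambda>n. (\<integral>\<omega>. F (Z n \<omega>) \<partial>M) < a) sequentially"
      using lower[OF F', of B "a - (\<integral>\<omega>. F (W \<omega>) \<partial>N)"] B by simp
  qed
qed

section \<open>Brownian motion on a grid\<close>

context
  fixes N :: "'b measure" and W :: "real \<Rightarrow> 'b \<Rightarrow> real"
  assumes BM: "standard_brownian_motion N W"
begin

lemma BM_prob_space: "prob_space N"
  using BM by (simp add: standard_brownian_motion_def)

lemma BM_measurable: "t \<in> {0..1} \<Longrightarrow> W t \<in> borel_measurable N"
  using BM by (simp add: standard_brownian_motion_def)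

lemma BM_cadlag: "\<omega> \<in> space N \<Longrightarrow> (\<lambda>t\<in>{0..1}. W t \<omega>) \<in> cadlag01"
  using BM by (intro continuous_path_cadlag) (simp add: standard_brownian_motion_def)

lemma fraction_in_unit: "i \<le> p \<Longrightarrow> real i / real p \<in> {0..1}"
  by (cases "p = 0") auto

text \<open>
  Uniform continuity of the path on the compact interval.
\<close>

lemma BM_grid_approximation:
  assumes \<omega>: "\<omega> \<in> space N" and e: "e > 0"
  shows "eventually (\<lambda>p. near (step_path p (\<lambda>i. W (real i / real p) \<omega>)) (\<lambda>t\<in>{0..1}. W t \<omega>) e) sequentially"
proof -
  have "uniformly_continuous_on {0..1} (\<lambda>t. W t \<omega>)"
    using BM \<omega> by (intro compact_uniformly_continuous) (auto simp: standard_brownian_motion_def)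
  then obtain d where d: "d > 0" "\<forall>t\<in>{0..1}. \<forall>s\<in>{0..1}. \<bar>s - t\<bar> < d \<longrightarrow> \<bar>W s \<omega> - W t \<omega>\<bar> < e"
    using e unfolding uniformly_continuous_on_def dist_real_def by meson
  obtain p0 :: nat where p0: "p0 > 0" "inverse (real p0) < d"
    using ex_inverse_of_nat_less[OF d(1)] by auto
  have "near (step_path p (\<lambda>i. W (real i / real p) \<omega>)) (\<lambda>t\<in>{0..1}. W t \<omega>) e" if p: "p \<ge> p0" for p
    unfolding near_def
  proof
    fix t :: real assume t: "t \<in> {0..1}"
    have pp: "real p > 0" using p p0 by simp
    define i where "i = nat \<lfloor>real p * t\<rfloor>"
    have i: "real i \<le> real p * t" "real p * t < real i + 1"
      using t pp unfolding i_def by (auto simp: of_nat_nat)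
    have "\<bar>real i / real p - t\<bar> \<le> inverse (real p)"
    proof -
      have "real i / real p \<le> t" using i pp by (simp add: divide_le_eq mult.commute)
      moreover have "t \<le> (real i + 1) / real p" using i pp by (simp add: pos_le_divide_eq mult.commute)
      ultimately show ?thesis by (simp add: add_divide_distrib inverse_eq_divide)
    qed
    also have "\<dots> \<le> inverse (real p0)" using p p0 by (intro le_imp_inverse_le) auto
    also have "\<dots> < d" by (rule p0)
    finally have "\<bar>W (real i / real p) \<omega> - W t \<omega>\<bar> < e"
      using d(2)[rule_format, OF t fraction_in_unit] step_index_le[OF t, of p] by (simp add: i_def)
    then show "\<bar>step_path p (\<lambda>i. W (real i / real p) \<omega>) t - (\<lambda>t\<in>{0..1}. W t \<omega>) t\<bar> \<le> e"
      using t by (simp add: step_path_def i_def)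
  qed
  then show ?thesis unfolding eventually_sequentially by blast
qed

lemma BM_grid_measurable: "(\<lambda>\<omega>. step_path p (\<lambda>i. W (real i / real p) \<omega>)) \<in> measurable N (Borel_of D01)"
  by (intro measurable_step_path BM_measurable fraction_in_unit)

lemma BM_path_measurable: "(\<lambda>\<omega>. \<lambda>t\<in>{0..1}. W t \<omega>) \<in> measurable N (Borel_of D01)"
  by (rule measurable_uniform_limit_D01[OF BM_grid_measurable BM_cadlag BM_grid_approximation])

lemma BM_grid_limit:
  assumes H: "Lipschitz_D01 K H" and B: "\<And>x. x \<in> cadlag01 \<Longrightarrow> \<bar>H x\<bar> \<le> B" and K: "0 \<le> K"
  shows "(\<lambda>p. \<integral>\<omega>. H (step_path p (\<lambda>i. W (real i / real p) \<omega>)) \<partial>N) \<longlonglongrightarrow> (\<integral>\<omega>. H (\<lambda>t\<in>{0..1}. W t \<omega>) \<partial>N)"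
proof -
  interpret N: prob_space N by (rule BM_prob_space)
  note mH = Lipschitz_D01_measurable[OF H]
  show ?thesis
  proof (rule integral_dominated_convergence[where w="\<lambda>_. B"])
    show "AE \<omega> in N. (\<lambda>p. H (step_path p (\<lambda>i. W (real i / real p) \<omega>))) \<longlonglongrightarrow> H (\<lambda>t\<in>{0..1}. W t \<omega>)"
    proof (intro AE_I2 tendstoI)
      fix \<omega> and e :: real assume \<omega>: "\<omega> \<in> space N" and e: "e > 0"
      define r where "r = e / (K + 1)"
      have r: "r > 0" "K * r < e" using e K by (auto simp: r_def field_simps add_pos_nonneg)
      show "eventually (\<lambda>p. dist (H (step_path p (\<lambda>i. W (real i / real p) \<omega>))) (H (\<lambda>t\<in>{0..1}. W t \<omega>)) < e) sequentially"
        using BM_grid_approximation[OF \<omega> r(1)]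
      proof eventually_elim
        case (elim p)
        then have "\<bar>H (step_path p (\<lambda>i. W (real i / real p) \<omega>)) - H (\<lambda>t\<in>{0..1}. W t \<omega>)\<bar> \<le> K * r"
          using H step_path_cadlag BM_cadlag[OF \<omega>] r(1) unfolding Lipschitz_D01_def by simp
        with r show ?case by (simp add: dist_real_def)
      qed
    qed
  qed (use B in \<open>auto intro!: AE_I2 step_path_cadlag measurable_compose[OF BM_path_measurable mH]
      measurable_compose[OF BM_grid_measurable mH]\<close>)
qed

lemma BM_increment_std_normal:
  assumes "i < p"
  shows "distr N borel (\<lambda>\<omega>. sqrt (real p) * (W (real (Suc i) / real p) \<omega> - W (real i / real p) \<omega>)) = std_normal_distribution"
proof -
  interpret N: prob_space N by (rule BM_prob_space)
  have p: "real p > 0" using assms by simp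
  let ?s = "real i / real p" and ?t = "real (Suc i) / real p"
  have st: "0 \<le> ?s" "?s < ?t" "?t \<le> 1" using assms p by (auto simp: divide_strict_right_mono)
  have diff: "?t - ?s = 1 / real p" by (simp add: diff_divide_distrib[symmetric])
  have "distributed N lborel (\<lambda>\<omega>. W ?t \<omega> - W ?s \<omega>) (normal_density 0 (sqrt (?t - ?s)))"
    using BM st unfolding standard_brownian_motion_def by blast
  then have "distributed N lborel (\<lambda>\<omega>. 0 + sqrt (real p) * (W ?t \<omega> - W ?s \<omega>))
      (normal_density (0 + sqrt (real p) * 0) (\<bar>sqrt (real p)\<bar> * sqrt (?t - ?s)))"
    by (rule N.normal_density_affine) (use p diff in auto)
  moreover have "\<bar>sqrt (real p)\<bar> * sqrt (?t - ?s) = 1"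
    unfolding diff using p by (simp add: real_sqrt_divide)
  ultimately have "distributed N lborel (\<lambda>\<omega>. sqrt (real p) * (W ?t \<omega> - W ?s \<omega>)) std_normal_density" by simp
  then have "distr N lborel (\<lambda>\<omega>. sqrt (real p) * (W ?t \<omega> - W ?s \<omega>)) = std_normal_distribution"
    by (rule distributed_distr_eq_density)
  moreover have "distr N borel (\<lambda>\<omega>. sqrt (real p) * (W ?t \<omega> - W ?s \<omega>)) = distr N lborel (\<lambda>\<omega>. sqrt (real p) * (W ?t \<omega> - W ?s \<omega>))"
    by (rule distr_cong) auto
  ultimately show ?thesis by simp
qed

lemma BM_increments_indep:
  "prob_space.indep_vars N (\<lambda>_. borel)
    (\<lambda>i \<omega>. sqrt (real p) * (W (real (Suc i) / real p) \<omega> - W (real i / real p) \<omega>)) {..<p}"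
proof -
  interpret N: prob_space N by (rule BM_prob_space)
  have "mono_on {..p} (\<lambda>i. real i / real p)" "(\<lambda>i. real i / real p) ` {..p} \<subseteq> {0..1}"
    using fraction_in_unit by (auto intro!: mono_onI divide_right_mono)
  then have "N.indep_vars (\<lambda>_. borel) (\<lambda>i \<omega>. W (real (Suc i) / real p) \<omega> - W (real i / real p) \<omega>) {..<p}"
    using BM unfolding standard_brownian_motion_def by blast
  then show ?thesis by (rule N.indep_vars_compose2) auto
qed

text \<open>
  The values on the grid are sums of the increments, because Brownian motion starts almost surely at
  0. The increments are normalised to unit variance to match the central limit theorem.
\<close>

lemma BM_grid_increments:
  assumes p: "p \<ge> 1" and mH: "H \<in> borel_measurable (Borel_of D01)"
  shows "(\<integral>\<omega>. H (step_path p (\<lambda>i. W (real i / real p) \<omega>)) \<partial>N)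
    = (\<integral>\<omega>. H (step_path p (\<lambda>i. \<Sum>l<i. cut p (\<lambda>l. sqrt (real p) *
        (W (real (Suc l) / real p) \<omega> - W (real l / real p) \<omega>)) l / sqrt (real p))) \<partial>N)"
proof (rule integral_cong_AE)
  have m: "(\<lambda>\<omega>. \<Sum>l<i. cut p (\<lambda>l. sqrt (real p) * (W (real (Suc l) / real p) \<omega> - W (real l / real p) \<omega>)) l / sqrt (real p))
    \<in> borel_measurable N" for i
  proof (intro borel_measurable_sum)
    fix l
    show "(\<lambda>\<omega>. cut p (\<lambda>l. sqrt (real p) * (W (real (Suc l) / real p) \<omega> - W (real l / real p) \<omega>)) l / sqrt (real p))
        \<in> borel_measurable N"
    proof (cases "l < p")
      case True
      have "W (real (Suc l) / real p) \<in> borel_measurable N" "W (real l / real p) \<in> borel_measurable N"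
        using True by (intro BM_measurable fraction_in_unit; simp)+
      then show ?thesis using True by (simp add: cut_def)
    qed (simp add: cut_def)
  qed
  show "(\<lambda>\<omega>. H (step_path p (\<lambda>i. W (real i / real p) \<omega>))) \<in> borel_measurable N"
    by (rule measurable_compose[OF BM_grid_measurable mH])
  show "(\<lambda>\<omega>. H (step_path p (\<lambda>i. \<Sum>l<i. cut p (\<lambda>l. sqrt (real p) *
        (W (real (Suc l) / real p) \<omega> - W (real l / real p) \<omega>)) l / sqrt (real p)))) \<in> borel_measurable N"
    by (rule measurable_compose[OF measurable_step_path[OF m] mH])
  have "AE \<omega> in N. W 0 \<omega> = 0" using BM by (simp add: standard_brownian_motion_def)
  then show "AE \<omega> in N. H (step_path p (\<lambda>i. W (real i / real p) \<omega>)) = H (step_path p (\<lambda>i. \<Sum>l<i. cut p (\<lambda>l. sqrt (real p) *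
        (W (real (Suc l) / real p) \<omega> - W (real l / real p) \<omega>)) l / sqrt (real p)))"
  proof eventually_elim
    case (elim \<omega>)
    have "W (real j / real p) \<omega> = (\<Sum>l<j. cut p (\<lambda>l. sqrt (real p) *
        (W (real (Suc l) / real p) \<omega> - W (real l / real p) \<omega>)) l / sqrt (real p))" if "j \<le> p" for j
    proof -
      have "(\<Sum>l<j. cut p (\<lambda>l. sqrt (real p) * (W (real (Suc l) / real p) \<omega> - W (real l / real p) \<omega>)) l / sqrt (real p))
          = (\<Sum>l<j. W (real (Suc l) / real p) \<omega> - W (real l / real p) \<omega>)"
        using that p by (intro sum.cong) (auto simp: cut_def)
      also have "\<dots> = W (real j / real p) \<omega> - W (real 0 / real p) \<omega>"
        by (rule sum_lessThan_telescope)
      finally show ?thesis using elim by simp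
    qed
    then show ?case by (intro arg_cong[where f=H] step_path_cong)
  qed
qed

end

section \<open>The invariance principle\<close>

text \<open>
  Turns a bound on fourth moments into a bound on a mean, at the price of an arbitrary constant \<open>\<eta>\<close>.
\<close>

lemma le_add_fourth_power:
  fixes y \<eta> :: real
  assumes "\<eta> > 0" "0 \<le> y"
  shows "y \<le> \<eta> + y ^ 4 / \<eta> ^ 3"
proof (cases "y \<le> \<eta>")
  case True
  then show ?thesis using assms by (simp add: add_increasing2)
next
  case False
  then have "y * \<eta> ^ 3 \<le> y * y ^ 3" using assms by (intro mult_left_mono power_mono) auto
  then have "y \<le> y ^ 4 / \<eta> ^ 3" using assms by (simp add: pos_le_divide_eq eval_nat_numeral mult_ac)
  then show ?thesis using assms by simp
qed

text \<open>
  A sequence with its triangular array of blocks. The variance of the partial sums grows at least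
  linearly, and on every grid \<open>i / p\<close> it is asymptotically proportional to time.
\<close>

locale block_array = prob_space M for M :: "'a measure" +
  fixes x :: "nat \<Rightarrow> 'a \<Rightarrow> real" and \<delta> C :: "nat \<Rightarrow> real" and L :: "nat \<Rightarrow> nat"
    and V :: "nat \<Rightarrow> nat \<Rightarrow> 'a \<Rightarrow> real" and \<sigma> :: "nat \<Rightarrow> real" and h0 :: real
  assumes sqx: "\<And>k. square_integrable M (x k)"
    and blocks: "\<And>n. approximated_by_blocks x (\<delta> n) (L n) (C n) (V n)"
    and \<delta>0: "\<delta> \<longlonglongrightarrow> 0" and C0: "(\<lambda>n. C n / sqrt (real n)) \<longlonglongrightarrow> 0"
    and \<sigma>: "\<And>n. \<sigma> n = norm2 M (\<lambda>\<omega>. \<Sum>k<n. x k \<omega>)"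
    and h0: "h0 > 0" "eventually (\<lambda>n. h0 * real n \<le> (\<sigma> n)\<^sup>2) sequentially"
    and ratio: "\<And>p i. 1 \<le> p \<Longrightarrow> i \<le> p \<Longrightarrow> (\<lambda>n. \<sigma> ((n * i) div p) / \<sigma> n) \<longlonglongrightarrow> sqrt (real i / real p)"
begin

lemma
  shows L1: "L n \<ge> 1" and C_nonneg: "C n \<ge> 0" and indV: "indep_vars (\<lambda>_. borel) (V n) UNIV"
    and bV: "\<bar>V n i \<omega>\<bar> \<le> C n" and cV: "expectation (V n i) = 0"
    and err: "norm2 M (\<lambda>\<omega>. running_max (\<lambda>j. \<bar>(\<Sum>k<j. x k \<omega>) - (\<Sum>i<j div L n. V n i \<omega>)\<bar>) n) \<le> \<delta> n * sqrt (real n) + C n"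
  using blocks[of n] by (auto simp: approximated_by_blocks_def)

lemma mV [measurable]: "V n i \<in> borel_measurable M"
  using indV by (auto simp: indep_vars_def2)

lemma mx [measurable]: "x k \<in> borel_measurable M"
  using sqx by auto

lemma sqV: "square_integrable M (V n i)"
  using bV by (intro square_integrable_bounded) auto

text \<open>
  The block version of the partial sum \<open>S j\<close>. It depends on \<open>n\<close> through the array.
\<close>

definition T :: "nat \<Rightarrow> nat \<Rightarrow> 'a \<Rightarrow> real" where
  "T n j \<omega> = (\<Sum>i<j div L n. V n i \<omega>)"

definition S :: "nat \<Rightarrow> 'a \<Rightarrow> real" where
  "S j \<omega> = (\<Sum>k<j. x k \<omega>)"

lemma mT [measurable]: "T n j \<in> borel_measurable M"
  unfolding T_def[abs_def] by measurable

lemma mS [measurable]: "S j \<in> borel_measurable M"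
  unfolding S_def[abs_def] by measurable

lemma sqT: "square_integrable M (T n j)"
  unfolding T_def[abs_def] by (intro square_integrable_sum sqV)

lemma sqS: "square_integrable M (S j)"
  unfolding S_def[abs_def] by (intro square_integrable_sum sqx)

lemma \<sigma>_nonneg: "0 \<le> \<sigma> n"
  by (simp add: \<sigma>)

lemma \<sigma>_lower: "eventually (\<lambda>n. 0 < \<sigma> n \<and> sqrt (real n) / \<sigma> n \<le> 1 / sqrt h0) sequentially"
  using h0(2) eventually_gt_at_top[of 0]
proof eventually_elim
  case (elim n)
  have "sqrt h0 * sqrt (real n) \<le> \<sigma> n"
    unfolding real_sqrt_mult[symmetric] by (rule real_le_lsqrt) (use elim \<sigma>_nonneg in auto)
  moreover have "0 < sqrt h0 * sqrt (real n)" using elim h0 by simp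
  ultimately show ?case using h0 by (simp add: field_simps)
qed

lemma scaled_null:
  assumes "(\<lambda>n. u n / sqrt (real n)) \<longlonglongrightarrow> 0"
  shows "(\<lambda>n. u n / \<sigma> n) \<longlonglongrightarrow> 0"
proof (rule Lim_null_comparison)
  have "(\<lambda>n. \<bar>u n / sqrt (real n)\<bar> * (1 / sqrt h0)) \<longlonglongrightarrow> 0 * (1 / sqrt h0)"
    by (intro tendsto_mult tendsto_const tendsto_rabs_zero assms)
  then show "(\<lambda>n. \<bar>u n / sqrt (real n)\<bar> * (1 / sqrt h0)) \<longlonglongrightarrow> 0" by simp
  show "eventually (\<lambda>n. norm (u n / \<sigma> n) \<le> \<bar>u n / sqrt (real n)\<bar> * (1 / sqrt h0)) sequentially"
    using \<sigma>_lower eventually_gt_at_top[of 0]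
  proof eventually_elim
    case (elim n)
    have "norm (u n / \<sigma> n) = \<bar>u n / sqrt (real n)\<bar> * (sqrt (real n) / \<sigma> n)"
      using elim by (simp add: abs_divide)
    also have "\<dots> \<le> \<bar>u n / sqrt (real n)\<bar> * (1 / sqrt h0)"
      using elim by (intro mult_left_mono) auto
    finally show ?case .
  qed
qed

lemma err_null: "(\<lambda>n. (\<delta> n * sqrt (real n) + C n) / \<sigma> n) \<longlonglongrightarrow> 0"
proof (rule scaled_null)
  have "(\<lambda>n. \<delta> n + C n / sqrt (real n)) \<longlonglongrightarrow> 0" using tendsto_add[OF \<delta>0 C0] by simp
  moreover have "eventually (\<lambda>n. \<delta> n + C n / sqrt (real n) = (\<delta> n * sqrt (real n) + C n) / sqrt (real n)) sequentially"
    using eventually_gt_at_top[of 0] by eventually_elim (simp add: add_divide_distrib)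
  ultimately show "(\<lambda>n. (\<delta> n * sqrt (real n) + C n) / sqrt (real n)) \<longlonglongrightarrow> 0"
    by (rule Lim_transform_eventually)
qed

lemma C_null: "(\<lambda>n. C n / \<sigma> n) \<longlonglongrightarrow> 0"
  by (rule scaled_null[OF C0])

text \<open>
  The number of complete blocks before the grid time \<open>i / p\<close>.
\<close>

definition \<kappa> :: "nat \<Rightarrow> nat \<Rightarrow> nat \<Rightarrow> nat" where
  "\<kappa> n p i = ((n * i) div p) div L n"

lemma \<kappa>_mono: "i \<le> j \<Longrightarrow> \<kappa> n p i \<le> \<kappa> n p j"
  unfolding \<kappa>_def by (intro div_le_mono mult_le_mono2)

definition increment_variance :: "nat \<Rightarrow> nat \<Rightarrow> nat \<Rightarrow> real" where
  "increment_variance p n i = (\<Sum>l\<in>{\<kappa> n p i..<\<kappa> n p (Suc i)}. expectation (\<lambda>\<omega>. (V n l \<omega>)\<^sup>2))"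

lemma second_moment_T: "(norm2 M (T n j))\<^sup>2 = (\<Sum>l<j div L n. expectation (\<lambda>\<omega>. (V n l \<omega>)\<^sup>2))"
  unfolding norm2_square T_def
  by (intro second_moment_indep_sum sqV cV indep_vars_subset[OF indV]) auto

text \<open>
  The block sums have the same asymptotic standard deviations as the partial sums, and for them,
  unlike for the original sums, the variance is exactly additive in time.
\<close>

lemma increment_variance_limit:
  assumes i: "i < p"
  shows "(\<lambda>n. increment_variance p n i / (\<sigma> n)\<^sup>2) \<longlonglongrightarrow> 1 / real p"
proof -
  let ?j = "\<lambda>n i. (n * i) div p"
  have lim: "(\<lambda>n. norm2 M (T n (?j n i)) / \<sigma> n) \<longlonglongrightarrow> sqrt (real i / real p)" if "i \<le> p" for i
  proof -
    have "(\<lambda>n. (norm2 M (T n (?j n i)) - \<sigma> (?j n i)) / \<sigma> n) \<longlonglongrightarrow> 0"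
    proof (rule Lim_null_comparison[OF always_eventually err_null], intro allI)
      fix n
      let ?R = "\<lambda>\<omega>. running_max (\<lambda>j. \<bar>S j \<omega> - T n j \<omega>\<bar>) n"
      have sqR: "square_integrable M ?R"
        by (intro square_integrable_running_max square_integrable_abs square_integrable_diff sqS sqT)
      have j: "?j n i \<le> n" using that by (cases "p = 0") (auto intro: div_le_dividend order_trans[OF div_le_mono[OF mult_le_mono2]])
      have "\<bar>norm2 M (T n (?j n i)) - \<sigma> (?j n i)\<bar> \<le> norm2 M (\<lambda>\<omega>. T n (?j n i) \<omega> - S (?j n i) \<omega>)"
        unfolding \<sigma> using norm2_diff_triangle[OF sqT sqS] by (simp add: S_def[abs_def])
      also have "\<dots> \<le> norm2 M ?R"
      proof (rule norm2_mono[OF sqR])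
        show "AE \<omega> in M. \<bar>T n (?j n i) \<omega> - S (?j n i) \<omega>\<bar> \<le> \<bar>?R \<omega>\<bar>"
          using running_max_ge[OF j]
          by (intro AE_I2) (metis (mono_tags, lifting) abs_ge_self abs_minus_commute order_trans)
      qed simp
      also have "\<dots> \<le> \<delta> n * sqrt (real n) + C n" using err[of n] by (simp add: S_def T_def)
      finally show "norm ((norm2 M (T n (?j n i)) - \<sigma> (?j n i)) / \<sigma> n) \<le> (\<delta> n * sqrt (real n) + C n) / \<sigma> n"
        using \<sigma>_nonneg[of n] by (simp add: divide_right_mono)
    qed
    from tendsto_add[OF this ratio[OF _ that]] i show ?thesis by (simp add: diff_divide_distrib)
  qed
  have e: "increment_variance p n i / (\<sigma> n)\<^sup>2
      = (norm2 M (T n (?j n (Suc i))) / \<sigma> n)\<^sup>2 - (norm2 M (T n (?j n i)) / \<sigma> n)\<^sup>2" for n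
  proof -
    have "(norm2 M (T n (?j n (Suc i))))\<^sup>2 = (norm2 M (T n (?j n i)))\<^sup>2 + increment_variance p n i"
      unfolding second_moment_T increment_variance_def lessThan_atLeast0 \<kappa>_def[symmetric]
      by (rule sum.atLeastLessThan_concat[symmetric]) (auto intro: \<kappa>_mono)
    then show ?thesis by (simp add: power_divide diff_divide_distrib[symmetric])
  qed
  have "(\<lambda>n. (norm2 M (T n (?j n (Suc i))) / \<sigma> n)\<^sup>2 - (norm2 M (T n (?j n i)) / \<sigma> n)\<^sup>2)
      \<longlonglongrightarrow> (sqrt (real (Suc i) / real p))\<^sup>2 - (sqrt (real i / real p))\<^sup>2"
    using i by (intro tendsto_diff tendsto_power lim) auto
  moreover have "(sqrt (real (Suc i) / real p))\<^sup>2 - (sqrt (real i / real p))\<^sup>2 = 1 / real p"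
    by (simp add: diff_divide_distrib[symmetric])
  ultimately show ?thesis unfolding e by simp
qed

lemma increment_CLT:
  assumes i: "i < p"
  shows "weak_conv_m (\<lambda>n. distr M borel (\<lambda>\<omega>. \<Sum>l\<in>{\<kappa> n p i..<\<kappa> n p (Suc i)}. sqrt (real p) * V n l \<omega> / \<sigma> n)) std_normal_distribution"
proof (rule bounded_triangular_CLT)
  show "indep_vars (\<lambda>_. borel) (\<lambda>l \<omega>. sqrt (real p) * V n l \<omega> / \<sigma> n) {\<kappa> n p i..<\<kappa> n p (Suc i)}" for n
    by (rule indep_vars_compose2[OF indep_vars_subset[OF indV]]) auto
  show "\<bar>sqrt (real p) * V n l \<omega> / \<sigma> n\<bar> \<le> sqrt (real p) * (C n / \<sigma> n)" for n l \<omega>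
    using bV[of n l \<omega>] \<sigma>_nonneg[of n]
    by (simp add: abs_mult abs_divide divide_right_mono mult_left_mono)
  show "expectation (\<lambda>\<omega>. sqrt (real p) * V n l \<omega> / \<sigma> n) = 0" for n l
    using cV by simp
  show "(\<lambda>n. sqrt (real p) * (C n / \<sigma> n)) \<longlonglongrightarrow> 0"
    using tendsto_mult[OF tendsto_const C_null, of "sqrt (real p)"] by simp
  have "(\<lambda>n. real p * (increment_variance p n i / (\<sigma> n)\<^sup>2)) \<longlonglongrightarrow> real p * (1 / real p)"
    by (intro tendsto_mult tendsto_const increment_variance_limit i)
  moreover have "real p * (1 / real p) = 1" using i by simp
  moreover have "(\<Sum>l\<in>{\<kappa> n p i..<\<kappa> n p (Suc i)}. expectation (\<lambda>\<omega>. (sqrt (real p) * V n l \<omega> / \<sigma> n)\<^sup>2))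
      = real p * (increment_variance p n i / (\<sigma> n)\<^sup>2)" for n
    by (simp add: increment_variance_def power_divide power_mult_distrib sum_divide_distrib sum_distrib_left)
  ultimately show "(\<lambda>n. \<Sum>l\<in>{\<kappa> n p i..<\<kappa> n p (Suc i)}. expectation (\<lambda>\<omega>. (sqrt (real p) * V n l \<omega> / \<sigma> n)\<^sup>2)) \<longlonglongrightarrow> 1"
    by simp
qed simp

text \<open>
  The path on the grid is a Lipschitz function of its \<open>p\<close> increments. These are independent because they
  are made of disjoint sets of blocks, and each of them obeys the central limit theorem.
\<close>

lemma grid_limit:
  fixes N :: "'b measure"
  assumes BM: "standard_brownian_motion N W" and p: "p \<ge> 1"
    and H: "Lipschitz_D01 K H" and B: "\<And>x. x \<in> cadlag01 \<Longrightarrow> \<bar>H x\<bar> \<le> B" and K: "0 \<le> K"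
  shows "(\<lambda>n. expectation (\<lambda>\<omega>. H (step_path p (\<lambda>i. T n ((n * i) div p) \<omega> / \<sigma> n))))
    \<longlonglongrightarrow> (\<integral>\<omega>. H (step_path p (\<lambda>i. W (real i / real p) \<omega>)) \<partial>N)"
proof -
  interpret N: prob_space N by (rule BM_prob_space[OF BM])
  note mH = Lipschitz_D01_measurable[OF H]
  define G where "G u = H (step_path p (\<lambda>i. \<Sum>l<i. u l / sqrt (real p)))" for u
  define U where "U n i \<omega> = (\<Sum>l\<in>{\<kappa> n p i..<\<kappa> n p (Suc i)}. sqrt (real p) * V n l \<omega> / \<sigma> n)" for n i \<omega>
  define Z where "Z i \<omega> = sqrt (real p) * (W (real (Suc i) / real p) \<omega> - W (real i / real p) \<omega>)" for i \<omega>
  have "(\<lambda>n. expectation (\<lambda>\<omega>. G (cut p (\<lambda>i. U n i \<omega>)))) \<longlonglongrightarrow> (\<integral>\<omega>. G (cut p (\<lambda>i. Z i \<omega>)) \<partial>N)"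
  proof (rule joint_weak_convergence[OF prob_space_axioms N.prob_space_axioms p])
    show "indep_vars (\<lambda>_. borel) (U n) {..<p}" for n
    proof (rule indep_vars_past[OF indV])
      have "{\<kappa> n p i..<\<kappa> n p (Suc i)} \<inter> {\<kappa> n p j..<\<kappa> n p (Suc j)} = {}" if "i < j" for i j
        using \<kappa>_mono[of "Suc i" j n p] that by auto
      then show "disjoint_family_on (\<lambda>i. {\<kappa> n p i..<\<kappa> n p (Suc i)}) {..<p}"
        unfolding disjoint_family_on_def by (metis Int_commute nat_neq_iff)
      show "U n i \<in> borel_measurable (past (V n) {\<kappa> n p i..<\<kappa> n p (Suc i)})" for i
        unfolding U_def[abs_def]
        by (intro borel_measurable_sum borel_measurable_divide borel_measurable_times borel_measurable_const
            measurable_past_component)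
    qed auto
    show "N.indep_vars (\<lambda>_. borel) Z {..<p}"
      unfolding Z_def[abs_def] by (rule BM_increments_indep[OF BM])
    show "weak_conv_m (\<lambda>n. distr M borel (U n i)) (distr N borel (Z i))" if "i < p" for i
      using increment_CLT[OF that] BM_increment_std_normal[OF BM that]
      by (simp add: U_def[abs_def] Z_def[abs_def])
    show "G \<in> borel_measurable borel"
      unfolding G_def
    proof (rule measurable_compose[OF measurable_step_path mH])
      show "(\<lambda>u. \<Sum>l<j. u l / sqrt (real p)) \<in> borel_measurable borel" for j
        by (intro borel_measurable_continuous_onI continuous_intros continuous_on_product_coordinates) (use p in auto)
    qed
    show "\<bar>G u\<bar> \<le> B" for u unfolding G_def by (intro B step_path_cadlag)
    show "(\<lambda>n. G (X n)) \<longlonglongrightarrow> G y" if X: "\<And>i. (\<lambda>n. X n i) \<longlonglongrightarrow> y i" for X y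
    proof -
      let ?s = "\<lambda>u i. \<Sum>l<i. u l / sqrt (real p)"
      define R where "R n = (\<Sum>i\<le>p. \<bar>?s (X n) i - ?s y i\<bar>)" for n
      have "R \<longlonglongrightarrow> (\<Sum>i\<le>p. \<bar>?s y i - ?s y i\<bar>)"
        unfolding R_def[abs_def] using p by (intro tendsto_intros X) auto
      then have R: "(\<lambda>n. K * R n) \<longlonglongrightarrow> 0" using tendsto_mult[OF tendsto_const, of R 0 sequentially K] by simp
      have "\<bar>G (X n) - G y\<bar> \<le> K * R n" for n
      proof -
        have "near (step_path p (?s (X n))) (step_path p (?s y)) (R n)"
          unfolding R_def by (intro near_step_path member_le_sum) auto
        moreover have "0 \<le> R n" unfolding R_def by (intro sum_nonneg) auto
        ultimately show ?thesis using H step_path_cadlag unfolding G_def Lipschitz_D01_def by simp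
      qed
      then have "(\<lambda>n. G (X n) - G y) \<longlonglongrightarrow> 0"
        by (intro Lim_null_comparison[OF always_eventually R]) auto
      then show ?thesis by (rule Lim_null[THEN iffD2])
    qed
  qed
  moreover have "G (cut p (\<lambda>i. U n i \<omega>)) = H (step_path p (\<lambda>i. T n ((n * i) div p) \<omega> / \<sigma> n))" for n \<omega>
    unfolding G_def
  proof (intro arg_cong[where f=H] step_path_cong)
    fix i assume i: "i \<le> p"
    have "(\<Sum>l<i. cut p (\<lambda>i. U n i \<omega>) l / sqrt (real p))
        = (\<Sum>l<i. \<Sum>m\<in>{\<kappa> n p l..<\<kappa> n p (Suc l)}. V n m \<omega> / \<sigma> n)"
      using i p by (intro sum.cong) (auto simp: cut_def U_def sum_divide_distrib)
    also have "\<dots> = (\<Sum>m<\<kappa> n p i. V n m \<omega> / \<sigma> n)"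
    proof (induction i)
      case (Suc i)
      then show ?case
        unfolding lessThan_Suc
        using sum.atLeastLessThan_concat[of 0 "\<kappa> n p i" "\<kappa> n p (Suc i)" "\<lambda>m. V n m \<omega> / \<sigma> n"] \<kappa>_mono[of i "Suc i" n p]
        by (simp add: lessThan_atLeast0 add.commute)
    qed (simp add: \<kappa>_def)
    also have "\<dots> = T n ((n * i) div p) \<omega> / \<sigma> n"
      by (simp add: T_def \<kappa>_def sum_divide_distrib)
    finally show "(\<Sum>l<i. cut p (\<lambda>i. U n i \<omega>) l / sqrt (real p)) = T n ((n * i) div p) \<omega> / \<sigma> n" .
  qed
  moreover have "(\<integral>\<omega>. G (cut p (\<lambda>i. Z i \<omega>)) \<partial>N) = (\<integral>\<omega>. H (step_path p (\<lambda>i. W (real i / real p) \<omega>)) \<partial>N)"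
    unfolding G_def Z_def using BM_grid_increments[OF BM p mH] by simp
  ultimately show ?thesis by simp
qed

lemma expectation_Lipschitz:
  assumes H: "Lipschitz_D01 K H" and B: "\<And>x. x \<in> cadlag01 \<Longrightarrow> \<bar>H x\<bar> \<le> B" and K: "0 \<le> K"
    and Z: "Z \<in> measurable M (Borel_of D01)" "Z' \<in> measurable M (Borel_of D01)"
    and R: "integrable M R" "\<And>\<omega>. 0 \<le> R \<omega>" "\<And>\<omega>. \<omega> \<in> space M \<Longrightarrow> near (Z \<omega>) (Z' \<omega>) (R \<omega>)"
  shows "\<bar>expectation (\<lambda>\<omega>. H (Z \<omega>)) - expectation (\<lambda>\<omega>. H (Z' \<omega>))\<bar> \<le> K * expectation R"
proof -
  note mH = Lipschitz_D01_measurable[OF H]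
  have c: "\<omega> \<in> space M \<Longrightarrow> Z \<omega> \<in> cadlag01" "\<omega> \<in> space M \<Longrightarrow> Z' \<omega> \<in> cadlag01" for \<omega>
    using measurable_space[OF Z(1)] measurable_space[OF Z(2)] by (simp_all add: topspace_D01)
  have i: "integrable M (\<lambda>\<omega>. H (Z \<omega>))" "integrable M (\<lambda>\<omega>. H (Z' \<omega>))"
    using B c by (auto intro!: integrable_const_bound[where B=B] AE_I2 measurable_compose[OF Z(1) mH] measurable_compose[OF Z(2) mH])
  have "\<bar>expectation (\<lambda>\<omega>. H (Z \<omega>)) - expectation (\<lambda>\<omega>. H (Z' \<omega>))\<bar> = \<bar>expectation (\<lambda>\<omega>. H (Z \<omega>) - H (Z' \<omega>))\<bar>"
    using i by simp
  also have "\<dots> \<le> expectation (\<lambda>\<omega>. \<bar>H (Z \<omega>) - H (Z' \<omega>)\<bar>)" by (rule integral_abs_bound)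
  also have "\<dots> \<le> expectation (\<lambda>\<omega>. K * R \<omega>)"
  proof (rule integral_mono)
    show "\<bar>H (Z \<omega>) - H (Z' \<omega>)\<bar> \<le> K * R \<omega>" if "\<omega> \<in> space M" for \<omega>
      using H c[OF that] R(2,3) that unfolding Lipschitz_D01_def by blast
  qed (use i R in auto)
  finally show ?thesis by simp
qed

text \<open>
  Replacing the partial sums by block sums moves the path by at most the maximal error of the block
  approximation, divided by \<open>\<sigma> n\<close>.
\<close>

lemma block_error:
  assumes H: "Lipschitz_D01 K H" and B: "\<And>x. x \<in> cadlag01 \<Longrightarrow> \<bar>H x\<bar> \<le> B" and K: "0 \<le> K"
  shows "\<bar>expectation (\<lambda>\<omega>. H (step_path n (\<lambda>j. S j \<omega> / \<sigma> n))) - expectation (\<lambda>\<omega>. H (step_path n (\<lambda>j. T n j \<omega> / \<sigma> n)))\<bar>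
    \<le> K * ((\<delta> n * sqrt (real n) + C n) / \<sigma> n)"
proof -
  let ?R = "\<lambda>\<omega>. running_max (\<lambda>j. \<bar>S j \<omega> - T n j \<omega>\<bar>) n"
  have sqR: "square_integrable M ?R"
    by (intro square_integrable_running_max square_integrable_abs square_integrable_diff sqS sqT)
  have R0: "0 \<le> ?R \<omega>" for \<omega> by (intro running_max_nonneg) simp
  have "\<bar>expectation (\<lambda>\<omega>. H (step_path n (\<lambda>j. S j \<omega> / \<sigma> n))) - expectation (\<lambda>\<omega>. H (step_path n (\<lambda>j. T n j \<omega> / \<sigma> n)))\<bar>
      \<le> K * expectation (\<lambda>\<omega>. ?R \<omega> / \<sigma> n)"
  proof (rule expectation_Lipschitz[OF H B K])
    show "near (step_path n (\<lambda>j. S j \<omega> / \<sigma> n)) (step_path n (\<lambda>j. T n j \<omega> / \<sigma> n)) (?R \<omega> / \<sigma> n)" for \<omega>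
    proof (rule near_step_path)
      fix j assume "j \<le> n"
      then have "\<bar>S j \<omega> - T n j \<omega>\<bar> / \<sigma> n \<le> ?R \<omega> / \<sigma> n"
        using \<sigma>_nonneg by (intro divide_right_mono running_max_ge[of j n "\<lambda>j. \<bar>S j \<omega> - T n j \<omega>\<bar>"])
      then show "\<bar>S j \<omega> / \<sigma> n - T n j \<omega> / \<sigma> n\<bar> \<le> ?R \<omega> / \<sigma> n"
        using \<sigma>_nonneg[of n] by (simp add: diff_divide_distrib[symmetric])
    qed
    show "integrable M (\<lambda>\<omega>. ?R \<omega> / \<sigma> n)" using square_integrable_integrable[OF sqR] by simp
    show "0 \<le> ?R \<omega> / \<sigma> n" for \<omega> using R0 \<sigma>_nonneg by simp
  qed (auto intro!: measurable_step_path)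
  also have "expectation (\<lambda>\<omega>. ?R \<omega> / \<sigma> n) = expectation ?R / \<sigma> n" by simp
  also have "expectation ?R \<le> norm2 M ?R"
    using expectation_abs_le_norm2[OF sqR] R0 by simp
  also have "norm2 M ?R \<le> \<delta> n * sqrt (real n) + C n" using err[of n] by (simp add: S_def T_def)
  finally show ?thesis using K \<sigma>_nonneg[of n] by (simp add: divide_right_mono mult_left_mono)
qed

text \<open>
  Between two grid times the path moves by at most the maximal oscillation of the block sums there. Its
  fourth moment is of order \<open>1 / p\<^sup>2\<close> in each of the \<open>p\<close> intervals, so the sum over the intervals is of order
  \<open>1 / p\<close>. This is the tightness part of the argument.
\<close>

lemma oscillation_error:
  assumes H: "Lipschitz_D01 K H" and B: "\<And>x. x \<in> cadlag01 \<Longrightarrow> \<bar>H x\<bar> \<le> B" and K: "0 \<le> K"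
    and p: "p \<ge> 1" and \<eta>: "\<eta> > 0" and \<sigma>p: "\<sigma> n > 0"
  shows "\<bar>expectation (\<lambda>\<omega>. H (step_path n (\<lambda>j. T n j \<omega> / \<sigma> n)))
      - expectation (\<lambda>\<omega>. H (step_path p (\<lambda>i. T n ((n * i) div p) \<omega> / \<sigma> n)))\<bar>
    \<le> K * (\<eta> + (\<Sum>i<p. 512 * (3 * (increment_variance p n i / (\<sigma> n)\<^sup>2)\<^sup>2
        + (C n / \<sigma> n)\<^sup>2 * (increment_variance p n i / (\<sigma> n)\<^sup>2))) / \<eta> ^ 3)"
proof -
  define O' where "O' i \<omega> = running_max (\<lambda>j. \<bar>\<Sum>l\<in>{\<kappa> n p i..<\<kappa> n p i + j}. V n l \<omega>\<bar> ^ 4) (\<kappa> n p (Suc i) - \<kappa> n p i)" for i \<omega>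
  have intO: "integrable M (O' i)" for i
    unfolding O'_def[abs_def]
  proof (rule integrable_running_max)
    fix j
    have "integrable M (\<lambda>\<omega>. \<bar>V n l \<omega>\<bar> ^ 4)" for l
    proof (rule integrable_const_bound[of _ "C n ^ 4", OF AE_I2])
      show "norm (\<bar>V n l \<omega>\<bar> ^ 4) \<le> C n ^ 4" for \<omega>
        unfolding real_norm_def power_abs abs_idempotent by (intro power_mono bV) simp
    qed simp
    then show "integrable M (\<lambda>\<omega>. \<bar>\<Sum>l\<in>{\<kappa> n p i..<\<kappa> n p i + j}. V n l \<omega>\<bar> ^ 4)"
      by (intro integrable_power_partial_sum) auto
  qed
  have O0: "0 \<le> O' i \<omega>" for i \<omega> unfolding O'_def by (intro running_max_nonneg) simp
  define R where "R \<omega> = \<eta> + (\<Sum>i<p. O' i \<omega> / (\<sigma> n) ^ 4) / \<eta> ^ 3" for \<omega>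
  have sum0: "0 \<le> (\<Sum>i<p. O' i \<omega> / (\<sigma> n) ^ 4) / \<eta> ^ 3" for \<omega>
    using O0 \<eta> \<sigma>p by (intro divide_nonneg_nonneg sum_nonneg) auto
  have "\<bar>expectation (\<lambda>\<omega>. H (step_path n (\<lambda>j. T n j \<omega> / \<sigma> n)))
      - expectation (\<lambda>\<omega>. H (step_path p (\<lambda>i. T n ((n * i) div p) \<omega> / \<sigma> n)))\<bar> \<le> K * expectation R"
  proof (rule expectation_Lipschitz[OF H B K])
    show "integrable M R" unfolding R_def using intO by simp
    show "0 \<le> R \<omega>" for \<omega> unfolding R_def using sum0 \<eta> by (simp add: add_nonneg_nonneg)
    fix \<omega>
    show "near (step_path n (\<lambda>j. T n j \<omega> / \<sigma> n)) (step_path p (\<lambda>i. T n ((n * i) div p) \<omega> / \<sigma> n)) (R \<omega>)"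
      unfolding near_def
    proof
      fix t :: real assume t: "t \<in> {0..1}"
      define i where "i = nat \<lfloor>real p * t\<rfloor>"
      define k where "k = nat \<lfloor>real n * t\<rfloor>"
      have i: "real i \<le> real p * t" "real p * t < real i + 1" "i \<le> p"
        using t step_index_le[OF t, of p] unfolding i_def by (auto simp: of_nat_nat)
      have "\<bar>T n k \<omega> / \<sigma> n - T n ((n * i) div p) \<omega> / \<sigma> n\<bar> \<le> R \<omega>"
      (* at t = 1 both paths have their final value *)
      proof (cases "i = p")
        case True
        then have "t = 1" using i(1) t p by simp
        then have "k = (n * i) div p" using True p by (simp add: k_def)
        then show ?thesis using sum0[of \<omega>] \<eta> by (simp add: R_def)
      next
        case False
        then have ip: "i < p" using i by simp
        have lo: "(n * i) div p \<le> k"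
        proof -
          have "real n * (real i / real p) \<le> real n * t"
            using i(1) p by (intro mult_left_mono) (auto simp: divide_le_eq mult.commute)
          then show ?thesis unfolding floor_fraction[symmetric] k_def by (intro nat_mono floor_mono)
        qed
        have hi: "k \<le> (n * Suc i) div p"
        proof -
          have "t \<le> real (Suc i) / real p" using i(2) p by (simp add: le_divide_eq mult.commute)
          then have "real n * t \<le> real n * (real (Suc i) / real p)" by (intro mult_left_mono) auto
          then show ?thesis unfolding floor_fraction[symmetric] k_def by (intro nat_mono floor_mono)
        qed
        let ?u = "\<kappa> n p i" and ?k = "k div L n"
        have uk: "?u \<le> ?k" "?k \<le> \<kappa> n p (Suc i)"
          unfolding \<kappa>_def using lo hi by (auto intro: div_le_mono)
        have "T n k \<omega> - T n ((n * i) div p) \<omega> = (\<Sum>l\<in>{?u..<?k}. V n l \<omega>)"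
          using sum_diff_nat_ivl[of 0 ?u ?k "\<lambda>l. V n l \<omega>"] uk by (simp add: T_def \<kappa>_def lessThan_atLeast0)
        also have "\<dots> = (\<Sum>l\<in>{?u..<?u + (?k - ?u)}. V n l \<omega>)" using uk by simp
        finally have D: "\<bar>T n k \<omega> - T n ((n * i) div p) \<omega>\<bar> ^ 4 \<le> O' i \<omega>"
          unfolding O'_def using uk running_max_ge[of "?k - ?u" "\<kappa> n p (Suc i) - ?u" "\<lambda>j. \<bar>\<Sum>l\<in>{?u..<?u + j}. V n l \<omega>\<bar> ^ 4"]
          by simp
        define y where "y = \<bar>T n k \<omega> / \<sigma> n - T n ((n * i) div p) \<omega> / \<sigma> n\<bar>"
        have y: "y = \<bar>T n k \<omega> - T n ((n * i) div p) \<omega>\<bar> / \<sigma> n"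
          using \<sigma>p by (simp add: y_def diff_divide_distrib[symmetric])
        have "y ^ 4 \<le> O' i \<omega> / (\<sigma> n) ^ 4"
          unfolding y power_divide using D \<sigma>p by (intro divide_right_mono) auto
        also have "\<dots> \<le> (\<Sum>i<p. O' i \<omega> / (\<sigma> n) ^ 4)"
          using ip O0 \<sigma>p by (intro member_le_sum[of i "{..<p}" "\<lambda>i. O' i \<omega> / (\<sigma> n) ^ 4"]) auto
        finally have "y ^ 4 / \<eta> ^ 3 \<le> (\<Sum>i<p. O' i \<omega> / (\<sigma> n) ^ 4) / \<eta> ^ 3"
          using \<eta> by (intro divide_right_mono) auto
        with le_add_fourth_power[OF \<eta>, of y] have "y \<le> R \<omega>" by (simp add: R_def y_def)
        then show ?thesis by (simp add: y_def)
      qed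
      then show "\<bar>step_path n (\<lambda>j. T n j \<omega> / \<sigma> n) t - step_path p (\<lambda>i. T n ((n * i) div p) \<omega> / \<sigma> n) t\<bar> \<le> R \<omega>"
        using t by (simp add: step_path_def i_def k_def)
    qed
  qed (auto intro!: measurable_step_path)
  also have "expectation R = \<eta> + (\<Sum>i<p. expectation (O' i) / (\<sigma> n) ^ 4) / \<eta> ^ 3"
    unfolding R_def using intO by (simp add: prob_space)
  also have "\<dots> \<le> \<eta> + (\<Sum>i<p. 512 * (3 * (increment_variance p n i / (\<sigma> n)\<^sup>2)\<^sup>2
        + (C n / \<sigma> n)\<^sup>2 * (increment_variance p n i / (\<sigma> n)\<^sup>2))) / \<eta> ^ 3"
  proof (intro add_left_mono divide_right_mono sum_mono)
    fix i
    let ?s = "increment_variance p n i"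
    have "expectation (O' i) \<le> 512 * (3 * ?s\<^sup>2 + (C n)\<^sup>2 * ?s)"
      unfolding O'_def[abs_def] increment_variance_def
      by (rule fourth_moment_oscillation[OF indV bV cV]) (simp add: \<kappa>_mono)
    then have "expectation (O' i) / (\<sigma> n) ^ 4 \<le> 512 * (3 * ?s\<^sup>2 + (C n)\<^sup>2 * ?s) / (\<sigma> n) ^ 4"
      by (intro divide_right_mono) auto
    also have "\<dots> = 512 * (3 * (?s / (\<sigma> n)\<^sup>2)\<^sup>2 + (C n / \<sigma> n)\<^sup>2 * (?s / (\<sigma> n)\<^sup>2))"
    proof -
      have "(\<sigma> n) ^ 4 = (\<sigma> n)\<^sup>2 * (\<sigma> n)\<^sup>2" by (simp flip: power_add)
      then show ?thesis using \<sigma>p by (simp add: power_divide power2_eq_square field_simps)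
    qed
    finally show "expectation (O' i) / (\<sigma> n) ^ 4 \<le> 512 * (3 * (?s / (\<sigma> n)\<^sup>2)\<^sup>2 + (C n / \<sigma> n)\<^sup>2 * (?s / (\<sigma> n)\<^sup>2))" .
  qed (use \<eta> in auto)
  finally show ?thesis using K by (simp add: mult_left_mono)
qed

text \<open>
  For a Lipschitz functional the four replacements, partial sums by block sums, block sums by their
  values on a grid, these by Brownian motion on the grid, and the latter by Brownian motion, are
  controlled one after the other. The grid is fixed first, so that the errors that depend on \<open>p\<close> alone
  are small, and then \<open>n\<close> tends to infinity.
\<close>

theorem invariance_principle:
  fixes N :: "'b measure"
  assumes BM: "standard_brownian_motion N W"
  shows "converges_in_distribution D01 M (\<lambda>n \<omega>. step_path n (\<lambda>j. S j \<omega> / \<sigma> n)) N (\<lambda>\<omega>. \<lambda>t\<in>{0..1}. W t \<omega>)"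
proof (rule converges_in_distribution_D01I[OF prob_space_axioms BM_prob_space[OF BM] _ BM_path_measurable[OF BM]])
  show "(\<lambda>\<omega>. step_path n (\<lambda>j. S j \<omega> / \<sigma> n)) \<in> measurable M (Borel_of D01)" for n
    by (intro measurable_step_path) auto
  fix H :: "(real \<Rightarrow> real) \<Rightarrow> real" and K B :: real
  assume K: "0 \<le> K" and H: "Lipschitz_D01 K H" and B: "\<And>x. x \<in> cadlag01 \<Longrightarrow> \<bar>H x\<bar> \<le> B"
  define E where "E = (\<integral>\<omega>. H (\<lambda>t\<in>{0..1}. W t \<omega>) \<partial>N)"
  define Ep where "Ep p = (\<integral>\<omega>. H (step_path p (\<lambda>i. W (real i / real p) \<omega>)) \<partial>N)" for p
  define Es where "Es n = expectation (\<lambda>\<omega>. H (step_path n (\<lambda>j. S j \<omega> / \<sigma> n)))" for n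
  define Et where "Et n = expectation (\<lambda>\<omega>. H (step_path n (\<lambda>j. T n j \<omega> / \<sigma> n)))" for n
  define Eg where "Eg p n = expectation (\<lambda>\<omega>. H (step_path p (\<lambda>i. T n ((n * i) div p) \<omega> / \<sigma> n)))" for p n
  have "Es \<longlonglongrightarrow> E"
  proof (rule LIMSEQ_I)
    fix r :: real assume r: "r > 0"
    define e where "e = r / 5"
    have e: "e > 0" using r by (simp add: e_def)
    (* the limit of the oscillation bound as n tends to infinity is K * (\<eta> + 1536 / (p * \<eta> ^ 3)),
       with 1536 = 512 * 3 from the fourth moment inequality *)
    define \<eta> where "\<eta> = e / (K + 1)"
    have \<eta>: "\<eta> > 0" "K * \<eta> < e" using e K by (auto simp: \<eta>_def field_simps add_pos_nonneg)
    have "(\<lambda>p. K * (\<eta> + 1536 * inverse (real p) / \<eta> ^ 3)) \<longlonglongrightarrow> K * (\<eta> + 1536 * 0 / \<eta> ^ 3)"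
      by (intro tendsto_intros lim_inverse_n) (use \<eta> in auto)
    then have "eventually (\<lambda>p. K * (\<eta> + 1536 * inverse (real p) / \<eta> ^ 3) < e) sequentially"
      by (rule order_tendstoD) (use \<eta> in simp)
    moreover have "eventually (\<lambda>p. dist (Ep p) E < e) sequentially"
      using BM_grid_limit[OF BM H B K] e by (auto simp: Ep_def E_def tendsto_iff)
    ultimately have "eventually (\<lambda>p. K * (\<eta> + 1536 * inverse (real p) / \<eta> ^ 3) < e \<and> dist (Ep p) E < e \<and> p \<ge> 1) sequentially"
      using eventually_ge_at_top[of 1] by eventually_elim simp
    then obtain p where p: "K * (\<eta> + 1536 * inverse (real p) / \<eta> ^ 3) < e" "dist (Ep p) E < e" "p \<ge> 1"
      unfolding eventually_sequentially by blast
    let ?osc = "\<lambda>n. K * (\<eta> + (\<Sum>i<p. 512 * (3 * (increment_variance p n i / (\<sigma> n)\<^sup>2)\<^sup>2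
        + (C n / \<sigma> n)\<^sup>2 * (increment_variance p n i / (\<sigma> n)\<^sup>2))) / \<eta> ^ 3)"
    have "?osc \<longlonglongrightarrow> K * (\<eta> + (\<Sum>i<p. 512 * (3 * (1 / real p)\<^sup>2 + 0\<^sup>2 * (1 / real p))) / \<eta> ^ 3)"
      by (intro tendsto_intros increment_variance_limit C_null) (use \<eta> in auto)
    moreover have "(\<Sum>i<p. 512 * (3 * (1 / real p)\<^sup>2 + 0\<^sup>2 * (1 / real p))) = 1536 * inverse (real p)"
      using p(3) by (simp add: power2_eq_square field_simps)
    ultimately have "?osc \<longlonglongrightarrow> K * (\<eta> + 1536 * inverse (real p) / \<eta> ^ 3)" by (simp only:)
    then have "eventually (\<lambda>n. ?osc n < e) sequentially" using p(1) by (rule order_tendstoD)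
    moreover have "eventually (\<lambda>n. K * ((\<delta> n * sqrt (real n) + C n) / \<sigma> n) < e) sequentially"
      using tendsto_mult[OF tendsto_const err_null, of K] e by (intro order_tendstoD) auto
    moreover have "eventually (\<lambda>n. dist (Eg p n) (Ep p) < e) sequentially"
      using grid_limit[OF BM p(3) H B K] e by (auto simp: Ep_def Eg_def tendsto_iff)
    ultimately have "eventually (\<lambda>n. norm (Es n - E) < r) sequentially"
      using \<sigma>_lower
    proof eventually_elim
      case (elim n)
      have "\<bar>Es n - Et n\<bar> < e"
        using block_error[OF H B K, of n] elim by (simp add: Es_def Et_def)
      moreover have "\<bar>Et n - Eg p n\<bar> < e"
        using oscillation_error[OF H B K p(3) \<eta>(1), of n] elim by (simp add: Eg_def Et_def)
      moreover have "\<bar>Eg p n - Ep p\<bar> < e" "\<bar>Ep p - E\<bar> < e" using elim p(2) by (simp_all add: dist_real_def)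
      moreover have "r = 5 * e" by (simp add: e_def)
      ultimately show ?case using e unfolding real_norm_def by linarith
    qed
    then show "\<exists>n0. \<forall>n\<ge>n0. norm (Es n - E) < r" by (simp add: eventually_sequentially)
  qed
  then show "(\<lambda>n. expectation (\<lambda>\<omega>. H (step_path n (\<lambda>j. S j \<omega> / \<sigma> n)))) \<longlonglongrightarrow> (\<integral>\<omega>. H (\<lambda>t\<in>{0..1}. W t \<omega>) \<partial>N)"
    by (simp add: Es_def[abs_def] E_def)
qed

end

section \<open>Uniformly integrable innovations and the series condition\<close>

lemma uniformly_integrable_tail:
  assumes "uniformly_integrable M I X" "e > 0"
  shows "\<exists>A\<ge>0. \<forall>i\<in>I. (\<integral>\<^sup>+\<omega>. ennreal \<bar>X i \<omega>\<bar> * indicator {\<omega>. A < \<bar>X i \<omega>\<bar>} \<omega> \<partial>M) \<le> ennreal e"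
proof -
  have "((\<lambda>A::real. SUP i\<in>I. \<integral>\<^sup>+\<omega>. ennreal \<bar>X i \<omega>\<bar> * indicator {\<omega>. A < \<bar>X i \<omega>\<bar>} \<omega> \<partial>M) \<longlongrightarrow> 0) at_top"
    using assms by (simp add: uniformly_integrable_def)
  then have "eventually (\<lambda>A::real. (SUP i\<in>I. \<integral>\<^sup>+\<omega>. ennreal \<bar>X i \<omega>\<bar> * indicator {\<omega>. A < \<bar>X i \<omega>\<bar>} \<omega> \<partial>M) < ennreal e) at_top"
    by (rule order_tendstoD) (use assms in simp)
  then obtain A0 where A0: "\<And>A. A \<ge> A0 \<Longrightarrow> (SUP i\<in>I. \<integral>\<^sup>+\<omega>. ennreal \<bar>X i \<omega>\<bar> * indicator {\<omega>. A < \<bar>X i \<omega>\<bar>} \<omega> \<partial>M) < ennreal e"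
    by (auto simp: eventually_at_top_linorder)
  show ?thesis
  proof (intro exI[of _ "max 0 A0"] conjI ballI)
    fix i assume "i \<in> I"
    then have "(\<integral>\<^sup>+\<omega>. ennreal \<bar>X i \<omega>\<bar> * indicator {\<omega>. max 0 A0 < \<bar>X i \<omega>\<bar>} \<omega> \<partial>M)
        \<le> (SUP i\<in>I. \<integral>\<^sup>+\<omega>. ennreal \<bar>X i \<omega>\<bar> * indicator {\<omega>. max 0 A0 < \<bar>X i \<omega>\<bar>} \<omega> \<partial>M)"
      by (rule SUP_upper)
    also have "\<dots> \<le> ennreal e" by (rule less_imp_le[OF A0]) simp
    finally show "(\<integral>\<^sup>+\<omega>. ennreal \<bar>X i \<omega>\<bar> * indicator {\<omega>. max 0 A0 < \<bar>X i \<omega>\<bar>} \<omega> \<partial>M) \<le> ennreal e" .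
  qed simp
qed

lemma (in prob_space) uniformly_integrable_square_integrable:
  fixes \<epsilon> :: "'i \<Rightarrow> 'a \<Rightarrow> real"
  assumes UI: "uniformly_integrable M I (\<lambda>i \<omega>. (\<epsilon> i \<omega>)\<^sup>2)" and [measurable]: "\<epsilon> i \<in> borel_measurable M" and i: "i \<in> I"
  shows "square_integrable M (\<epsilon> i)"
proof -
  obtain A where A: "A \<ge> 0" "(\<integral>\<^sup>+\<omega>. ennreal \<bar>(\<epsilon> i \<omega>)\<^sup>2\<bar> * indicator {\<omega>. A < \<bar>(\<epsilon> i \<omega>)\<^sup>2\<bar>} \<omega> \<partial>M) \<le> ennreal 1"
    using uniformly_integrable_tail[OF UI, of 1] i by auto
  have "(\<integral>\<^sup>+\<omega>. ennreal ((\<epsilon> i \<omega>)\<^sup>2) \<partial>M)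
      \<le> (\<integral>\<^sup>+\<omega>. ennreal A + ennreal \<bar>(\<epsilon> i \<omega>)\<^sup>2\<bar> * indicator {\<omega>. A < \<bar>(\<epsilon> i \<omega>)\<^sup>2\<bar>} \<omega> \<partial>M)"
  proof (rule nn_integral_mono)
    fix \<omega>
    show "ennreal ((\<epsilon> i \<omega>)\<^sup>2) \<le> ennreal A + ennreal \<bar>(\<epsilon> i \<omega>)\<^sup>2\<bar> * indicator {\<omega>. A < \<bar>(\<epsilon> i \<omega>)\<^sup>2\<bar>} \<omega>"
      by (cases "A < (\<epsilon> i \<omega>)\<^sup>2") (auto simp: ennreal_leI add_increasing)
  qed
  also have "\<dots> = (\<integral>\<^sup>+\<omega>. ennreal A \<partial>M) + (\<integral>\<^sup>+\<omega>. ennreal \<bar>(\<epsilon> i \<omega>)\<^sup>2\<bar> * indicator {\<omega>. A < \<bar>(\<epsilon> i \<omega>)\<^sup>2\<bar>} \<omega> \<partial>M)"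
    by (rule nn_integral_add) auto
  also have "\<dots> \<le> ennreal A + ennreal 1"
    using A by (intro add_mono) (auto simp: emeasure_space_1)
  also have "\<dots> < \<infinity>" by simp
  finally have "integrable M (\<lambda>\<omega>. (\<epsilon> i \<omega>)\<^sup>2)" by (intro integrableI_bounded) auto
  then show ?thesis by (simp add: square_integrable_def)
qed

lemma clip_diff: "0 \<le> B \<Longrightarrow> \<bar>x - clip B x\<bar> \<le> \<bar>x\<bar>"
  by (auto simp: clip_def max_def min_def)

text \<open>
  The clipping error is supported where \<open>(\<epsilon> i)\<^sup>2\<close> exceeds the squared clipping level, and is bounded by \<open>\<bar>\<epsilon> i\<bar>\<close> there.
\<close>

lemma (in prob_space) uniformly_integrable_clip:
  fixes \<epsilon> :: "'i \<Rightarrow> 'a \<Rightarrow> real"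
  assumes UI: "uniformly_integrable M I (\<lambda>i \<omega>. (\<epsilon> i \<omega>)\<^sup>2)" and m: "\<And>i. i \<in> I \<Longrightarrow> \<epsilon> i \<in> borel_measurable M" and e: "e > 0"
  shows "\<exists>B\<ge>0. \<forall>i\<in>I. norm2 M (\<lambda>\<omega>. \<epsilon> i \<omega> - clip B (\<epsilon> i \<omega>)) \<le> e"
proof -
  obtain A where A: "A \<ge> 0" "\<And>i. i \<in> I \<Longrightarrow> (\<integral>\<^sup>+\<omega>. ennreal \<bar>(\<epsilon> i \<omega>)\<^sup>2\<bar> * indicator {\<omega>. A < \<bar>(\<epsilon> i \<omega>)\<^sup>2\<bar>} \<omega> \<partial>M) \<le> ennreal (e\<^sup>2)"
    using uniformly_integrable_tail[OF UI, of "e\<^sup>2"] e by auto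
  show ?thesis
  proof (intro exI[of _ "sqrt A"] conjI ballI)
    fix i assume i: "i \<in> I"
    note [measurable] = m[OF i]
    have sq: "square_integrable M (\<lambda>\<omega>. \<epsilon> i \<omega> - clip (sqrt A) (\<epsilon> i \<omega>))"
      using A clip_bound[of "sqrt A"]
      by (intro square_integrable_diff uniformly_integrable_square_integrable[OF UI m[OF i] i] square_integrable_bounded) auto
    have "ennreal (expectation (\<lambda>\<omega>. (\<epsilon> i \<omega> - clip (sqrt A) (\<epsilon> i \<omega>))\<^sup>2))
        = (\<integral>\<^sup>+\<omega>. ennreal ((\<epsilon> i \<omega> - clip (sqrt A) (\<epsilon> i \<omega>))\<^sup>2) \<partial>M)"
      using sq by (intro nn_integral_eq_integral[symmetric]) auto
    also have "\<dots> \<le> (\<integral>\<^sup>+\<omega>. ennreal \<bar>(\<epsilon> i \<omega>)\<^sup>2\<bar> * indicator {\<omega>. A < \<bar>(\<epsilon> i \<omega>)\<^sup>2\<bar>} \<omega> \<partial>M)"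
    proof (rule nn_integral_mono)
      fix \<omega>
      let ?x = "\<epsilon> i \<omega>"
      show "ennreal ((?x - clip (sqrt A) ?x)\<^sup>2) \<le> ennreal \<bar>?x\<^sup>2\<bar> * indicator {\<omega>. A < \<bar>(\<epsilon> i \<omega>)\<^sup>2\<bar>} \<omega>"
      proof (cases "A < ?x\<^sup>2")
        case True
        have "\<bar>?x - clip (sqrt A) ?x\<bar> \<le> \<bar>?x\<bar>" using A(1) by (intro clip_diff) simp
        then have "(?x - clip (sqrt A) ?x)\<^sup>2 \<le> ?x\<^sup>2" by (simp add: abs_le_square_iff)
        then show ?thesis using True by (simp add: ennreal_leI)
      next
        case False
        then have "\<bar>?x\<bar> \<le> sqrt A" using real_sqrt_le_mono[of "?x\<^sup>2" A] by simp
        then show ?thesis by (auto simp: clip_def max_def min_def abs_le_iff)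
      qed
    qed
    also have "\<dots> \<le> ennreal (e\<^sup>2)" by (rule A(2)[OF i])
    finally have "expectation (\<lambda>\<omega>. (\<epsilon> i \<omega> - clip (sqrt A) (\<epsilon> i \<omega>))\<^sup>2) \<le> e\<^sup>2" by simp
    then show "norm2 M (\<lambda>\<omega>. \<epsilon> i \<omega> - clip (sqrt A) (\<epsilon> i \<omega>)) \<le> e" using e by (intro norm2_leI) auto
  qed (use A in simp)
qed

text \<open>
  Cauchy condensation: the terms decrease, and \<open>2 ^ r\<close> times the term with index \<open>2 ^ r\<close> is the \<open>r\<close>-th dyadic term.
\<close>

lemma dyadic_condensation:
  fixes c :: "real \<Rightarrow> real"
  assumes summ: "summable (\<lambda>i. \<bar>a i\<bar>)" and c: "\<And>x. 0 \<le> x \<Longrightarrow> 0 \<le> c x" "mono_on {0..} c" and s: "0 \<le> s"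
    and sum: "summable (\<lambda>j. real (Suc j) powr (- 1 / 2) * c (2 * s * tail_sum a (Suc j)))"
  shows "summable (\<lambda>r. sqrt (2 ^ r) * c (2 * s * tail_sum a (2 ^ r)))"
proof -
  have st: "summable (\<lambda>i. \<bar>a (m + i)\<bar>)" for m
    using summ summable_iff_shift[of "\<lambda>i. \<bar>a i\<bar>" m] by (simp add: add.commute)
  have t0: "0 \<le> tail_sum a m" for m unfolding tail_sum_def by (intro suminf_nonneg st) auto
  have tS: "tail_sum a (Suc m) \<le> tail_sum a m" for m
    using suminf_split_head[OF st[of m]] by (simp add: tail_sum_def)
  define g where "g k = real k powr (- 1 / 2) * c (2 * s * tail_sum a k)" for k
  have c0: "0 \<le> c (2 * s * tail_sum a k)" for k using s t0 by (intro c) simp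
  have "summable g" using sum by (subst summable_Suc_iff[symmetric]) (simp add: g_def)
  moreover have "summable g \<longleftrightarrow> summable (\<lambda>n. 2 ^ n * g (2 ^ n))"
  proof (rule condensation_test)
    fix m :: nat assume m: "0 < m"
    show "g (Suc m) \<le> g m"
      unfolding g_def
    proof (intro mult_mono c0)
      show "real (Suc m) powr (- 1 / 2) \<le> real m powr (- 1 / 2)" using m by (intro powr_mono2') auto
      show "c (2 * s * tail_sum a (Suc m)) \<le> c (2 * s * tail_sum a m)"
        using s t0 tS by (intro mono_onD[OF c(2)] mult_left_mono) auto
    qed simp
  qed (simp add: g_def c0)
  moreover have "2 ^ n * g (2 ^ n) = sqrt (2 ^ n) * c (2 * s * tail_sum a (2 ^ n))" for n
  proof -
    have "(2::real) ^ n * (2 ^ n) powr (- 1 / 2) = (2 ^ n) powr (1 / 2)"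
      using powr_add[of "2 ^ n :: real" 1 "- 1 / 2"] by simp
    also have "\<dots> = sqrt (2 ^ n)" by (simp add: powr_half_sqrt)
    finally show ?thesis by (simp add: g_def mult.assoc[symmetric])
  qed
  ultimately show ?thesis by simp
qed

section \<open>Functionals of linear processes\<close>

theorem corollary4p4:
  fixes M :: "'a measure" and \<epsilon> :: "int \<Rightarrow> 'a \<Rightarrow> real" and \<sigma>\<^sub>\<epsilon> :: real
    and a :: "nat \<Rightarrow> real" and Y :: "int \<Rightarrow> 'a \<Rightarrow> real"
    and c f h :: "real \<Rightarrow> real"
    and X S :: "nat \<Rightarrow> 'a \<Rightarrow> real" and \<sigma> :: "nat \<Rightarrow> real"
    and N :: "'b measure" and W :: "real \<Rightarrow> 'b \<Rightarrow> real"
  assumes "prob_space M"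
    and "prob_space.indep_vars M (\<lambda>_. borel) \<epsilon> UNIV"
    and "uniformly_integrable M UNIV (\<lambda>i \<omega>. (\<epsilon> i \<omega>)\<^sup>2)"
    and "bdd_above (range (\<lambda>i. norm2 M (\<epsilon> i)))"
    and "\<sigma>\<^sub>\<epsilon> = (SUP i. norm2 M (\<epsilon> i))"
    and "summable (\<lambda>i. \<bar>a i\<bar>)"
    and "\<And>k \<omega>. Y k \<omega> = (\<Sum>i. a i * \<epsilon> (k - int i) \<omega>)"
    and "c \<in> {0..} \<rightarrow> {0..}" and "concave_on {0..} c" and "mono_on {0..} c"
    and "(c \<longlongrightarrow> 0) (at 0 within {0..})"
    and "\<And>x y. \<bar>f x - f y\<bar> \<le> c \<bar>x - y\<bar>"
    and "\<And>K. K > 0 \<Longrightarrow> ereal (c (K * (\<Sum>i. \<bar>a i\<bar>))) < \<infinity>"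
    and "summable (\<lambda>j. let k = Suc j in
           real k powr (- 1 / 2) * c (2 * \<sigma>\<^sub>\<epsilon> * (\<Sum>i. \<bar>a (k + i)\<bar>)))"
    and "\<And>k \<omega>. X k \<omega> = f (Y (int k) \<omega>) - prob_space.expectation M (\<lambda>\<omega>'. f (Y (int k) \<omega>'))"
    and "\<And>n \<omega>. S n \<omega> = (\<Sum>k=1..n. X k \<omega>)"
    and "\<And>n. \<sigma> n = sqrt (prob_space.variance M (S n))"
    and "\<And>n. n \<ge> 1 \<Longrightarrow> (\<sigma> n)\<^sup>2 = real n * h (real n)"
    and "slowly_varying_at_infinity h"
    and "liminf (\<lambda>n. ereal (h (real n))) > 0"
    and "standard_brownian_motion N W"
  shows "converges_in_distribution D01
           M (\<lambda>n \<omega>. \<lambda>t\<in>{0..1}. inverse (\<sigma> n) * (\<Sum>k=1..nat \<lfloor>real n * t\<rfloor>. X k \<omega>))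
           N (\<lambda>\<omega>. \<lambda>t\<in>{0..1}. W t \<omega>)"
proof -
  interpret prob_space M by fact
  note ind = assms(2) and UI = assms(3)
  have \<epsilon>m: "\<epsilon> i \<in> borel_measurable M" for i using ind by (auto simp: indep_vars_def2)
  have n\<epsilon>: "norm2 M (\<epsilon> i) \<le> \<sigma>\<^sub>\<epsilon>" for i
    unfolding assms(5) by (rule cSUP_upper[OF _ assms(4)]) simp
  have s0: "0 \<le> \<sigma>\<^sub>\<epsilon>" using n\<epsilon>[of 0] norm2_nonneg[of M "\<epsilon> 0"] by linarith
  have c_nonneg: "0 \<le> c x" if "0 \<le> x" for x using funcset_mem[OF assms(8), of x] that by simp
  have c_small: "\<exists>d>0. \<forall>x. 0 < x \<and> x \<le> d \<longrightarrow> c x < e" if "e > 0" for e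
  proof -
    have "eventually (\<lambda>x. c x < e) (at 0 within {0..})"
      by (rule order_tendstoD(2)[OF assms(11) that])
    then obtain d where d: "d > 0" "\<And>x. x \<in> {0..} \<Longrightarrow> x \<noteq> 0 \<Longrightarrow> dist x 0 < d \<Longrightarrow> c x < e"
      by (auto simp: eventually_at)
    then show ?thesis by (intro exI[of _ "d / 2"]) (auto simp: dist_real_def)
  qed
  (* the limit at 0 does not involve the value there; monotonicity does *)
  have c0: "c 0 = 0"
  proof (rule antisym)
    show "c 0 \<le> 0"
    proof (rule field_le_epsilon)
      fix e :: real assume "e > 0"
      then obtain d where "d > 0" "c d < e" using c_small by (metis order_refl)
      moreover have "c 0 \<le> c d" using \<open>d > 0\<close> by (intro mono_onD[OF assms(10)]) auto
      ultimately show "c 0 \<le> 0 + e" by simp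
    qed
  qed (simp add: c_nonneg)
  interpret F: functional_of_linear_process M \<epsilon> \<sigma>\<^sub>\<epsilon> a Y c f
  proof unfold_locales
    show "square_integrable M (\<epsilon> i)" for i
      by (rule uniformly_integrable_square_integrable[OF UI \<epsilon>m]) simp
    show "\<exists>B\<ge>0. \<forall>i. norm2 M (\<lambda>\<omega>. \<epsilon> i \<omega> - clip B (\<epsilon> i \<omega>)) \<le> e" if "e > 0" for e
      using uniformly_integrable_clip[OF UI \<epsilon>m that] by auto
    show "\<exists>d>0. \<forall>x. 0 \<le> x \<and> x \<le> d \<longrightarrow> c x \<le> e" if "e > 0" for e
      using c_small[OF that] c0 that by (metis less_eq_real_def)
    show "summable (\<lambda>r. sqrt (2 ^ r) * c (2 * \<sigma>\<^sub>\<epsilon> * tail_sum a (2 ^ r)))"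
      by (rule dyadic_condensation[OF assms(6) c_nonneg assms(10) s0])
        (use assms(14) in \<open>simp_all add: tail_sum_def Let_def\<close>)
  qed (use assms c0 n\<epsilon> in auto)
  define x where "x k = F.centered (Y (int (Suc k)))" for k
  have xX: "x k \<omega> = X (Suc k) \<omega>" for k \<omega> by (simp add: x_def F.centered_def assms(15))
  have Sx: "S n \<omega> = (\<Sum>k<n. x k \<omega>)" for n \<omega>
  proof -
    have "(\<Sum>k<n. X (Suc k) \<omega>) = (\<Sum>k=1..n. X k \<omega>)"
      by (rule sum.reindex_bij_witness[of _ "\<lambda>k. k - 1" Suc]) auto
    then show ?thesis by (simp add: assms(16) xX)
  qed
  have x: "square_integrable M (x k)" "expectation (x k) = 0" for k
    unfolding x_def by (rule F.centered_props[OF F.square_integrable_Y])+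
  define K where "K = sqrt 2 * c (\<sigma>\<^sub>\<epsilon> * tail_sum a 0)"
  have xK: "norm2 M (x k) \<le> K" for k
  proof -
    have t0: "F.trunc 0 k = (\<lambda>_. 0)" for k by (simp add: F.trunc_def fun_eq_iff)
    have "norm2 M (\<lambda>\<omega>. F.centered (Y (int (Suc k))) \<omega> - F.centered (F.trunc 0 (int (Suc k))) \<omega>) \<le> K"
      unfolding K_def
      by (rule F.norm2_centered_diff[OF F.square_integrable_Y F.square_integrable_trunc F.norm2_Y_trunc(2)])
    then show ?thesis by (simp add: t0 F.centered_def[of "\<lambda>_. 0"] x_def prob_space)
  qed
  have sqS: "square_integrable M (S n)" for n
    unfolding Sx[abs_def] by (intro square_integrable_sum x)
  have \<sigma>: "\<sigma> n = norm2 M (\<lambda>\<omega>. \<Sum>k<n. x k \<omega>)" for n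
  proof -
    have "expectation (S n) = 0"
      unfolding Sx[abs_def] using x square_integrable_integrable[OF x(1)] by simp
    then show ?thesis by (simp add: assms(17) norm2_def Sx)
  qed
  (* the summands are uniformly bounded in L2, so each step changes the standard deviation by at most K *)
  have lip: "\<bar>\<sigma> m - \<sigma> n\<bar> \<le> K * \<bar>real m - real n\<bar>" for m n
  proof -
    have le: "\<bar>\<sigma> n - \<sigma> m\<bar> \<le> K * \<bar>real n - real m\<bar>" if "m \<le> n" for m n
    proof -
      have "\<bar>\<sigma> n - \<sigma> m\<bar> \<le> norm2 M (\<lambda>\<omega>. (\<Sum>k<n. x k \<omega>) - (\<Sum>k<m. x k \<omega>))"
        unfolding \<sigma> by (intro norm2_diff_triangle square_integrable_sum x)
      also have "(\<lambda>\<omega>. (\<Sum>k<n. x k \<omega>) - (\<Sum>k<m. x k \<omega>)) = (\<lambda>\<omega>. \<Sum>k\<in>{m..<n}. x k \<omega>)"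
        unfolding lessThan_atLeast0 using that by (intro ext sum_diff_nat_ivl) auto
      also have "norm2 M \<dots> \<le> (\<Sum>k\<in>{m..<n}. norm2 M (x k))" by (intro norm2_sum x)
      also have "\<dots> \<le> (\<Sum>k\<in>{m..<n}. K)" by (intro sum_mono xK)
      finally show ?thesis using that by (simp add: of_nat_diff mult.commute)
    qed
    show ?thesis using le[of m n] le[of n m] by (cases "m \<le> n") (auto simp: abs_minus_commute)
  qed
  obtain h0 where h0: "h0 > 0" "eventually (\<lambda>n. h (real n) \<ge> h0) sequentially"
  proof -
    obtain z where "0 < ereal z" "ereal z < liminf (\<lambda>n. ereal (h (real n)))"
      using ereal_dense2[OF assms(20)] by auto
    then have "eventually (\<lambda>n. ereal z < ereal (h (real n))) sequentially" by (intro less_LiminfD)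
    then have "eventually (\<lambda>n. h (real n) \<ge> z) sequentially" by eventually_elim simp
    with \<open>0 < ereal z\<close> show ?thesis using that[of z] by simp
  qed
  have sv: "((\<lambda>y. h (t * y) / h y) \<longlongrightarrow> 1) at_top" if "t > 0" for t
    using assms(19) that by (simp add: slowly_varying_at_infinity_def)
  have \<sigma>0: "\<sigma> 0 = 0" by (simp add: \<sigma> norm2_def)
  obtain \<delta> L C V where blocks: "\<And>n. approximated_by_blocks x (\<delta> n) (L n) (C n) (V n)"
    and "\<delta> \<longlonglongrightarrow> 0" "(\<lambda>n. C n / sqrt (real n)) \<longlonglongrightarrow> 0"
    using diagonal_block_approximation[of x] F.approximation_by_independent_blocks
    unfolding x_def[abs_def] by blast
  interpret B: block_array M x \<delta> C L V \<sigma> h0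
  proof unfold_locales
    show "eventually (\<lambda>n. h0 * real n \<le> (\<sigma> n)\<^sup>2) sequentially"
      using h0(2) eventually_ge_at_top[of 1]
      by eventually_elim (simp add: assms(18) mult.commute mult_left_mono)
    show "(\<lambda>n. \<sigma> ((n * i) div p) / \<sigma> n) \<longlonglongrightarrow> sqrt (real i / real p)" if "1 \<le> p" "i \<le> p" for p i
      by (rule variance_ratio[where h=h, OF _ \<sigma>0 assms(18) sv h0 lip that(2,1)]) (simp_all add: \<sigma>)
  qed (use x blocks \<sigma> h0 \<open>\<delta> \<longlonglongrightarrow> 0\<close> \<open>(\<lambda>n. C n / sqrt (real n)) \<longlonglongrightarrow> 0\<close> in auto)
  have "(\<lambda>t\<in>{0..1}. inverse (\<sigma> n) * (\<Sum>k=1..nat \<lfloor>real n * t\<rfloor>. X k \<omega>)) = step_path n (\<lambda>j. B.S j \<omega> / \<sigma> n)" for n \<omega>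
    unfolding step_path_def B.S_def Sx[symmetric] assms(16) by (simp add: divide_inverse mult.commute)
  then show ?thesis using B.invariance_principle[OF assms(21)] by simp
qed

end
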